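(* Let $\Omega\subset\mathbb{R}^n$ ($n=2$ or $3$) be a bounded, open, convex polytope with a conforming, shape-regular simplicial triangulation $\mathcal{T}_h$, and let $V_h$ be the finite element space defined in the context. Let $\Lambda$ be a compact metric space and let the coefficients $A^\alpha,\bm{b}^\alpha,c^\alpha$ ($\alpha\in\Lambda$) satisfy the continuity, uniform ellipticity and Cordes conditions stated in the context, with constants $\varepsilon\in(0,1]$ and $\lambda$. Let $M_h$ be the operator defined in the context. Then for every $w_h,v_h\in V_h$, $$\langle M_h[w_h]-M_h[v_h],\,w_h-v_h\rangle\ \ge\ (1-\sqrt{1-\varepsilon})\,\|w_h-v_h\|_{\lambda,h}^2 .$$
   Context: Coefficients: $A^\alpha\in C(\bar\Omega\times\Lambda;\mathbb{R}^{n\times n})$, $\bm{b}^\alpha\in C(\bar\Omega\times\Lambda;\mathbb{R}^n)$, $c^\alpha\in C(\bar\Omega\times\Lambda)$, and $L^\alpha v=A^\alpha:D^2v+\bm{b}^\alpha\cdot\nabla v-c^\alpha v$. For matrices, $|\cdot|$ is the Frobenius norm and $A:B=\sum_{i,j}A_{ij}B_{ij}$. Uniform ellipticity: there are $\underline{\nu},\bar{\nu}>0$ with $\underline{\nu}|\bm{\xi}|^2\le\bm{\xi}^tA^\alpha(x)\bm{\xi}\le\bar{\nu}|\bm{\xi}|^2$ for all $\bm{\xi}\in\mathbb{R}^n$, a.e. $x\in\Omega$, all $\alpha\in\Lambda$. Cordes condition: 1. If $\bm{b}^\alpha\not\equiv\bm{0}$ or $c^\alpha\not\equiv0$ for some $\alpha\in\Lambda$: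 there exist $\lambda>0$ and $\varepsilon\in(0,1]$ with $$\frac{|A^\alpha|^2+|\bm{b}^\alpha|^2/(2\lambda)+(c^\alpha/\lambda)^2}{(\mathrm{tr}A^\alpha+c^\alpha/\lambda)^2}\le\frac1{n+\varepsilon}\quad\text{a.e. in }\Omega,\ \forall\alpha\in\Lambda.$$ 2. If $\bm{b}^\alpha\equiv\bm{0}$ and $c^\alpha\equiv0$ for all $\alpha\in\Lambda$: there is $\varepsilon\in(0,1]$ with $|A^\alpha|^2/(\mathrm{tr}A^\alpha)^2\le 1/(n-1+\varepsilon)$ a.e. in $\Omega$, for all $\alpha\in\Lambda$; in this case $\lambda:=0$. In case 1 set $\gamma^\alpha=\dfrac{\mathrm{tr}A^\alpha+c^\alpha/\lambda}{|A^\alpha|^2+|\bm{b}^\alpha|^2/(2\lambda)+(c^\alpha/\lambda)^2}$ for all $\alpha$; in case 2 set $\gamma^\alpha=\mathrm{tr}A^\alpha/|A^\alpha|^2$. $F_\gamma[v]:=\sup_{\alpha\in\Lambda}\gamma^\alpha(L^\alpha v-f^\alpha)$, where the functions $f^\alpha$ on $\Omega$ are such that, for every open $U\subset\Omega$ and $v\in H^2(U)$, the supremum is finite a.e. and $F_\gamma[v]\in L^2(U)$. $L_\lambda v:=\Delta v-\lambda v$. Mesh notation: a face is an $(n-1)$-dimensional subsimplex of some $K\in\mathcal{T}_h$; $\mathcal{F}_h^i$ is the set of faces not contained in $\partial\Omega$, each of the form $F=\partial K^+\cap\partial K^-$. $(\cdot,\cdot)_K$, $\langle\cdot,\cdot\rangle_F$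 are the $L^2(K)$, $L^2(F)$ inner products. Jump: $\llbracket\bm{w}\rrbracket|_F=\bm{w}^+\cdot\bm{n}^+|_F+\bm{w}^-\cdot\bm{n}^-|_F$ with $\bm{w}^\pm=\bm{w}|_{K^\pm}$, $\bm{n}^\pm$ the outward unit normal of $K^\pm$. Tangential Laplacian on a flat face with orthonormal tangential directions $\bm{t}_i$: $\Delta_Tw=\sum_{i=1}^{n-1}\partial^2w/\partial\bm{t}_i^2$. Finite element space ($\mathcal{P}_k(K)$ = polynomials of total degree at most $k$): - $n=2$, $k\ge3$: $V_h=\{v\in H_0^1(\Omega): v|_K\in\mathcal{P}_k(K)\ \forall K\in\mathcal{T}_h,\ v\text{ is }C^1\text{ at all vertices}\}$. - $n=3$, $k\ge5$: $V_h=\{v\in H_0^1(\Omega): v|_K\in\mathcal{P}_k(K)\ \forall K\in\mathcal{T}_h,\ v\text{ is }C^1\text{ on all edges},\ v\text{ is }C^2\text{ at all vertices}\}$. "$C^1$ at a vertex / on an edge" means that $v$ and $\nabla v$ there, computed from all elements containing it, coincide; "$C^2$ at a vertex" means that in addition $D^2v$ there coincide. With $V=H^2(\Omega)\cap H_0^1(\Omega)$, the operator $M_h:V+V_h\to V_h^*$ is (second derivatives and $F_\gamma$ being taken elementwise) $$\langle M_h[w],v_h\rangle=\sum_{K\in\mathcal{T}_h}(F_\gamma[w],L_\lambda v_h)_K-(2-\sqrt{1-\varepsilon})\sum_{F\in\mathcal{F}_h^i}\langle\llbracket\nabla w\rrbracket,\Delta_Tv_h-\lambda v_h\rangle_F,$$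 and $$\|v\|_{\lambda,h}^2=\sum_{K\in\mathcal{T}_h}\big(\|D^2v\|_{L^2(K)}^2+2\lambda\|\nabla v\|_{L^2(K)}^2+\lambda^2\|v\|_{L^2(K)}^2\big).$$ *)

theory Defs
  imports "HOL-Analysis.Analysis"
begin

(* Matrices are elements of real ^ 'n ^ 'n. There, the library's inner product is the
   product A : B = sum_ij A_ij B_ij and the library's norm is the Frobenius norm. *)

section \<open>Sobolev spaces\<close>

definition pderivative :: "'n \<Rightarrow> (real ^ 'n \<Rightarrow> real) \<Rightarrow> real ^ 'n \<Rightarrow> real"
  where "pderivative i u x = frechet_derivative u (at x) (axis i 1)"

definition smooth :: "(real ^ 'n \<Rightarrow> real) \<Rightarrow> bool"
  where "smooth u \<longleftrightarrow> (\<forall>is x. foldr pderivative is u differentiable at x)"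

definition test_functions :: "(real ^ 'n) set \<Rightarrow> (real ^ 'n \<Rightarrow> real) set"
  where "test_functions U =
    {\<phi>. smooth \<phi> \<and> compact (closure {x. \<phi> x \<noteq> 0}) \<and> closure {x. \<phi> x \<noteq> 0} \<subseteq> U}"

definition L2 :: "(real ^ 'n) set \<Rightarrow> (real ^ 'n \<Rightarrow> real) set"
  where "L2 U = {u. u \<in> borel_measurable (lebesgue_on U) \<and> integrable (lebesgue_on U) (\<lambda>x. (u x)\<^sup>2)}"

definition weak_partial ::
    "(real ^ 'n) set \<Rightarrow> 'n \<Rightarrow> (real ^ 'n \<Rightarrow> real) \<Rightarrow> (real ^ 'n \<Rightarrow> real) \<Rightarrow> bool"
  where "weak_partial U i u g \<longleftrightarrow>
    (\<forall>\<phi>\<in>test_functions U.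
      (LINT x|lebesgue_on U. u x * pderivative i \<phi> x) = - (LINT x|lebesgue_on U. g x * \<phi> x))"

(* H1 U u g: u lies in H^1(U) and g is (a representative of) its weak gradient *)
definition H1 :: "(real ^ 'n) set \<Rightarrow> (real ^ 'n \<Rightarrow> real) \<Rightarrow> (real ^ 'n \<Rightarrow> real ^ 'n) \<Rightarrow> bool"
  where "H1 U u g \<longleftrightarrow>
    u \<in> L2 U \<and> (\<forall>i. (\<lambda>x. g x $ i) \<in> L2 U \<and> weak_partial U i u (\<lambda>x. g x $ i))"

(* H2 U u g D: u lies in H^2(U), with weak gradient g and weak Hessian D *)
definition H2 :: "(real ^ 'n) set \<Rightarrow> (real ^ 'n \<Rightarrow> real) \<Rightarrow> (real ^ 'n \<Rightarrow> real ^ 'n) \<Rightarrow>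
    (real ^ 'n \<Rightarrow> real ^ 'n ^ 'n) \<Rightarrow> bool"
  where "H2 U u g D \<longleftrightarrow> H1 U u g \<and> (\<forall>i. H1 U (\<lambda>x. g x $ i) (\<lambda>x. D x $ i))"

(* closure of the test functions in H^1(U) *)
definition H10 :: "(real ^ 'n) set \<Rightarrow> (real ^ 'n \<Rightarrow> real) set"
  where "H10 U = {u. \<exists>g \<phi>. H1 U u g \<and> (\<forall>j. \<phi> j \<in> test_functions U) \<and>
    (\<lambda>j::nat. (LINT x|lebesgue_on U. (\<phi> j x - u x)\<^sup>2) +
       (\<Sum>i\<in>UNIV. LINT x|lebesgue_on U. (pderivative i (\<phi> j) x - g x $ i)\<^sup>2)) \<longlonglongrightarrow> 0}"


section \<open>Meshes\<close>

definition inradius :: "(real ^ 'n) set \<Rightarrow> real"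
  where "inradius K = Sup {r. 0 \<le> r \<and> (\<exists>x. cball x r \<subseteq> K)}"

definition shape_regular :: "real \<Rightarrow> (real ^ 'n) set set \<Rightarrow> bool"
  where "shape_regular \<sigma> T \<longleftrightarrow> (\<forall>K\<in>T. diameter K \<le> \<sigma> * inradius K)"

(* The library's triangulation is a finite set of (closed) simplices any two of which
   intersect in a common face. *)
definition conforming_mesh :: "(real ^ 'n) set \<Rightarrow> (real ^ 'n) set set \<Rightarrow> bool"
  where "conforming_mesh \<Omega> T \<longleftrightarrow>
    triangulation T \<and> (\<forall>K\<in>T. int CARD('n) simplex K) \<and> \<Union>T = closure \<Omega>"

definition interior_faces :: "(real ^ 'n) set \<Rightarrow> (real ^ 'n) set set \<Rightarrow> (real ^ 'n) set set"
  where "interior_faces \<Omega> T = {F. (\<exists>K\<in>T. F facet_of K) \<and> \<not> F \<subseteq> frontier \<Omega>}"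

definition outer_normal :: "(real ^ 'n) set \<Rightarrow> (real ^ 'n) set \<Rightarrow> real ^ 'n"
  where "outer_normal K F = (THE \<nu>. norm \<nu> = 1 \<and> (\<forall>x\<in>F. \<forall>y\<in>F. \<nu> \<bullet> (y - x) = 0) \<and>
    (\<forall>x\<in>F. \<forall>y\<in>K. \<nu> \<bullet> (y - x) \<le> 0))"

definition tangent_basis :: "(real ^ 'n) set \<Rightarrow> (real ^ 'n) set"
  where "tangent_basis F = (SOME B. pairwise orthogonal B \<and> (\<forall>t\<in>B. norm t = 1) \<and>
    span B = span {y - x | x y. x \<in> F \<and> y \<in> F})"

(* Surface measure on a flat face F: Lebesgue measure in orthonormal coordinates on the
   affine hull of F, built in the same way as the library's lborel, and restricted to F. *)
definition face_measure :: "(real ^ 'n) set \<Rightarrow> (real ^ 'n) measure"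
  where "face_measure F = restrict_space
    (distr (\<Pi>\<^sub>M t\<in>tangent_basis F. (lborel :: real measure)) borel
      (\<lambda>s. (SOME a. a \<in> F) + (\<Sum>t\<in>tangent_basis F. s t *\<^sub>R t))) F"


section \<open>Elementwise derivatives\<close>

(* All derivatives are taken within the closed element K, so that grad_on K u x and
   hess_on K u x are the one-sided values from K also when x is on a face, an edge or a
   vertex of K. They are unique because K has nonempty interior. *)
definition grad_on :: "(real ^ 'n) set \<Rightarrow> (real ^ 'n \<Rightarrow> real) \<Rightarrow> real ^ 'n \<Rightarrow> real ^ 'n"
  where "grad_on K u x = (\<chi> i. frechet_derivative u (at x within K) (axis i 1))"

definition hess_on :: "(real ^ 'n) set \<Rightarrow> (real ^ 'n \<Rightarrow> real) \<Rightarrow> real ^ 'n \<Rightarrow> real ^ 'n ^ 'n"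
  where "hess_on K u x = (\<chi> i. grad_on K (\<lambda>y. grad_on K u y $ i) x)"

definition L_lam :: "(real ^ 'n) set \<Rightarrow> real \<Rightarrow> (real ^ 'n \<Rightarrow> real) \<Rightarrow> real ^ 'n \<Rightarrow> real"
  where "L_lam K lam u x = trace (hess_on K u x) - lam * u x"

(* The derivative within F is determined only in directions tangential to F, and it is
   only evaluated at those. *)
definition tangential_derivative ::
    "(real ^ 'n) set \<Rightarrow> real ^ 'n \<Rightarrow> (real ^ 'n \<Rightarrow> real) \<Rightarrow> real ^ 'n \<Rightarrow> real"
  where "tangential_derivative F t u x = frechet_derivative u (at x within F) t"

definition tangential_laplacian :: "(real ^ 'n) set \<Rightarrow> (real ^ 'n \<Rightarrow> real) \<Rightarrow> real ^ 'n \<Rightarrow> real"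
  where "tangential_laplacian F u x =
    (\<Sum>t\<in>tangent_basis F. tangential_derivative F t (tangential_derivative F t u) x)"

(* The sum runs over the elements having F as a face; for an interior face these are
   the two elements K^+ and K^-. *)
definition grad_jump :: "(real ^ 'n) set set \<Rightarrow> (real ^ 'n) set \<Rightarrow> (real ^ 'n \<Rightarrow> real) \<Rightarrow> real ^ 'n \<Rightarrow> real"
  where "grad_jump T F u x = (\<Sum>K\<in>{K\<in>T. F facet_of K}. grad_on K u x \<bullet> outer_normal K F)"


section \<open>Finite element space\<close>

definition polynomials :: "nat \<Rightarrow> (real ^ 'n \<Rightarrow> real) set"
  where "polynomials k =
    {p. \<exists>c :: ('n \<Rightarrow> nat) \<Rightarrow> real. \<forall>x. p x = (\<Sum>a | (\<Sum>i\<in>UNIV. a i) \<le> k. c a * (\<Prod>i\<in>UNIV. x $ i ^ a i))}"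

(* C^1 and C^2 on a subsimplex S (a vertex {x} or an edge). The values of u itself from
   the elements containing S coincide because u is a function on the closed domain. *)
definition C1_at :: "(real ^ 'n) set set \<Rightarrow> (real ^ 'n) set \<Rightarrow> (real ^ 'n \<Rightarrow> real) \<Rightarrow> bool"
  where "C1_at T S u \<longleftrightarrow> (\<forall>K\<in>T. \<forall>K'\<in>T. S \<subseteq> K \<and> S \<subseteq> K' \<longrightarrow> (\<forall>x\<in>S. grad_on K u x = grad_on K' u x))"

definition C2_at :: "(real ^ 'n) set set \<Rightarrow> (real ^ 'n) set \<Rightarrow> (real ^ 'n \<Rightarrow> real) \<Rightarrow> bool"
  where "C2_at T S u \<longleftrightarrow> C1_at T S u \<and>
    (\<forall>K\<in>T. \<forall>K'\<in>T. S \<subseteq> K \<and> S \<subseteq> K' \<longrightarrow> (\<forall>x\<in>S. hess_on K u x = hess_on K' u x))"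

(* Requiring u to be a polynomial on each closed element selects the continuous
   representative of the H^1-class of u. Used for CARD('n) = 2 and CARD('n) = 3 only. *)
definition fe_space :: "(real ^ 'n) set \<Rightarrow> (real ^ 'n) set set \<Rightarrow> nat \<Rightarrow> (real ^ 'n \<Rightarrow> real) set"
  where "fe_space \<Omega> T k = {u. u \<in> H10 \<Omega> \<and>
    (\<forall>K\<in>T. \<exists>p\<in>polynomials k. \<forall>x\<in>K. u x = p x) \<and>
    (if CARD('n) = 2
     then \<forall>K\<in>T. \<forall>x. x extreme_point_of K \<longrightarrow> C1_at T {x} u
     else (\<forall>K\<in>T. \<forall>e. e edge_of K \<longrightarrow> C1_at T e u) \<and>
          (\<forall>K\<in>T. \<forall>x. x extreme_point_of K \<longrightarrow> C2_at T {x} u))}"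


section \<open>Coefficients\<close>

definition uniformly_elliptic ::
    "(real ^ 'n) set \<Rightarrow> 'l set \<Rightarrow> ('l \<Rightarrow> real ^ 'n \<Rightarrow> real ^ 'n ^ 'n) \<Rightarrow> bool"
  where "uniformly_elliptic \<Omega> \<Lambda> A \<longleftrightarrow> (\<exists>\<nu>1 > 0. \<exists>\<nu>2 > 0. \<forall>\<alpha>\<in>\<Lambda>. AE x in lebesgue_on \<Omega>. \<forall>\<xi>.
    \<nu>1 * (norm \<xi>)\<^sup>2 \<le> \<xi> \<bullet> (A \<alpha> x *v \<xi>) \<and> \<xi> \<bullet> (A \<alpha> x *v \<xi>) \<le> \<nu>2 * (norm \<xi>)\<^sup>2)"

definition lower_order ::
    "(real ^ 'n) set \<Rightarrow> 'l set \<Rightarrow> ('l \<Rightarrow> real ^ 'n \<Rightarrow> real ^ 'n) \<Rightarrow> ('l \<Rightarrow> real ^ 'n \<Rightarrow> real) \<Rightarrow> bool"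
  where "lower_order \<Omega> \<Lambda> b c \<longleftrightarrow> (\<exists>\<alpha>\<in>\<Lambda>. \<exists>x\<in>closure \<Omega>. b \<alpha> x \<noteq> 0 \<or> c \<alpha> x \<noteq> 0)"

(* The first conjunct in the case with lower-order terms states that the quotient is well
   defined (division by 0 yields 0 here); without such terms this follows from ellipticity. *)
definition cordes ::
    "(real ^ 'n) set \<Rightarrow> 'l set \<Rightarrow> ('l \<Rightarrow> real ^ 'n \<Rightarrow> real ^ 'n ^ 'n) \<Rightarrow> ('l \<Rightarrow> real ^ 'n \<Rightarrow> real ^ 'n) \<Rightarrow>
     ('l \<Rightarrow> real ^ 'n \<Rightarrow> real) \<Rightarrow> real \<Rightarrow> real \<Rightarrow> bool"
  where "cordes \<Omega> \<Lambda> A b c eps lam \<longleftrightarrow> 0 < eps \<and> eps \<le> 1 \<and>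
    (if lower_order \<Omega> \<Lambda> b c
     then lam > 0 \<and> (\<forall>\<alpha>\<in>\<Lambda>. AE x in lebesgue_on \<Omega>.
       trace (A \<alpha> x) + c \<alpha> x / lam \<noteq> 0 \<and>
       ((norm (A \<alpha> x))\<^sup>2 + (norm (b \<alpha> x))\<^sup>2 / (2 * lam) + (c \<alpha> x / lam)\<^sup>2)
         / (trace (A \<alpha> x) + c \<alpha> x / lam)\<^sup>2 \<le> 1 / (real CARD('n) + eps))
     else lam = 0 \<and> (\<forall>\<alpha>\<in>\<Lambda>. AE x in lebesgue_on \<Omega>.
       (norm (A \<alpha> x))\<^sup>2 / (trace (A \<alpha> x))\<^sup>2 \<le> 1 / (real CARD('n) - 1 + eps)))"

definition gamma ::
    "(real ^ 'n) set \<Rightarrow> 'l set \<Rightarrow> ('l \<Rightarrow> real ^ 'n \<Rightarrow> real ^ 'n ^ 'n) \<Rightarrow> ('l \<Rightarrow> real ^ 'n \<Rightarrow> real ^ 'n) \<Rightarrow>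
     ('l \<Rightarrow> real ^ 'n \<Rightarrow> real) \<Rightarrow> real \<Rightarrow> 'l \<Rightarrow> real ^ 'n \<Rightarrow> real"
  where "gamma \<Omega> \<Lambda> A b c lam \<alpha> x =
    (if lower_order \<Omega> \<Lambda> b c
     then (trace (A \<alpha> x) + c \<alpha> x / lam)
       / ((norm (A \<alpha> x))\<^sup>2 + (norm (b \<alpha> x))\<^sup>2 / (2 * lam) + (c \<alpha> x / lam)\<^sup>2)
     else trace (A \<alpha> x) / (norm (A \<alpha> x))\<^sup>2)"

(* L^\<alpha> and F_\<gamma> at the point x, as functions of the value r of v, of its gradient p and of
   its Hessian D at x. *)
definition L_op ::
    "('l \<Rightarrow> real ^ 'n \<Rightarrow> real ^ 'n ^ 'n) \<Rightarrow> ('l \<Rightarrow> real ^ 'n \<Rightarrow> real ^ 'n) \<Rightarrow> ('l \<Rightarrow> real ^ 'n \<Rightarrow> real) \<Rightarrow>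
     'l \<Rightarrow> real ^ 'n \<Rightarrow> real \<Rightarrow> real ^ 'n \<Rightarrow> real ^ 'n ^ 'n \<Rightarrow> real"
  where "L_op A b c \<alpha> x r p D = A \<alpha> x \<bullet> D + b \<alpha> x \<bullet> p - c \<alpha> x * r"

definition F_gamma ::
    "(real ^ 'n) set \<Rightarrow> 'l set \<Rightarrow> ('l \<Rightarrow> real ^ 'n \<Rightarrow> real ^ 'n ^ 'n) \<Rightarrow> ('l \<Rightarrow> real ^ 'n \<Rightarrow> real ^ 'n) \<Rightarrow>
     ('l \<Rightarrow> real ^ 'n \<Rightarrow> real) \<Rightarrow> ('l \<Rightarrow> real ^ 'n \<Rightarrow> real) \<Rightarrow> real \<Rightarrow>
     real ^ 'n \<Rightarrow> real \<Rightarrow> real ^ 'n \<Rightarrow> real ^ 'n ^ 'n \<Rightarrow> real"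
  where "F_gamma \<Omega> \<Lambda> A b c f lam x r p D =
    (SUP \<alpha>\<in>\<Lambda>. gamma \<Omega> \<Lambda> A b c lam \<alpha> x * (L_op A b c \<alpha> x r p D - f \<alpha> x))"

(* The real-valued SUP is meaningful only for bounded families; hence bdd_above. *)
definition admissible_rhs ::
    "(real ^ 'n) set \<Rightarrow> 'l set \<Rightarrow> ('l \<Rightarrow> real ^ 'n \<Rightarrow> real ^ 'n ^ 'n) \<Rightarrow> ('l \<Rightarrow> real ^ 'n \<Rightarrow> real ^ 'n) \<Rightarrow>
     ('l \<Rightarrow> real ^ 'n \<Rightarrow> real) \<Rightarrow> ('l \<Rightarrow> real ^ 'n \<Rightarrow> real) \<Rightarrow> real \<Rightarrow> bool"
  where "admissible_rhs \<Omega> \<Lambda> A b c f lam \<longleftrightarrow>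
    (\<forall>U v g D. open U \<and> U \<subseteq> \<Omega> \<and> H2 U v g D \<longrightarrow>
      (AE x in lebesgue_on U. bdd_above
        ((\<lambda>\<alpha>. gamma \<Omega> \<Lambda> A b c lam \<alpha> x * (L_op A b c \<alpha> x (v x) (g x) (D x) - f \<alpha> x)) ` \<Lambda>)) \<and>
      (\<lambda>x. F_gamma \<Omega> \<Lambda> A b c f lam x (v x) (g x) (D x)) \<in> L2 U)"


section \<open>The discrete operator and the norm\<close>

(* M_h ... w v is the duality pairing of M_h[w] with v. The operator is evaluated at
   elementwise smooth w only, where traces of the gradient are the one-sided values. *)
definition M_h ::
    "(real ^ 'n) set \<Rightarrow> (real ^ 'n) set set \<Rightarrow> 'l set \<Rightarrow>
     ('l \<Rightarrow> real ^ 'n \<Rightarrow> real ^ 'n ^ 'n) \<Rightarrow> ('l \<Rightarrow> real ^ 'n \<Rightarrow> real ^ 'n) \<Rightarrow>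
     ('l \<Rightarrow> real ^ 'n \<Rightarrow> real) \<Rightarrow> ('l \<Rightarrow> real ^ 'n \<Rightarrow> real) \<Rightarrow> real \<Rightarrow> real \<Rightarrow>
     (real ^ 'n \<Rightarrow> real) \<Rightarrow> (real ^ 'n \<Rightarrow> real) \<Rightarrow> real"
  where "M_h \<Omega> T \<Lambda> A b c f eps lam w v =
    (\<Sum>K\<in>T. LINT x|lebesgue_on K.
       F_gamma \<Omega> \<Lambda> A b c f lam x (w x) (grad_on K w x) (hess_on K w x) * L_lam K lam v x)
    - (2 - sqrt (1 - eps)) *
      (\<Sum>F\<in>interior_faces \<Omega> T. LINT x|face_measure F.
         grad_jump T F w x * (tangential_laplacian F v x - lam * v x))"

definition norm_h_sq :: "(real ^ 'n) set set \<Rightarrow> real \<Rightarrow> (real ^ 'n \<Rightarrow> real) \<Rightarrow> real"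
  where "norm_h_sq T lam v =
    (\<Sum>K\<in>T. (LINT x|lebesgue_on K. (norm (hess_on K v x))\<^sup>2)
          + 2 * lam * (LINT x|lebesgue_on K. (norm (grad_on K v x))\<^sup>2)
          + lam\<^sup>2 * (LINT x|lebesgue_on K. (v x)\<^sup>2))"

end

theory Submission
  imports Defs
begin

text \<open>
Let z = w - v and \<delta> = \<surd>(1 - eps). Write S for the sum over the elements of the integrals of
(L_lam z)^2, N for the squared norm of z, and J for the sum over the interior faces of the
integrals of the jump of \<nabla>z times \<Delta>_T z - \<lambda> z. Two facts carry the proof.

The Cordes condition makes every \<gamma>^\<alpha> L^\<alpha> close to L_lam: pointwise, the two operators applied to
z differ by at most \<delta> times the square root of |D^2z|^2 + 2\<lambda>|\<nabla>z|^2 + \<lambda>^2z^2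
(\<open>cordes_pointwise\<close>), and a difference of suprema inherits a bound that is uniform in \<alpha>
(\<open>SUP_diff_bound\<close>). By Young's inequality the volume terms of M_h[w] - M_h[v], tested with z,
are therefore at least S - \<delta> (S + N) / 2 (\<open>element_estimate\<close>).

On the finite element space S = N + 2 J holds exactly (\<open>mesh_identity\<close>). Subtracting the face
term (2 - \<delta>) J leaves (1 - \<delta>/2) (N + 2 J) - \<delta> N / 2 - (2 - \<delta>) J = (1 - \<delta>) N: the weight
2 - \<delta> in M_h is the one for which J cancels.

The identity S = N + 2 J rests on the fact that (\<Delta>z)^2 - |D^2z|^2 is the divergence of
\<Delta>z \<nabla>z - D^2z \<nabla>z. In a frame adapted to a face with normal n the flux of this field is
\<Delta>_T z \<partial>_n z - \<nabla>_T z \<cdot> \<nabla>_T \<partial>_n z; second derivatives in the direction n have cancelled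
(\<open>element_identity\<close>). From the two sides of an interior face z has the same tangential
derivatives, while the normals are opposite, so the sum of the two fluxes contains the jump in
place of \<partial>_n z. An integration by parts within the face turns the second term into a copy of the
first; the boundary of the face contributes nothing, because the C^1 conditions at vertices or
edges make the jump vanish there (\<open>integral_boundary_density_interior\<close>). On faces in the boundary
of \<Omega> the flux vanishes with z.

This argument needs the divergence theorem on a simplex with respect to \<open>face_measure\<close>
(\<open>simplex_divergence\<close>), the vanishing of functions of \<open>H10 \<Omega>\<close> on boundary faces
(\<open>H10_boundary_zero\<close>), and the fact that an interior face belongs to exactly two elements,
with opposite normals (\<open>sum_normals_interior_face\<close>). The divergence theorem comes from a formula
for cones: the field h(x) (x - p) with p a vertex has flux only through the facet opposite to p, and
constant directions are combinations of the fields x - p (\<open>cone_divergence\<close>).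
\<close>

section \<open>Lebesgue measure in orthonormal coordinates\<close>

interpretation lborel_prod: product_sigma_finite "\<lambda>_::'a. (lborel :: real measure)"
  by standard

abbreviation PiL :: "'a set \<Rightarrow> ('a \<Rightarrow> real) measure"
  where "PiL B \<equiv> Pi\<^sub>M B (\<lambda>_. lborel)"

text \<open>
With c = 1 this gives translation invariance; with c \<noteq> 1 it measures the slices of a cone.
\<close>

lemma PiL_affine:
  fixes B :: "'a set" and c :: real
  assumes B: "finite B" and c: "c \<noteq> 0"
  shows "density (distr (PiL B) (PiL B) (\<lambda>s. \<lambda>t\<in>B. a t + c * s t)) (\<lambda>_. ennreal (\<bar>c\<bar> ^ card B)) = PiL B"
proof (rule lborel_prod.PiM_eqI[OF B])
  fix A :: "'a \<Rightarrow> real set" assume A: "\<And>i. i \<in> B \<Longrightarrow> A i \<in> sets lborel"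
  have A': "A i \<in> sets borel" if "i \<in> B" for i using A[OF that] by simp
  let ?g = "\<lambda>s. \<lambda>t\<in>B. a t + c * s t"
  have g[measurable]: "?g \<in> PiL B \<rightarrow>\<^sub>M PiL B" by measurable
  have m: "(\<lambda>x. a i + c * x) -` A i \<in> sets borel" if "i \<in> B" for i
    using measurable_sets[of "\<lambda>x. a i + c * x" borel borel "A i"] A'[OF that] by simp
  have S: "Pi\<^sub>E B A \<in> sets (PiL B)" using A by (intro sets_PiM_I_finite B) auto
  have pre: "?g -` Pi\<^sub>E B A \<inter> space (PiL B) = Pi\<^sub>E B (\<lambda>i. (\<lambda>x. a i + c * x) -` A i)"
    by (auto simp: space_PiM PiE_iff extensional_def)
  have one: "ennreal \<bar>c\<bar> * emeasure lborel ((\<lambda>x. a i + c * x) -` A i) = emeasure lborel (A i)" if "i \<in> B" for i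
    using A'[OF that] by (subst (2) lborel_real_affine[OF c, of "a i"])
      (simp add: emeasure_density_const emeasure_distr)
  have "emeasure (density (distr (PiL B) (PiL B) ?g) (\<lambda>_. ennreal (\<bar>c\<bar> ^ card B))) (Pi\<^sub>E B A)
     = ennreal (\<bar>c\<bar> ^ card B) * emeasure (PiL B) (Pi\<^sub>E B (\<lambda>i. (\<lambda>x. a i + c * x) -` A i))"
    using S by (simp add: emeasure_density_const emeasure_distr pre)
  also have "\<dots> = (\<Prod>i\<in>B. ennreal \<bar>c\<bar>) * (\<Prod>i\<in>B. emeasure lborel ((\<lambda>x. a i + c * x) -` A i))"
    using B m by (subst lborel_prod.emeasure_PiM) (auto simp: ennreal_power)
  also have "\<dots> = (\<Prod>i\<in>B. emeasure lborel (A i))"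
    unfolding prod.distrib[symmetric] by (intro prod.cong refl one)
  finally show "emeasure (density (distr (PiL B) (PiL B) ?g) (\<lambda>_. ennreal (\<bar>c\<bar> ^ card B))) (Pi\<^sub>E B A) = (\<Prod>i\<in>B. emeasure lborel (A i))" .
qed simp

lemma nn_integral_PiL_affine:
  fixes B :: "'a set" and c :: real
  assumes B: "finite B" and c: "c \<noteq> 0" and f[measurable]: "f \<in> borel_measurable (PiL B)"
  shows "(\<integral>\<^sup>+s. f s \<partial>PiL B) = ennreal (\<bar>c\<bar> ^ card B) * (\<integral>\<^sup>+s. f (\<lambda>t\<in>B. a t + c * s t) \<partial>PiL B)"
proof -
  have g[measurable]: "(\<lambda>s. \<lambda>t\<in>B. a t + c * s t) \<in> PiL B \<rightarrow>\<^sub>M PiL B" by measurable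
  show ?thesis
    by (subst PiL_affine[OF B c, of a, symmetric]) (simp add: nn_integral_density nn_integral_distr nn_integral_cmult)
qed

text \<open>
Uniqueness of translation invariant measures: the integral of 1_b(x) 1_X(x + y), with b the unit
ball, is |b| M(X) when y is integrated first. After a shift of x it becomes |X| M(b), because b is
symmetric. The balls of other radii are there for sigma-finiteness.
\<close>

lemma translation_invariant_eq_lborel:
  fixes M :: "'a::euclidean_space measure"
  assumes sets[measurable_cong]: "sets M = sets borel"
    and inv: "\<And>a. distr M borel (\<lambda>x. a + x) = M"
    and cball: "\<And>r. r > 0 \<Longrightarrow> emeasure M (cball 0 r) = emeasure lborel (cball (0::'a) r)"
  shows "M = lborel"
proof (rule measure_eqI)
  show "sets M = sets lborel" using sets by simp
  have fin: "emeasure lborel (cball (0::'a) r) < \<infinity>" for r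
    using emeasure_bounded_finite[of "cball (0::'a) r"] by auto
  interpret sigma_finite_measure M
  proof
    have "emeasure M (cball 0 (real (Suc n))) \<noteq> \<infinity>" for n
      using less_imp_neq[OF fin[of "real (Suc n)"]] by (subst cball) (simp_all del: of_nat_Suc)
    moreover have "(\<Union>n. cball (0::'a) (real (Suc n))) = UNIV"
    proof -
      have "x \<in> (\<Union>n. cball (0::'a) (real (Suc n)))" for x
      proof -
        obtain n where "norm x \<le> real n" using real_arch_simple by blast
        then have "x \<in> cball 0 (real (Suc n))" by simp
        then show ?thesis by (rule UN_I[OF UNIV_I])
      qed
      then show ?thesis by blast
    qed
    ultimately show "\<exists>A. countable A \<and> A \<subseteq> sets M \<and> \<Union>A = space M \<and> (\<forall>a\<in>A. emeasure M a \<noteq> \<infinity>)"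
      using sets sets_eq_imp_space_eq[OF sets] by (intro exI[of _ "range (\<lambda>n. cball 0 (real (Suc n)))"]) auto
  qed
  interpret pair_sigma_finite M lborel ..
  let ?b = "cball (0::'a) 1"
  fix X assume "X \<in> sets M"
  then have X[measurable]: "X \<in> sets borel" using sets by simp
  have mtrans: "(\<integral>\<^sup>+y. g y \<partial>M) = (\<integral>\<^sup>+y. g (a + y) \<partial>M)" if [measurable]: "g \<in> borel_measurable borel" for g :: "'a \<Rightarrow> ennreal" and a
    by (subst inv[of a, symmetric]) (simp add: nn_integral_distr)
  have ltrans: "(\<integral>\<^sup>+y. g y \<partial>lborel) = (\<integral>\<^sup>+y. g (a + y) \<partial>lborel)" if [measurable]: "g \<in> borel_measurable borel" for g :: "'a \<Rightarrow> ennreal" and a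
    by (subst lborel_affine[of 1 a]) (simp_all add: density_1 nn_integral_distr)
  have Fub: "(\<integral>\<^sup>+x. \<integral>\<^sup>+y. g x y \<partial>M \<partial>lborel) = (\<integral>\<^sup>+y. \<integral>\<^sup>+x. g x y \<partial>lborel \<partial>M)"
    if [measurable]: "(\<lambda>(x, y). g x y) \<in> borel_measurable (borel \<Otimes>\<^sub>M borel)" for g :: "'a \<Rightarrow> 'a \<Rightarrow> ennreal"
    by (rule Fubini'[where f="\<lambda>y x. g x y"]) measurable
  let ?I = "indicator :: 'a set \<Rightarrow> 'a \<Rightarrow> ennreal"
  have ind: "(\<lambda>x. ?I S (g x)) \<in> borel_measurable N" if "g \<in> N \<rightarrow>\<^sub>M borel" "S \<in> sets borel" for g S and N :: "'z measure"
    using measurable_compose[OF that(1) borel_measurable_indicator[OF that(2)]] .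
  have "emeasure lborel ?b * emeasure M X = (\<integral>\<^sup>+x. ?I ?b x * emeasure M X \<partial>lborel)"
    by (subst nn_integral_multc) (auto intro!: borel_measurable_indicator)
  also have "\<dots> = (\<integral>\<^sup>+x. \<integral>\<^sup>+y. ?I ?b x * ?I X y \<partial>M \<partial>lborel)"
    using X sets by (intro nn_integral_cong, subst nn_integral_cmult) (auto intro!: borel_measurable_indicator)
  also have "\<dots> = (\<integral>\<^sup>+x. \<integral>\<^sup>+y. ?I ?b x * ?I X (x + y) \<partial>M \<partial>lborel)"
    by (intro nn_integral_cong mtrans borel_measurable_times_ennreal ind) (use X in measurable)
  also have "\<dots> = (\<integral>\<^sup>+y. \<integral>\<^sup>+x. ?I ?b x * ?I X (x + y) \<partial>lborel \<partial>M)"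
    by (rule Fub, unfold case_prod_beta', intro borel_measurable_times_ennreal ind) (use X in measurable)
  also have "\<dots> = (\<integral>\<^sup>+y. \<integral>\<^sup>+x. ?I ?b (- y + x) * ?I X (- y + x + y) \<partial>lborel \<partial>M)"
    by (intro nn_integral_cong ltrans borel_measurable_times_ennreal ind) (use X in measurable)
  also have "\<dots> = (\<integral>\<^sup>+y. \<integral>\<^sup>+x. ?I ?b (- x + y) * ?I X x \<partial>lborel \<partial>M)"
    by (intro nn_integral_cong) (simp add: indicator_def norm_minus_commute)
  also have "\<dots> = (\<integral>\<^sup>+x. \<integral>\<^sup>+y. ?I ?b (- x + y) * ?I X x \<partial>M \<partial>lborel)"
    by (rule Fub[symmetric], unfold case_prod_beta', intro borel_measurable_times_ennreal ind) (use X in measurable)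
  also have "\<dots> = (\<integral>\<^sup>+x. \<integral>\<^sup>+y. ?I ?b (- x + (x + y)) * ?I X x \<partial>M \<partial>lborel)"
    by (intro nn_integral_cong mtrans borel_measurable_times_ennreal ind) (use X in measurable)
  also have "\<dots> = emeasure M ?b * emeasure lborel X"
  proof -
    have bM: "?b \<in> sets M" unfolding sets by simp
    have "(\<integral>\<^sup>+y. ?I ?b (- x + (x + y)) * ?I X x \<partial>M) = emeasure M ?b * ?I X x" for x
    proof -
      have "(\<integral>\<^sup>+y. ?I ?b (- x + (x + y)) * ?I X x \<partial>M) = (\<integral>\<^sup>+y. ?I ?b y * ?I X x \<partial>M)"
        by (simp only: minus_add_cancel)
      also have "\<dots> = emeasure M ?b * ?I X x"
        by (subst nn_integral_multc[OF borel_measurable_indicator[OF bM]]) (simp only: nn_integral_indicator[OF bM])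
      finally show ?thesis .
    qed
    moreover have "(\<integral>\<^sup>+x. emeasure M ?b * ?I X x \<partial>lborel) = emeasure M ?b * emeasure lborel X"
      using X by (intro nn_integral_cmult_indicator) simp
    ultimately show ?thesis by (simp only:)
  qed
  also have "\<dots> = emeasure lborel ?b * emeasure lborel X" using cball[of 1] by simp
  finally have eq: "emeasure lborel ?b * emeasure M X = emeasure lborel ?b * emeasure lborel X" .
  have "emeasure lborel ?b \<noteq> 0" by (simp add: emeasure_cball) (metis less_irrefl of_nat_0_le_iff unit_ball_vol_pos)
  then show "emeasure M X = emeasure lborel X"
    using eq less_imp_neq[OF fin[of 1]] by (auto simp: ennreal_mult_cancel_left)
qed

definition orthonormal :: "'a::euclidean_space set \<Rightarrow> bool"
  where "orthonormal B \<longleftrightarrow> pairwise orthogonal B \<and> (\<forall>t\<in>B. norm t = 1)"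

lemma orthonormal_independent: "orthonormal B \<Longrightarrow> independent B"
  unfolding orthonormal_def by (rule pairwise_orthogonal_independent) auto

lemma orthonormal_finite: "orthonormal B \<Longrightarrow> finite B"
  using orthonormal_independent independent_imp_finite by blast

lemma orthonormal_inner: "orthonormal B \<Longrightarrow> s \<in> B \<Longrightarrow> t \<in> B \<Longrightarrow> s \<bullet> t = (if s = t then 1 else 0)"
  unfolding orthonormal_def pairwise_def orthogonal_def by (auto simp: dot_square_norm)

lemma orthonormal_insert:
  assumes B: "orthonormal B" and nu: "norm \<nu> = 1" "\<And>t. t \<in> B \<Longrightarrow> \<nu> \<bullet> t = 0"
  shows "\<nu> \<notin> B" "orthonormal (insert \<nu> B)"
proof -
  show "\<nu> \<notin> B" using nu by (metis inner_eq_zero_iff norm_zero zero_neq_one)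
  show "orthonormal (insert \<nu> B)" using B nu
    unfolding orthonormal_def pairwise_insert by (auto simp: orthogonal_def inner_commute)
qed

lemma orthonormal_span:
  fixes B :: "'a::euclidean_space set"
  assumes "orthonormal B" "card B = DIM('a)" shows "span B = UNIV"
  using orthonormal_independent[OF assms(1)] assms(2) card_eq_dim[of B UNIV] orthonormal_finite[OF assms(1)] by auto

lemma orthonormal_expand:
  fixes B :: "'a::euclidean_space set"
  assumes B: "orthonormal B" and x: "x \<in> span B" shows "x = (\<Sum>t\<in>B. (x \<bullet> t) *\<^sub>R t)"
proof -
  have fB: "finite B" using B by (rule orthonormal_finite)
  from x obtain c where c: "x = (\<Sum>t\<in>B. c t *\<^sub>R t)" using span_finite[OF fB] by auto
  have "x \<bullet> s = c s" if "s \<in> B" for s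
  proof -
    have "x \<bullet> s = (\<Sum>t\<in>B. if t = s then c t else 0)" unfolding c inner_sum_left
      using orthonormal_inner[OF B _ that] by (intro sum.cong) auto
    then show ?thesis using fB that by simp
  qed
  then show ?thesis using c by (metis (no_types, lifting) sum.cong)
qed

lemma orthonormal_norm_sum:
  assumes B: "orthonormal B" shows "norm (\<Sum>t\<in>B. s t *\<^sub>R t) = sqrt (\<Sum>t\<in>B. (s t)\<^sup>2)"
proof -
  have "(norm (\<Sum>t\<in>B. s t *\<^sub>R t))\<^sup>2 = (\<Sum>t\<in>B. (norm (s t *\<^sub>R t))\<^sup>2)"
    using B orthonormal_finite[OF B] unfolding orthonormal_def
    by (intro norm_sum_Pythagorean) (auto simp: pairwise_def orthogonal_def)
  also have "\<dots> = (\<Sum>t\<in>B. (s t)\<^sup>2)" using B by (intro sum.cong) (auto simp: orthonormal_def)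
  finally show ?thesis by (intro real_sqrt_unique[symmetric]) auto
qed

text \<open>
Rotation invariance of Lebesgue measure. The image measure is translation invariant, and the volume
of a ball in a product of Lebesgue measures depends on the index set only through its cardinality.
\<close>

lemma lborel_eq_orthonormal:
  fixes E :: "'a::euclidean_space set"
  assumes E: "orthonormal E" and card: "card E = DIM('a)"
  shows "distr (PiL E) borel (\<lambda>s. \<Sum>e\<in>E. s e *\<^sub>R e) = lborel"
proof (rule translation_invariant_eq_lborel)
  note fE = orthonormal_finite[OF E]
  let ?L = "\<lambda>s. \<Sum>e\<in>E. s e *\<^sub>R e :: 'a"
  have m[measurable]: "?L \<in> PiL E \<rightarrow>\<^sub>M borel" by measurable
  show "distr (distr (PiL E) borel ?L) borel (\<lambda>x. a + x) = distr (PiL E) borel ?L" for a :: 'a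
  proof -
    have "a \<in> span E" using orthonormal_span[OF E card] by simp
    from orthonormal_expand[OF E this] have a: "a = (\<Sum>t\<in>E. (a \<bullet> t) *\<^sub>R t)" .
    let ?g = "\<lambda>s. \<lambda>t\<in>E. a \<bullet> t + 1 * s t"
    have [measurable]: "?g \<in> PiL E \<rightarrow>\<^sub>M PiL E" by measurable
    have "distr (distr (PiL E) borel ?L) borel (\<lambda>x. a + x) = distr (PiL E) borel (\<lambda>s. a + ?L s)"
      by (subst distr_distr) (auto simp: comp_def)
    also have "(\<lambda>s. a + ?L s) = (\<lambda>s. ?L (?g s))"
    proof
      fix s
      have "?L (?g s) = (\<Sum>t\<in>E. (a \<bullet> t) *\<^sub>R t) + ?L s"
        unfolding sum.distrib[symmetric] by (intro sum.cong) (auto simp: scaleR_add_left)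
      then show "a + ?L s = ?L (?g s)" by (simp only: a[symmetric])
    qed
    also have "distr (PiL E) borel \<dots> = distr (distr (PiL E) (PiL E) ?g) borel ?L"
      by (subst distr_distr) (auto simp: comp_def)
    also have "distr (PiL E) (PiL E) ?g = PiL E"
      using PiL_affine[OF fE, of 1 "\<lambda>t. a \<bullet> t"] by (simp add: density_1)
    finally show ?thesis .
  qed
  show "emeasure (distr (PiL E) borel ?L) (cball 0 r) = emeasure lborel (cball (0::'a) r)" if "r > 0" for r
  proof -
    have "emeasure (distr (PiL E) borel ?L) (cball 0 r) = emeasure (PiL E) ({s. sqrt (\<Sum>t\<in>E. (s t)\<^sup>2) \<le> r} \<inter> space (PiL E))"
      by (subst emeasure_distr) (auto simp: orthonormal_norm_sum[OF E] intro!: arg_cong[where f="emeasure _"])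
    then show ?thesis using emeasure_cball_aux[OF fE that] emeasure_cball[of r "0::'a"] that card by simp
  qed
qed simp

section \<open>Integration over cones\<close>

text \<open>
Affine coordinates in the plane through \<open>a\<close> spanned by \<open>B\<close>. For B = tangent_basis F they are
the coordinates used by \<open>face_measure\<close>.
\<close>

definition frame_map :: "'a::euclidean_space set \<Rightarrow> 'a \<Rightarrow> ('a \<Rightarrow> real) \<Rightarrow> 'a"
  where "frame_map B a s = a + (\<Sum>t\<in>B. s t *\<^sub>R t)"

lemma frame_map_measurable[measurable (raw)]:
  assumes f: "f \<in> N \<rightarrow>\<^sub>M borel" and g: "g \<in> N \<rightarrow>\<^sub>M PiL B"
  shows "(\<lambda>x. frame_map B (f x) (g x)) \<in> N \<rightarrow>\<^sub>M borel"
proof -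
  have "(\<lambda>x. g x t) \<in> N \<rightarrow>\<^sub>M borel" if "t \<in> B" for t
    using measurable_compose[OF g measurable_component_singleton[OF that]] by simp
  then show ?thesis unfolding frame_map_def by (intro borel_measurable_add borel_measurable_sum borel_measurable_scaleR f measurable_const) auto
qed

text \<open>
Fubini's theorem for slices orthogonal to \<nu>.
\<close>

lemma nn_integral_frame:
  fixes B :: "'a::euclidean_space set"
  assumes B: "orthonormal B" and nu: "norm \<nu> = 1" "\<And>t. t \<in> B \<Longrightarrow> \<nu> \<bullet> t = 0" and card: "Suc (card B) = DIM('a)"
    and [measurable]: "h \<in> borel_measurable borel"
  shows "(\<integral>\<^sup>+x. h x \<partial>lborel) = (\<integral>\<^sup>+\<tau>. \<integral>\<^sup>+s. h (frame_map B (p + \<tau> *\<^sub>R \<nu>) s) \<partial>PiL B \<partial>lborel)"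
proof -
  have fB: "finite B" by (rule orthonormal_finite[OF B])
  have nB: "\<nu> \<notin> B" and E: "orthonormal (insert \<nu> B)" using orthonormal_insert[OF B nu] by blast+
  have cE: "card (insert \<nu> B) = DIM('a)" using nB fB card by simp
  have [measurable]: "(\<lambda>s. \<Sum>e\<in>insert \<nu> B. s e *\<^sub>R e) \<in> PiL (insert \<nu> B) \<rightarrow>\<^sub>M borel" by measurable
  have "(\<integral>\<^sup>+x. h x \<partial>lborel) = (\<integral>\<^sup>+x. h (p + x) \<partial>lborel)"
    by (subst lborel_affine[of 1 p]) (simp_all add: density_1 nn_integral_distr)
  also have "\<dots> = (\<integral>\<^sup>+s. h (p + (\<Sum>e\<in>insert \<nu> B. s e *\<^sub>R e)) \<partial>PiL (insert \<nu> B))"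
    by (subst lborel_eq_orthonormal[OF E cE, symmetric]) (simp add: nn_integral_distr)
  also have "\<dots> = (\<integral>\<^sup>+\<tau>. \<integral>\<^sup>+s. h (p + (\<Sum>e\<in>insert \<nu> B. (s(\<nu> := \<tau>)) e *\<^sub>R e)) \<partial>PiL B \<partial>lborel)"
    by (rule lborel_prod.product_nn_integral_insert_rev[OF fB nB]) measurable
  also have "\<dots> = (\<integral>\<^sup>+\<tau>. \<integral>\<^sup>+s. h (frame_map B (p + \<tau> *\<^sub>R \<nu>) s) \<partial>PiL B \<partial>lborel)"
  proof (intro nn_integral_cong arg_cong[where f=h])
    fix \<tau> s
    have "(\<Sum>e\<in>B. (s(\<nu> := \<tau>)) e *\<^sub>R e) = (\<Sum>e\<in>B. s e *\<^sub>R e)" using nB by (intro sum.cong) auto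
    then show "p + (\<Sum>e\<in>insert \<nu> B. (s(\<nu> := \<tau>)) e *\<^sub>R e) = frame_map B (p + \<tau> *\<^sub>R \<nu>) s"
      using fB nB by (simp add: frame_map_def add.assoc)
  qed
  finally show ?thesis .
qed

text \<open>
The cone with apex p over F, a subset of the hyperplane at distance d from p. The point \<open>a\<close> is the
origin of the coordinates in that hyperplane.
\<close>

locale cone =
  fixes B :: "'a::euclidean_space set" and \<nu> a p :: 'a and d :: real and F :: "'a set"
  assumes B: "orthonormal B" and nu: "norm \<nu> = 1" "\<And>t. t \<in> B \<Longrightarrow> \<nu> \<bullet> t = 0"
    and card: "Suc (card B) = DIM('a)"
    and F: "compact F" "\<And>y. y \<in> F \<Longrightarrow> \<nu> \<bullet> (y - a) = 0"
    and d: "\<nu> \<bullet> (a - p) = d" "d > 0"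
begin

definition K where "K = (\<lambda>(r, y). p + r *\<^sub>R (y - p)) ` ({0..1} \<times> F)"

lemma compact_K: "compact K"
  unfolding K_def by (intro compact_continuous_image compact_Times F) (auto intro!: continuous_intros simp: case_prod_beta')

lemma borel_F: "F \<in> sets borel" and borel_K: "K \<in> sets borel"
  using F compact_K by (auto intro: borel_compact)

lemma frame_map_height: "\<nu> \<bullet> (frame_map B a s - p) = d"
proof -
  have "\<nu> \<bullet> (\<Sum>t\<in>B. s t *\<^sub>R t) = 0" using nu by (simp add: inner_sum_right)
  then show ?thesis using d by (simp add: frame_map_def inner_simps)
qed

text \<open>
A ray from the apex meets the hyperplane once, so a point other than the apex determines r and y.
\<close>

lemma in_cone_iff:
  assumes r: "r \<noteq> 0"
  shows "p + r *\<^sub>R (frame_map B a s - p) \<in> K \<longleftrightarrow> r \<in> {0..1} \<and> frame_map B a s \<in> F"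
proof
  let ?y = "frame_map B a s"
  assume "p + r *\<^sub>R (?y - p) \<in> K"
  then obtain r' y' where 1: "r' \<in> {0..1}" "y' \<in> F" "p + r *\<^sub>R (?y - p) = p + r' *\<^sub>R (y' - p)"
    unfolding K_def by auto
  then have e: "r *\<^sub>R (?y - p) = r' *\<^sub>R (y' - p)" by simp
  have "\<nu> \<bullet> (y' - p) = d" using F(2)[OF 1(2)] d by (simp add: inner_simps)
  then have "r * d = r' * d" using arg_cong[OF e, of "\<lambda>x. \<nu> \<bullet> x"] frame_map_height by simp
  then have "r = r'" using d by simp
  then have "?y = y'" using e r by simp
  then show "r \<in> {0..1} \<and> ?y \<in> F" using 1 \<open>r = r'\<close> by simp
qed (auto simp: K_def)

lemma expand: "a - p = d *\<^sub>R \<nu> + (\<Sum>t\<in>B. ((a - p) \<bullet> t) *\<^sub>R t)"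
proof -
  have fB: "finite B" by (rule orthonormal_finite[OF B])
  have nB: "\<nu> \<notin> B" and E: "orthonormal (insert \<nu> B)" using orthonormal_insert[OF B nu] by blast+
  have cE: "card (insert \<nu> B) = DIM('a)" using nB fB card by simp
  have "a - p \<in> span (insert \<nu> B)" using orthonormal_span[OF E cE] by simp
  from orthonormal_expand[OF E this] show ?thesis using fB nB d by (simp add: inner_commute)
qed

text \<open>
The slice of the cone at distance r d from the apex is F shrunk by the factor r, so its measure is
that of F times r to the power \<open>card B\<close>. Nonnegative functions come first because Tonelli's
theorem then allows exchanging the integrals without integrability conditions.
\<close>

lemma nn_integral_cone:
  assumes [measurable]: "g \<in> borel_measurable borel"
  shows "(\<integral>\<^sup>+x. indicator K x * g x \<partial>lborel) =
    (\<integral>\<^sup>+s. \<integral>\<^sup>+r. (ennreal (indicator {0..1} r * d * r ^ card B) * indicator F (frame_map B a s)) * g (p + r *\<^sub>R (frame_map B a s - p)) \<partial>lborel \<partial>PiL B)"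
proof -
  note [measurable] = borel_F borel_K
  have fB: "finite B" by (rule orthonormal_finite[OF B])
  interpret S: sigma_finite_measure "PiL B" by (rule lborel_prod.sigma_finite[OF fB])
  let ?h = "\<lambda>x. indicator K x * g x"
  let ?y = "frame_map B a"
  have "(\<integral>\<^sup>+x. ?h x \<partial>lborel) = (\<integral>\<^sup>+\<tau>. \<integral>\<^sup>+s. ?h (frame_map B (p + \<tau> *\<^sub>R \<nu>) s) \<partial>PiL B \<partial>lborel)"
    by (rule nn_integral_frame[OF B nu card]) measurable
  also have "\<dots> = \<bar>d\<bar> * (\<integral>\<^sup>+r. \<integral>\<^sup>+s. ?h (frame_map B (p + (0 + d * r) *\<^sub>R \<nu>) s) \<partial>PiL B \<partial>lborel)"
  proof (rule nn_integral_real_affine)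
    show "(\<lambda>\<tau>. \<integral>\<^sup>+s. ?h (frame_map B (p + \<tau> *\<^sub>R \<nu>) s) \<partial>PiL B) \<in> borel_measurable borel" by measurable
    show "d \<noteq> 0" using d by simp
  qed
  also have "\<dots> = (\<integral>\<^sup>+r. d * (\<integral>\<^sup>+s. ?h (frame_map B (p + (d * r) *\<^sub>R \<nu>) s) \<partial>PiL B) \<partial>lborel)"
    using d by (subst nn_integral_cmult[symmetric]) auto
  also have "\<dots> = (\<integral>\<^sup>+r. \<integral>\<^sup>+s. (ennreal (indicator {0..1} r * d * r ^ card B) * indicator F (?y s)) * g (p + r *\<^sub>R (?y s - p)) \<partial>PiL B \<partial>lborel)"
  proof (rule nn_integral_cong_AE)
    have "AE r in lborel. r \<noteq> (0::real)" by (rule AE_lborel_singleton)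
    then show "AE r in lborel. d * (\<integral>\<^sup>+s. ?h (frame_map B (p + (d * r) *\<^sub>R \<nu>) s) \<partial>PiL B) =
       (\<integral>\<^sup>+s. (ennreal (indicator {0..1} r * d * r ^ card B) * indicator F (?y s)) * g (p + r *\<^sub>R (?y s - p)) \<partial>PiL B)"
    proof eventually_elim
      fix r :: real assume r: "r \<noteq> 0"
      \<comment> \<open>coordinates in the slice at height d r of the point that corresponds to s in F\<close>
      let ?g = "\<lambda>s. \<lambda>t\<in>B. r * ((a - p) \<bullet> t) + r * s t"
      have fm: "frame_map B (p + (d * r) *\<^sub>R \<nu>) (?g s) = p + r *\<^sub>R (?y s - p)" for s
      proof -
        have "(\<Sum>t\<in>B. ?g s t *\<^sub>R t) = r *\<^sub>R (\<Sum>t\<in>B. ((a - p) \<bullet> t) *\<^sub>R t) + r *\<^sub>R (\<Sum>t\<in>B. s t *\<^sub>R t)"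
          unfolding scaleR_sum_right sum.distrib[symmetric] by (intro sum.cong) (auto simp: algebra_simps)
        moreover have "r *\<^sub>R (?y s - p) = r *\<^sub>R (a - p) + r *\<^sub>R (\<Sum>t\<in>B. s t *\<^sub>R t)"
          by (simp add: frame_map_def algebra_simps)
        ultimately show ?thesis unfolding frame_map_def by (subst (asm) (2) expand) (simp add: algebra_simps)
      qed
      have key: "?h (p + r *\<^sub>R (?y s - p)) = indicator {0..1} r * (indicator F (?y s) * g (p + r *\<^sub>R (?y s - p)))" for s
        unfolding indicator_def in_cone_iff[OF r] by auto
      have "d * (\<integral>\<^sup>+s. ?h (frame_map B (p + (d * r) *\<^sub>R \<nu>) s) \<partial>PiL B)
         = d * (ennreal (\<bar>r\<bar> ^ card B) * (\<integral>\<^sup>+s. ?h (frame_map B (p + (d * r) *\<^sub>R \<nu>) (?g s)) \<partial>PiL B))"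
        by (subst nn_integral_PiL_affine[OF fB r, where a="\<lambda>t. r * ((a - p) \<bullet> t)"]) auto
      also have "\<dots> = d * (ennreal (\<bar>r\<bar> ^ card B) * (\<integral>\<^sup>+s. indicator {0..1} r * (indicator F (?y s) * g (p + r *\<^sub>R (?y s - p))) \<partial>PiL B))"
        unfolding fm key ..
      also have "\<dots> = (d * ennreal (\<bar>r\<bar> ^ card B) * indicator {0..1} r) * (\<integral>\<^sup>+s. (indicator F (?y s) * g (p + r *\<^sub>R (?y s - p))) \<partial>PiL B)"
        by (subst nn_integral_cmult) (auto simp: mult_ac)
      also have "(d * ennreal (\<bar>r\<bar> ^ card B) * indicator {0..1} r) = ennreal (indicator {0..1} r * d * r ^ card B)"
        using d by (auto simp: indicator_def ennreal_mult)
      also have "ennreal (indicator {0..1} r * d * r ^ card B) * (\<integral>\<^sup>+s. (indicator F (?y s) * g (p + r *\<^sub>R (?y s - p))) \<partial>PiL B) =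
        (\<integral>\<^sup>+s. (ennreal (indicator {0..1} r * d * r ^ card B) * indicator F (?y s)) * g (p + r *\<^sub>R (?y s - p)) \<partial>PiL B)"
        by (subst nn_integral_cmult[symmetric]) (auto simp: mult_ac)
      finally show "d * (\<integral>\<^sup>+s. ?h (frame_map B (p + (d * r) *\<^sub>R \<nu>) s) \<partial>PiL B) =
       (\<integral>\<^sup>+s. (ennreal (indicator {0..1} r * d * r ^ card B) * indicator F (?y s)) * g (p + r *\<^sub>R (?y s - p)) \<partial>PiL B)" .
    qed
  qed
  also have "\<dots> = (\<integral>\<^sup>+s. \<integral>\<^sup>+r. (ennreal (indicator {0..1} r * d * r ^ card B) * indicator F (?y s)) * g (p + r *\<^sub>R (?y s - p)) \<partial>lborel \<partial>PiL B)"
  proof -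
    interpret pair_sigma_finite "PiL B" "lborel :: real measure" ..
    show ?thesis
      by (rule Fubini'[where f="\<lambda>s r. (ennreal (indicator {0..1} r * d * r ^ card B) * indicator F (?y s)) * g (p + r *\<^sub>R (?y s - p))"]) measurable
  qed
  finally show ?thesis .
qed

text \<open>
The formula for nonnegative functions, applied to indicators, says that Lebesgue measure on K is an
image of a weighted product measure; integrable functions follow this identity of measures.
\<close>

lemma integral_cone:
  fixes g :: "'a \<Rightarrow> real"
  assumes g[measurable]: "g \<in> borel_measurable borel" and int: "integrable lborel (\<lambda>x. indicator K x * g x)"
  shows "(LINT x|lborel. indicator K x * g x) =
    (LINT s|PiL B. LINT r|lborel. (indicator {0..1} r * d * r ^ card B * indicator F (frame_map B a s)) * g (p + r *\<^sub>R (frame_map B a s - p)))"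
proof -
  note [measurable] = borel_F borel_K
  have fB: "finite B" by (rule orthonormal_finite[OF B])
  let ?y = "frame_map B a"
  interpret S: sigma_finite_measure "PiL B" by (rule lborel_prod.sigma_finite[OF fB])
  interpret P: pair_sigma_finite "PiL B" "lborel :: real measure" ..
  let ?w = "\<lambda>(s, r). indicator {0..1} r * d * r ^ card B * indicator F (?y s) :: real"
  let ?psi = "\<lambda>(s, r). p + r *\<^sub>R (?y s - p)"
  let ?N = "density (PiL B \<Otimes>\<^sub>M lborel) (\<lambda>z. ennreal (?w z))"
  have w0: "0 \<le> ?w z" for z using d by (auto simp: case_prod_beta' indicator_def)
  have psi[measurable]: "?psi \<in> PiL B \<Otimes>\<^sub>M lborel \<rightarrow>\<^sub>M borel" and [measurable]: "?w \<in> borel_measurable (PiL B \<Otimes>\<^sub>M lborel)"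
    unfolding case_prod_beta' by measurable
  have eq: "density lborel (\<lambda>x. ennreal (indicator K x)) = distr ?N borel ?psi" (is "?M1 = ?M2")
  proof (rule measure_eqI)
    fix X assume "X \<in> sets ?M1"
    then have [measurable]: "X \<in> sets borel" by simp
    have "emeasure ?M1 X = (\<integral>\<^sup>+x. indicator K x * indicator X x \<partial>lborel)"
      by (subst emeasure_density) (auto intro!: nn_integral_cong simp: indicator_def)
    also have "\<dots> = (\<integral>\<^sup>+s. \<integral>\<^sup>+r. (ennreal (indicator {0..1} r * d * r ^ card B) * indicator F (?y s)) * indicator X (p + r *\<^sub>R (?y s - p)) \<partial>lborel \<partial>PiL B)"
      by (rule nn_integral_cone) measurable
    also have "\<dots> = (\<integral>\<^sup>+s. \<integral>\<^sup>+r. (\<lambda>z. ennreal (?w z) * indicator X (?psi z)) (s, r) \<partial>lborel \<partial>PiL B)"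
      by (intro nn_integral_cong) (auto simp: indicator_def)
    also have "\<dots> = (\<integral>\<^sup>+z. ennreal (?w z) * indicator X (?psi z) \<partial>(PiL B \<Otimes>\<^sub>M lborel))"
      by (rule lborel.nn_integral_fst) measurable
    also have "\<dots> = (\<integral>\<^sup>+z. ennreal (?w z) * indicator (?psi -` X \<inter> space (PiL B \<Otimes>\<^sub>M lborel)) z \<partial>(PiL B \<Otimes>\<^sub>M lborel))"
      by (intro nn_integral_cong) (auto simp: indicator_def)
    also have "\<dots> = emeasure ?N (?psi -` X \<inter> space (PiL B \<Otimes>\<^sub>M lborel))"
    proof (rule emeasure_density[symmetric])
      show "(\<lambda>z. ennreal (?w z)) \<in> borel_measurable (PiL B \<Otimes>\<^sub>M lborel)" by measurable
      show "?psi -` X \<inter> space (PiL B \<Otimes>\<^sub>M lborel) \<in> sets (PiL B \<Otimes>\<^sub>M lborel)"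
        by (rule measurable_sets[OF psi \<open>X \<in> sets borel\<close>])
    qed
    also have "\<dots> = emeasure ?M2 X"
      using emeasure_distr[of ?psi ?N borel X] psi \<open>X \<in> sets borel\<close> by simp
    finally show "emeasure ?M1 X = emeasure ?M2 X" .
  qed simp
  have i1: "integrable ?M1 g"
    using int by (subst integrable_density) auto
  then have "integrable ?N (\<lambda>z. g (?psi z))"
    unfolding eq by (subst (asm) integrable_distr_eq) auto
  then have i2: "integrable (PiL B \<Otimes>\<^sub>M lborel) (\<lambda>z. ?w z * g (?psi z))"
    using w0 by (subst (asm) integrable_density) auto
  have "(LINT x|lborel. indicator K x * g x) = (LINT x|?M1. g x)"
    by (subst integral_density) auto
  also have "\<dots> = (LINT z|?N. g (?psi z))"
    unfolding eq by (subst integral_distr) auto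
  also have "\<dots> = (LINT z|(PiL B \<Otimes>\<^sub>M lborel). ?w z * g (?psi z))"
    using w0 by (subst integral_density) auto
  also have "\<dots> = (LINT s|PiL B. LINT r|lborel. ?w (s, r) * g (?psi (s, r)))"
    by (rule P.integral_fst'[OF i2, symmetric])
  finally show ?thesis by simp
qed

end

lemma integrable_compact_lborel:
  fixes f :: "'a::euclidean_space \<Rightarrow> real"
  assumes "compact S" "continuous_on UNIV f"
  shows "integrable lborel (\<lambda>x. indicator S x * f x)"
  using borel_integrable_compact[OF assms(1) continuous_on_subset[OF assms(2)]] by simp

lemma GDERIV_line:
  assumes "GDERIV h (p + r *\<^sub>R e) :> G"
  shows "((\<lambda>r. h (p + r *\<^sub>R e)) has_real_derivative (e \<bullet> G)) (at r)"
proof -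
  have "((\<lambda>r. p + r *\<^sub>R e) has_derivative (\<lambda>u. u *\<^sub>R e)) (at r)"
    by (auto intro!: derivative_eq_intros)
  from has_derivative_compose[OF this, of h "\<lambda>v. v \<bullet> G"] assms
  moreover have "(\<lambda>u. u * (e \<bullet> G)) = (*) (e \<bullet> G)" by auto
  ultimately show ?thesis by (simp add: gderiv_def has_field_derivative_def)
qed

lemma continuous_on_GDERIV:
  assumes "\<And>x. GDERIV h x :> G x" shows "continuous_on UNIV h"
  using assms unfolding gderiv_def by (meson has_derivative_continuous continuous_at_imp_continuous_on)

context cone begin

text \<open>
The integrand is the divergence of the field h(x) (x - p), which is tangential to the lateral
surface. Along the ray through y it is r^(1-n) times the derivative of r^n h(p + r (y - p)), and the
power of r is cancelled by the Jacobian of the cone.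
\<close>

lemma cone_divergence:
  fixes h :: "'a \<Rightarrow> real"
  assumes h: "\<And>x. GDERIV h x :> G x" and G: "continuous_on UNIV G"
  shows "(LINT x|lborel. indicator K x * (DIM('a) * h x + (x - p) \<bullet> G x)) =
     d * (LINT s|PiL B. indicator F (frame_map B a s) * h (frame_map B a s))"
proof -
  let ?y = "frame_map B a"
  let ?g = "\<lambda>x. DIM('a) * h x + (x - p) \<bullet> G x"
  note ch = continuous_on_GDERIV[OF h]
  have cg: "continuous_on UNIV ?g" by (intro continuous_intros ch G)
  have gm: "?g \<in> borel_measurable borel" by (rule borel_measurable_continuous_onI[OF cg])
  have inner: "(LINT r|lborel. (indicator {0..1} r * d * r ^ card B * indicator F (?y s)) * ?g (p + r *\<^sub>R (?y s - p)))
      = d * (indicator F (?y s) * h (?y s))" for s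
  proof -
    \<comment> \<open>the radial primitive of the integrand\<close>
    let ?H = "\<lambda>r::real. r ^ Suc (card B) * h (p + r *\<^sub>R (?y s - p))"
    let ?H' = "\<lambda>r. r ^ card B * ?g (p + r *\<^sub>R (?y s - p))"
    have D: "(?H has_real_derivative ?H' r) (at r)" for r
      by (rule DERIV_cong[OF DERIV_mult[OF DERIV_pow GDERIV_line[OF h]]])
        (simp add: card[symmetric] algebra_simps)
    have c: "isCont ?H' r" for r
    proof -
      have "continuous_on UNIV ?H'"
        by (intro continuous_intros continuous_on_compose2[OF ch] continuous_on_compose2[OF G]) auto
      then show ?thesis by (simp add: continuous_on_eq_continuous_at)
    qed
    have "(LINT r|lborel. ?H' r * indicator {0..1} r) = ?H 1 - ?H 0"
      by (rule integral_FTC_Icc_real) (use D c in auto)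
    then have I: "(LINT r|lborel. ?H' r * indicator {0..1} r) = h (?y s)" by simp
    have "(LINT r|lborel. (indicator {0..1} r * d * r ^ card B * indicator F (?y s)) * ?g (p + r *\<^sub>R (?y s - p)))
       = (LINT r|lborel. (d * indicator F (?y s)) * (?H' r * indicator {0..1} r))"
      by (intro Bochner_Integration.integral_cong refl) (simp only: mult_ac)
    also have "\<dots> = d * (indicator F (?y s) * h (?y s))"
      unfolding integral_mult_right_zero I by (simp only: mult.assoc)
    finally show ?thesis .
  qed
  show ?thesis
    unfolding integral_cone[OF gm integrable_compact_lborel[OF compact_K cg]] inner by simp
qed

end

section \<open>Surface integrals\<close>

lemma tangent_basis:
  fixes F :: "(real ^ 'n) set"
  shows "orthonormal (tangent_basis F)" "span (tangent_basis F) = span {y - x | x y. x \<in> F \<and> y \<in> F}"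
proof -
  let ?S = "span {y - x | x y. x \<in> F \<and> y \<in> F}"
  obtain B where "B \<subseteq> ?S" "pairwise orthogonal B" "\<And>x. x \<in> B \<Longrightarrow> norm x = 1" "span B = ?S"
    by (rule orthonormal_basis_subspace[OF subspace_span]) blast
  then have "\<exists>B. pairwise orthogonal B \<and> (\<forall>t\<in>B. norm t = 1) \<and> span B = ?S" by blast
  from someI_ex[OF this] show "orthonormal (tangent_basis F)" "span (tangent_basis F) = ?S"
    unfolding tangent_basis_def orthonormal_def by auto
qed

lemma diff_in_span_tangent_basis:
  "x \<in> F \<Longrightarrow> y \<in> F \<Longrightarrow> y - x \<in> span (tangent_basis F)"
  unfolding tangent_basis(2) by (rule span_base) auto

lemma card_tangent_basis:
  fixes F :: "(real ^ 'n) set"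
  assumes "F \<noteq> {}" shows "int (card (tangent_basis F)) = aff_dim F"
proof -
  obtain a where a: "a \<in> F" using assms by auto
  let ?D = "(\<lambda>x. x - a) ` F"
  have "span {y - x | x y. x \<in> F \<and> y \<in> F} = span ?D"
  proof (rule span_eq[THEN iffD2], intro conjI subsetI)
    fix z assume "z \<in> {y - x | x y. x \<in> F \<and> y \<in> F}"
    then obtain x y where "x \<in> F" "y \<in> F" "z = (y - a) - (x - a)" by auto
    then show "z \<in> span ?D" by (simp only:) (intro span_diff span_base imageI)
  qed (use a in \<open>auto intro: span_base\<close>)
  then have "dim (tangent_basis F) = dim ?D" using tangent_basis(2)[of F] by (metis dim_span)
  moreover have "dim (tangent_basis F) = card (tangent_basis F)"
    by (rule dim_eq_card_independent[OF orthonormal_independent[OF tangent_basis(1)]])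
  ultimately show ?thesis
    using aff_dim_eq_dim_subtract[of a F] a by (simp add: hull_inc)
qed

abbreviation face_map :: "(real ^ 'n) set \<Rightarrow> (real ^ 'n \<Rightarrow> real) \<Rightarrow> real ^ 'n"
  where "face_map F \<equiv> frame_map (tangent_basis F) (SOME a. a \<in> F)"

lemma face_measure_eq: "face_measure F = restrict_space (distr (PiL (tangent_basis F)) borel (face_map F)) F"
  unfolding face_measure_def frame_map_def ..

lemma space_face_measure: "F \<in> sets borel \<Longrightarrow> space (face_measure F) = F"
  unfolding face_measure_eq by (simp add: space_restrict_space)

lemma integral_face_cong:
  assumes "F \<in> sets borel" "\<And>x. x \<in> F \<Longrightarrow> f x = g x"
  shows "(LINT x|face_measure F. f x) = (LINT x|face_measure F. g x)"
  using assms by (intro Bochner_Integration.integral_cong refl) (simp add: space_face_measure)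

lemma integral_face:
  fixes f :: "real ^ 'n \<Rightarrow> real"
  assumes [measurable]: "F \<in> sets borel" "f \<in> borel_measurable borel"
  shows "(LINT x|face_measure F. f x) = (LINT s|PiL (tangent_basis F). indicator F (face_map F s) * f (face_map F s))"
proof -
  have "(LINT x|face_measure F. f x) = (LINT x|distr (PiL (tangent_basis F)) borel (face_map F). indicator F x * f x)"
    unfolding face_measure_eq by (subst integral_restrict_space) auto
  also have "\<dots> = (LINT s|PiL (tangent_basis F). indicator F (face_map F s) * f (face_map F s))"
    by (subst integral_distr) auto
  finally show ?thesis .
qed

lemma integrable_frame:
  fixes f :: "'a::euclidean_space \<Rightarrow> real"
  assumes B: "orthonormal B" and F: "compact F" and f: "continuous_on UNIV f"
  shows "integrable (PiL B) (\<lambda>s. indicator F (frame_map B a s) * f (frame_map B a s))"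
proof -
  note fB = orthonormal_finite[OF B]
  have [measurable]: "F \<in> sets borel" "f \<in> borel_measurable borel"
    using F f by (auto intro: borel_compact borel_measurable_continuous_onI)
  obtain R where R: "R > 0" "\<And>x. x \<in> F \<Longrightarrow> norm x \<le> R"
    using compact_imp_bounded[OF F] by (auto simp: bounded_pos)
  have "compact (f ` F)" using F f by (meson compact_continuous_image continuous_on_subset subset_UNIV)
  then obtain M where M: "M > 0" "\<And>x. x \<in> F \<Longrightarrow> norm (f x) \<le> M"
    using compact_imp_bounded[of "f ` F"] by (auto simp: bounded_pos)
  let ?A = "Pi\<^sub>E B (\<lambda>_. {- (R + norm a) .. R + norm a})"
  have coord: "s t \<in> {- (R + norm a) .. R + norm a}" if "frame_map B a s \<in> F" "t \<in> B" for s t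
  proof -
    have "\<bar>s t\<bar> = sqrt ((s t)\<^sup>2)" by simp
    also have "\<dots> \<le> sqrt (\<Sum>t\<in>B. (s t)\<^sup>2)"
      using fB that by (intro real_sqrt_le_mono member_le_sum) auto
    also have "\<dots> = norm (frame_map B a s - a)" by (simp add: frame_map_def orthonormal_norm_sum[OF B])
    also have "\<dots> \<le> R + norm a" using R(2)[OF that(1)] norm_triangle_ineq4[of "frame_map B a s" a] by linarith
    finally show ?thesis by (simp add: abs_le_iff)
  qed
  show ?thesis
  proof (rule integrableI_bounded_set[where A="?A" and B=M])
    show "?A \<in> sets (PiL B)" using fB by (intro sets_PiM_I_finite) auto
    show "emeasure (PiL B) ?A < \<infinity>"
      using fB by (subst lborel_prod.emeasure_PiM) (use R(1) in \<open>auto simp: emeasure_lborel_Icc_eq power_less_top_ennreal\<close>)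
    show "AE s in PiL B. s \<in> ?A \<longrightarrow> norm (indicator F (frame_map B a s) * f (frame_map B a s)) \<le> M"
      using M by (intro AE_I2) (auto simp: indicator_def)
    show "AE s in PiL B. s \<notin> ?A \<longrightarrow> indicator F (frame_map B a s) * f (frame_map B a s) = 0"
    proof (intro AE_I2 impI)
      fix s assume s: "s \<in> space (PiL B)" "s \<notin> ?A"
      have "frame_map B a s \<notin> F"
      proof
        assume "frame_map B a s \<in> F"
        from coord[OF this] s show False unfolding space_PiM PiE_iff by blast
      qed
      then show "indicator F (frame_map B a s) * f (frame_map B a s) = 0" by simp
    qed
  qed measurable
qed

lemma integral_face_add:
  fixes f g :: "real ^ 'n \<Rightarrow> real"
  assumes F: "compact F" and f: "continuous_on UNIV f" and g: "continuous_on UNIV g"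
  shows "(LINT x|face_measure F. f x + g x) = (LINT x|face_measure F. f x) + (LINT x|face_measure F. g x)"
proof -
  have m: "F \<in> sets borel" "f \<in> borel_measurable borel" "g \<in> borel_measurable borel" "(\<lambda>x. f x + g x) \<in> borel_measurable borel"
    using F f g by (auto intro!: borel_compact borel_measurable_continuous_onI continuous_intros)
  note i = integrable_frame[OF tangent_basis(1) F]
  show ?thesis unfolding integral_face[OF m(1,2)] integral_face[OF m(1,3)] integral_face[OF m(1,4)]
    using i[OF f] i[OF g] by (simp add: distrib_left)
qed

lemma integral_face_sum:
  fixes f :: "'i \<Rightarrow> real ^ 'n \<Rightarrow> real"
  assumes F: "compact F" and "finite I" and "\<And>i. i \<in> I \<Longrightarrow> continuous_on UNIV (f i)"
  shows "(LINT x|face_measure F. (\<Sum>i\<in>I. f i x)) = (\<Sum>i\<in>I. LINT x|face_measure F. f i x)"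
  using assms(2,3)
proof (induction I)
  case (insert i I)
  have "(LINT x|face_measure F. f i x + (\<Sum>i\<in>I. f i x)) = (LINT x|face_measure F. f i x) + (LINT x|face_measure F. (\<Sum>i\<in>I. f i x))"
    by (intro integral_face_add F continuous_intros insert) (use insert in auto)
  then show ?case using insert by simp
qed simp

section \<open>The divergence theorem on a simplex\<close>

text \<open>
A simplex of full dimension with a marked vertex p; F is the facet opposite to p.
\<close>

locale simplex_vertex =
  fixes C :: "(real ^ 'n) set" and p :: "real ^ 'n"
  assumes C: "\<not> affine_dependent C" "card C = Suc CARD('n)" and p: "p \<in> C"
begin

abbreviation "K \<equiv> convex hull C"
abbreviation "F \<equiv> convex hull (C - {p})"
abbreviation "\<nu> \<equiv> outer_normal K F"

lemma finite_C: "finite C" using C by (simp add: aff_independent_finite)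

lemma other_vertices: "C - {p} \<noteq> {}"
proof
  assume "C - {p} = {}"
  then have "card C \<le> card {p}" by (intro card_mono) auto
  then show False using C by simp
qed

lemma F_nonempty: "F \<noteq> {}" using other_vertices by simp

lemma facet: "F facet_of K"
  unfolding facet_of_convex_hull_affine_independent[OF C(1)] using other_vertices p by auto

lemma aff_dim_K: "aff_dim K = int CARD('n)"
  using C aff_dim_affine_independent[OF C(1)] by (simp add: aff_dim_convex_hull)

lemma card_tangent_basis_facet: "Suc (card (tangent_basis F)) = CARD('n)"
proof -
  have "int (card (tangent_basis F)) = aff_dim F" using other_vertices by (intro card_tangent_basis) auto
  then show ?thesis using facet aff_dim_K unfolding facet_of_def by simp
qed

lemma simplex_eq_cone: "K = {p + r *\<^sub>R (y - p) | r y. 0 \<le> r \<and> r \<le> 1 \<and> y \<in> F}"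
proof -
  have "K = convex hull (insert p (C - {p}))" using p by (simp add: insert_absorb)
  also have "\<dots> = {(1 - u) *\<^sub>R p + u *\<^sub>R x |x u. 0 \<le> u \<and> u \<le> 1 \<and> x \<in> F}"
    using other_vertices by (simp only: convex_hull_insert_alt if_False)
  also have "\<dots> = {p + r *\<^sub>R (y - p) | r y. 0 \<le> r \<and> r \<le> 1 \<and> y \<in> F}"
    by (auto simp: algebra_simps)
  finally show ?thesis .
qed

lemma normal_exists:
  obtains \<nu> where "norm \<nu> = 1" "\<And>x y. x \<in> F \<Longrightarrow> y \<in> F \<Longrightarrow> \<nu> \<bullet> (y - x) = 0"
    "\<And>x. x \<in> F \<Longrightarrow> \<nu> \<bullet> (x - p) > 0" "\<And>t. t \<in> tangent_basis F \<Longrightarrow> \<nu> \<bullet> t = 0"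
proof -
  let ?B = "tangent_basis F"
  obtain a where a: "a \<in> F" using F_nonempty by blast
  have "dim ?B < DIM(real ^ 'n)"
    using card_tangent_basis_facet orthonormal_independent[OF tangent_basis(1)[of F]] by (simp add: dim_eq_card_independent)
  then obtain u where u: "u \<noteq> 0" "\<And>y. y \<in> span ?B \<Longrightarrow> orthogonal u y"
    using orthogonal_to_subspace_exists[of ?B] by blast
  have uF: "u \<bullet> (y - x) = 0" if "x \<in> F" "y \<in> F" for x y
    using u(2)[OF diff_in_span_tangent_basis[OF that]] by (simp add: orthogonal_def)
  have "u \<bullet> (a - p) \<noteq> 0"
  proof
    assume 0: "u \<bullet> (a - p) = 0"
    have "C \<subseteq> {x. u \<bullet> x = u \<bullet> a}"
    proof
      fix x assume "x \<in> C"
      show "x \<in> {x. u \<bullet> x = u \<bullet> a}"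
      proof (cases "x = p")
        case False
        then have "x \<in> F" using \<open>x \<in> C\<close> by (intro hull_inc) auto
        then show ?thesis using uF[OF a] by (simp add: inner_diff_right)
      qed (use 0 in \<open>simp add: inner_diff_right\<close>)
    qed
    then have "aff_dim C \<le> aff_dim {x. u \<bullet> x = u \<bullet> a}" by (rule aff_dim_subset)
    also have "\<dots> = int DIM(real ^ 'n) - 1" using aff_dim_hyperplane[OF u(1)] by simp
    finally show False using aff_dim_K by (simp add: aff_dim_convex_hull)
  qed
  then obtain \<sigma> :: real where s: "\<bar>\<sigma>\<bar> = 1" "\<sigma> * (u \<bullet> (a - p)) > 0"
    by (metis abs_1 abs_minus_cancel linorder_neqE_linordered_idom mult_1 mult_minus_left neg_0_less_iff_less)
  let ?v = "(\<sigma> / norm u) *\<^sub>R u"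
  show ?thesis
  proof
    show "norm ?v = 1" using s u by simp
    show F0: "?v \<bullet> (y - x) = 0" if "x \<in> F" "y \<in> F" for x y using uF[OF that] by simp
    show "?v \<bullet> (x - p) > 0" if "x \<in> F" for x
    proof -
      have "?v \<bullet> (x - p) = ?v \<bullet> (a - p)" using F0[OF a that] by (simp add: inner_diff_right)
      also have "\<dots> > 0" using s u by (simp add: zero_less_divide_iff)
      finally show ?thesis .
    qed
    show "?v \<bullet> t = 0" if "t \<in> ?B" for t using u(2)[OF span_base[OF that]] by (simp add: orthogonal_def)
  qed
qed

text \<open>
A hyperplane has two unit normals, and the position of p decides between them. This is what makes
the description in \<open>outer_normal\<close> a definite one.
\<close>

lemma outer_normal:
  shows norm_normal: "norm \<nu> = 1" and normal_orthogonal: "\<And>x y. x \<in> F \<Longrightarrow> y \<in> F \<Longrightarrow> \<nu> \<bullet> (y - x) = 0"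
    and normal_apex: "\<And>x. x \<in> F \<Longrightarrow> \<nu> \<bullet> (x - p) > 0" and normal_tangent: "\<And>t. t \<in> tangent_basis F \<Longrightarrow> \<nu> \<bullet> t = 0"
    and normal_inward: "\<And>x y. x \<in> F \<Longrightarrow> y \<in> K \<Longrightarrow> \<nu> \<bullet> (y - x) \<le> 0"
proof -
  obtain n where n: "norm n = 1" "\<And>x y. x \<in> F \<Longrightarrow> y \<in> F \<Longrightarrow> n \<bullet> (y - x) = 0"
    "\<And>x. x \<in> F \<Longrightarrow> n \<bullet> (x - p) > 0" "\<And>t. t \<in> tangent_basis F \<Longrightarrow> n \<bullet> t = 0"
    by (rule normal_exists) blast
  have nK: "n \<bullet> (y - x) \<le> 0" if "x \<in> F" "y \<in> K" for x y
  proof -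
    from that(2) obtain r z where z: "y = p + r *\<^sub>R (z - p)" "0 \<le> r" "r \<le> 1" "z \<in> F" using simplex_eq_cone by auto
    have "n \<bullet> (y - x) = n \<bullet> (z - x) - (1 - r) * (n \<bullet> (z - p))"
      unfolding z(1) by (simp add: inner_simps algebra_simps)
    also have "\<dots> \<le> 0" using n(2)[OF that(1) z(4)] n(3)[OF z(4)] z by simp
    finally show ?thesis .
  qed
  obtain a where a: "a \<in> F" using F_nonempty by blast
  have pK: "p \<in> K" using p by (simp add: hull_inc)
  have "outer_normal K F = n" unfolding outer_normal_def
  proof (rule the_equality)
    show "norm n = 1 \<and> (\<forall>x\<in>F. \<forall>y\<in>F. n \<bullet> (y - x) = 0) \<and> (\<forall>x\<in>F. \<forall>y\<in>K. n \<bullet> (y - x) \<le> 0)"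
      using n nK by blast
    fix m assume m: "norm m = 1 \<and> (\<forall>x\<in>F. \<forall>y\<in>F. m \<bullet> (y - x) = 0) \<and> (\<forall>x\<in>F. \<forall>y\<in>K. m \<bullet> (y - x) \<le> 0)"
    let ?B = "tangent_basis F"
    have mt: "m \<bullet> t = 0" if "t \<in> ?B" for t
    proof -
      have "t \<in> span {y - x | x y. x \<in> F \<and> y \<in> F}" using span_base[OF that] by (simp add: tangent_basis(2))
      then have "orthogonal m t" by (rule orthogonal_to_span) (use m in \<open>auto simp: orthogonal_def\<close>)
      then show ?thesis by (simp add: orthogonal_def)
    qed
    have fB: "finite ?B" by (rule orthonormal_finite[OF tangent_basis(1)])
    have nB: "n \<notin> ?B" and E: "orthonormal (insert n ?B)" using orthonormal_insert[OF tangent_basis(1) n(1,4)] by blast+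
    have "card (insert n ?B) = DIM(real ^ 'n)" using nB fB card_tangent_basis_facet by simp
    then have "m \<in> span (insert n ?B)" using orthonormal_span[OF E] by simp
    from orthonormal_expand[OF E this] have mn: "m = (m \<bullet> n) *\<^sub>R n" using fB nB mt by simp
    then have "norm m = \<bar>m \<bullet> n\<bar>" using n(1) by (metis mult.right_neutral norm_scaleR)
    then have one: "\<bar>m \<bullet> n\<bar> = 1" using m by simp
    have "m \<bullet> (p - a) \<le> 0" using m a pK by auto
    then have "(m \<bullet> n) * (n \<bullet> (p - a)) \<le> 0" by (subst (asm) mn) simp
    moreover have "n \<bullet> (p - a) < 0" using n(3)[OF a] by (simp add: inner_diff_right)
    ultimately have "m \<bullet> n \<ge> 0" by (simp add: mult_le_0_iff)
    then show "m = n" using one mn by simp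
  qed
  with n nK show "norm \<nu> = 1" "\<And>x y. x \<in> F \<Longrightarrow> y \<in> F \<Longrightarrow> \<nu> \<bullet> (y - x) = 0"
    "\<And>x. x \<in> F \<Longrightarrow> \<nu> \<bullet> (x - p) > 0" "\<And>t. t \<in> tangent_basis F \<Longrightarrow> \<nu> \<bullet> t = 0"
    "\<And>x y. x \<in> F \<Longrightarrow> y \<in> K \<Longrightarrow> \<nu> \<bullet> (y - x) \<le> 0" by auto
qed

lemma compact_F: "compact F" and compact_K: "compact K"
  using finite_C by (auto intro!: finite_imp_compact_convex_hull)

lemma divergence_vertex:
  fixes h :: "real ^ 'n \<Rightarrow> real"
  assumes h: "\<And>x. GDERIV h x :> G x" and G: "continuous_on UNIV G" and y: "y \<in> F"
  shows "(LINT x|lborel. indicator K x * (CARD('n) * h x + (x - p) \<bullet> G x)) = (\<nu> \<bullet> (y - p)) * (LINT x|face_measure F. h x)"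
proof -
  let ?a = "SOME a. a \<in> F"
  have a: "?a \<in> F" using y by (rule someI)
  interpret c: cone "tangent_basis F" \<nu> ?a p "\<nu> \<bullet> (?a - p)" F
    using tangent_basis(1) norm_normal normal_tangent card_tangent_basis_facet compact_F normal_orthogonal[OF a] normal_apex[OF a] by unfold_locales auto
  have K: "c.K = K" unfolding c.K_def simplex_eq_cone by (auto, blast)
  have hm: "h \<in> borel_measurable borel" by (rule borel_measurable_continuous_onI[OF continuous_on_GDERIV[OF h]])
  have "\<nu> \<bullet> (?a - p) = \<nu> \<bullet> (y - p)" using normal_orthogonal[OF a y] by (simp add: inner_diff_right)
  then show ?thesis using c.cone_divergence[OF h G] K integral_face[OF borel_compact[OF compact_F] hm] by simp
qed

end

text \<open>
Choose coefficients with sum 0 such that e is the combination of the fields x - p over the vertices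
p. Each field is treated by \<open>divergence_vertex\<close>; on the facet opposite to p, only x - p among
them has a normal component.
\<close>

lemma simplex_divergence:
  fixes h :: "real ^ 'n \<Rightarrow> real"
  assumes K: "int CARD('n) simplex K"
    and h: "\<And>x. GDERIV h x :> G x" and G: "continuous_on UNIV G"
  shows "(LINT x|lborel. indicator K x * (e \<bullet> G x)) =
    (\<Sum>F | F facet_of K. (e \<bullet> outer_normal K F) * (LINT x|face_measure F. h x))"
proof -
  obtain C where C: "\<not> affine_dependent C" "card C = Suc CARD('n)" "K = convex hull C"
    using K unfolding simplex_def by (metis of_nat_Suc of_nat_eq_iff add.commute)
  have sv: "simplex_vertex C p" if "p \<in> C" for p using C that by unfold_locales
  have fC: "finite C" using C by (simp add: aff_independent_finite)
  then have cK: "compact K" using C by (simp add: finite_imp_compact_convex_hull)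
  let ?F = "\<lambda>p. convex hull (C - {p})"
  have inj: "inj_on ?F C"
  proof (rule inj_onI)
    fix p q assume pq: "p \<in> C" "q \<in> C" "?F p = ?F q"
    show "p = q"
    proof (rule ccontr)
      assume "p \<noteq> q"
      then have "p \<in> ?F q" using pq by (intro hull_inc) auto
      then show False using simplex_vertex.normal_apex[OF sv[OF pq(1)], of p] pq by simp
    qed
  qed
  have facets: "{F. F facet_of K} = ?F ` C"
    unfolding C(3) facet_of_convex_hull_affine_independent[OF C(1)]
    using simplex_vertex.other_vertices[OF sv] by auto
  \<comment> \<open>coefficients c with e = \<Sum> c_p (x - p) for all x, from barycentric coordinates of q - e\<close>
  obtain c where c: "(\<Sum>p\<in>C. c p) = 0" "(\<Sum>p\<in>C. c p *\<^sub>R p) = - e"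
  proof -
    have "C \<noteq> {}" using C by auto
    then obtain q where q: "q \<in> C" by auto
    have "affine hull C = UNIV" using C by (intro affine_independent_span_gt) auto
    then have "q - e \<in> affine hull C" by simp
    then obtain u where u: "sum u C = 1" "(\<Sum>v\<in>C. u v *\<^sub>R v) = q - e"
      unfolding affine_hull_finite[OF fC] by auto
    show ?thesis
    proof (rule that[of "\<lambda>p. u p - (if p = q then 1 else 0)"])
      show "(\<Sum>p\<in>C. u p - (if p = q then 1 else 0)) = 0" using u fC q by (simp add: sum_subtractf)
      have "(\<Sum>p\<in>C. (if p = q then 1 else 0) *\<^sub>R p) = (\<Sum>p\<in>C. if p = q then q else 0)" by (intro sum.cong) auto
      then show "(\<Sum>p\<in>C. (u p - (if p = q then 1 else 0)) *\<^sub>R p) = - e"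
        using u fC q by (simp add: sum_subtractf scaleR_diff_left)
    qed
  qed
  note ch = continuous_on_GDERIV[OF h]
  have comb: "(\<Sum>p\<in>C. c p *\<^sub>R (x - p)) = e" for x
  proof -
    have "(\<Sum>p\<in>C. c p *\<^sub>R (x - p)) = (\<Sum>p\<in>C. c p) *\<^sub>R x - (\<Sum>p\<in>C. c p *\<^sub>R p)"
      by (simp add: scaleR_diff_right sum_subtractf scaleR_sum_left)
    then show ?thesis using c by simp
  qed
  have i: "integrable lborel (\<lambda>x. indicator K x * (CARD('n) * h x + (x - p) \<bullet> G x))" for p
    by (intro integrable_compact_lborel cK continuous_intros ch G)
  have "(LINT x|lborel. indicator K x * (e \<bullet> G x)) =
      (LINT x|lborel. (\<Sum>p\<in>C. c p * (indicator K x * (CARD('n) * h x + (x - p) \<bullet> G x))))"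
  proof (intro Bochner_Integration.integral_cong refl)
    fix x
    have "(\<Sum>p\<in>C. c p * (CARD('n) * h x + (x - p) \<bullet> G x)) = (\<Sum>p\<in>C. c p) * (CARD('n) * h x) + (\<Sum>p\<in>C. c p *\<^sub>R (x - p)) \<bullet> G x"
      by (simp add: distrib_left sum.distrib sum_distrib_right inner_sum_left)
    also have "\<dots> = e \<bullet> G x" unfolding comb c(1) by simp
    finally have eq: "(\<Sum>p\<in>C. c p * (CARD('n) * h x + (x - p) \<bullet> G x)) = e \<bullet> G x" .
    show "indicator K x * (e \<bullet> G x) = (\<Sum>p\<in>C. c p * (indicator K x * (CARD('n) * h x + (x - p) \<bullet> G x)))"
      unfolding eq[symmetric] sum_distrib_left by (intro sum.cong) auto
  qed
  also have "\<dots> = (\<Sum>p\<in>C. c p * (LINT x|lborel. (indicator K x * (CARD('n) * h x + (x - p) \<bullet> G x))))"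
    using i by (subst Bochner_Integration.integral_sum) auto
  also have "\<dots> = (\<Sum>p\<in>C. (e \<bullet> outer_normal K (?F p)) * (LINT x|face_measure (?F p). h x))"
  proof (intro sum.cong refl)
    fix p assume p: "p \<in> C"
    interpret sv: simplex_vertex C p by (rule sv[OF p])
    obtain y where y: "y \<in> ?F p" using sv.F_nonempty by blast
    have "e \<bullet> outer_normal K (?F p) = (\<Sum>q\<in>C. c q * ((y - q) \<bullet> outer_normal K (?F p)))"
      unfolding comb[of y, symmetric] by (simp add: inner_sum_left)
    also have "\<dots> = (\<Sum>q\<in>C. if q = p then c p * (outer_normal K (?F p) \<bullet> (y - p)) else 0)"
    proof (intro sum.cong refl)
      fix q assume q: "q \<in> C"
      show "c q * ((y - q) \<bullet> outer_normal K (?F p)) = (if q = p then c p * (outer_normal K (?F p) \<bullet> (y - p)) else 0)"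
      proof (cases "q = p")
        case False
        then have "q \<in> ?F p" using q by (intro hull_inc) auto
        then show ?thesis using False sv.normal_orthogonal[OF _ y] C(3) by (simp add: inner_commute)
      qed (simp add: inner_commute)
    qed
    also have "\<dots> = c p * (outer_normal K (?F p) \<bullet> (y - p))" using fC p by simp
    finally show "c p * (LINT x|lborel. (indicator K x * (CARD('n) * h x + (x - p) \<bullet> G x))) =
      (e \<bullet> outer_normal K (?F p)) * (LINT x|face_measure (?F p). h x)"
      using sv.divergence_vertex[OF h G y] C(3) by simp
  qed
  also have "\<dots> = (\<Sum>F | F facet_of K. (e \<bullet> outer_normal K F) * (LINT x|face_measure F. h x))"
    unfolding facets by (subst sum.reindex[OF inj]) simp
  finally show ?thesis .
qed

section \<open>Integration by parts within a face\<close>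

lemma affine_hull_add_tangent:
  fixes F :: "(real ^ 'n) set"
  assumes x: "x \<in> affine hull F" and t: "t \<in> span (tangent_basis F)"
  shows "x + t \<in> affine hull F"
proof -
  have "\<forall>z\<in>affine hull F. z + t \<in> affine hull F"
  proof (rule span_induct[of t "{y - x | x y. x \<in> F \<and> y \<in> F}" "\<lambda>t. \<forall>z\<in>affine hull F. z + t \<in> affine hull F"])
    show "t \<in> span {y - x | x y. x \<in> F \<and> y \<in> F}" using t by (simp only: tangent_basis(2))
    show "\<forall>z\<in>affine hull F. z + v \<in> affine hull F" if v: "v \<in> {y - x | x y. x \<in> F \<and> y \<in> F}" for v
    proof
      fix z assume z: "z \<in> affine hull F"
      obtain a b where ab: "a \<in> F" "b \<in> F" "v = b - a" using v by auto
      have "z + 1 *\<^sub>R (b - a) \<in> affine hull F"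
        by (rule mem_affine_3_minus[OF affine_affine_hull z hull_inc[OF ab(2)] hull_inc[OF ab(1)]])
      then show "z + v \<in> affine hull F" using ab by simp
    qed
    show "subspace {t. \<forall>z\<in>affine hull F. z + t \<in> affine hull F}"
    proof (rule subspaceI)
      show "0 \<in> {t. \<forall>z\<in>affine hull F. z + t \<in> affine hull F}" by simp
      fix u v assume u: "u \<in> {t. \<forall>z\<in>affine hull F. z + t \<in> affine hull F}"
      { assume v: "v \<in> {t. \<forall>z\<in>affine hull F. z + t \<in> affine hull F}"
        show "u + v \<in> {t. \<forall>z\<in>affine hull F. z + t \<in> affine hull F}"
          using u v by (auto simp: add.assoc[symmetric]) }
      fix c :: real
      show "c *\<^sub>R u \<in> {t. \<forall>z\<in>affine hull F. z + t \<in> affine hull F}"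
      proof (intro CollectI ballI)
        fix z assume z: "z \<in> affine hull F"
        have "(1 - c) *\<^sub>R z + c *\<^sub>R (z + u) \<in> affine hull F"
          using z u by (intro mem_affine affine_affine_hull) auto
        then show "z + c *\<^sub>R u \<in> affine hull F" by (simp add: algebra_simps)
      qed
    qed
  qed
  then show ?thesis using x by blast
qed

text \<open>
The line meets F in a segment whose end points lie in the relative boundary, where h vanishes.
\<close>

lemma integral_line_zero:
  fixes F :: "(real ^ 'n) set" and h :: "real ^ 'n \<Rightarrow> real"
  assumes F: "compact F" "convex F" and t: "t \<in> tangent_basis F"
    and h: "\<And>x. GDERIV h x :> G x" and G: "continuous_on UNIV G"
    and h0: "\<And>x. x \<in> rel_frontier F \<Longrightarrow> h x = 0"
  shows "(LINT y|lborel. indicator F (q + y *\<^sub>R t) * (t \<bullet> G (q + y *\<^sub>R t))) = 0"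
proof -
  have nt: "norm t = 1" and tt: "t \<bullet> t = 1"
    using tangent_basis(1)[of F] t by (auto simp: orthonormal_def dot_square_norm)
  let ?I = "{y. q + y *\<^sub>R t \<in> F}"
  have cl: "closed ?I"
    using continuous_closed_vimage[of F "\<lambda>y. q + y *\<^sub>R t"] compact_imp_closed[OF F(1)]
    by (auto simp: vimage_def intro!: continuous_intros)
  obtain R where R: "\<And>x. x \<in> F \<Longrightarrow> norm x \<le> R"
    using compact_imp_bounded[OF F(1)] by (auto simp: bounded_iff)
  have bd: "bounded ?I"
  proof (rule boundedI)
    fix y assume "y \<in> ?I"
    then have "norm (q + y *\<^sub>R t) \<le> R" using R by auto
    moreover have "norm (y *\<^sub>R t) \<le> norm (q + y *\<^sub>R t) + norm q" by (metis add_diff_cancel_left' norm_triangle_ineq4)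
    ultimately show "norm y \<le> R + norm q" using nt by simp
  qed
  have conv: "convex ?I"
  proof (rule convexI)
    fix y z u v :: real assume a: "y \<in> ?I" "z \<in> ?I" "0 \<le> u" "0 \<le> v" "u + v = 1"
    have "u *\<^sub>R (q + y *\<^sub>R t) + v *\<^sub>R (q + z *\<^sub>R t) \<in> F" using a by (intro convexD[OF F(2)]) auto
    moreover have "u *\<^sub>R (q + y *\<^sub>R t) + v *\<^sub>R (q + z *\<^sub>R t) = q + (u *\<^sub>R y + v *\<^sub>R z) *\<^sub>R t"
      using a(5) by (simp add: algebra_simps flip: scaleR_add_left)
    ultimately show "u *\<^sub>R y + v *\<^sub>R z \<in> ?I" by simp
  qed
  then obtain \<alpha> \<beta> where I: "?I = {\<alpha>..\<beta>}"
    using cl bd connected_compact_interval_1[of ?I] by (auto simp: compact_eq_bounded_closed convex_connected)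
  let ?H = "\<lambda>y. h (q + y *\<^sub>R t)"
  show ?thesis
  proof (cases "\<alpha> \<le> \<beta>")
    case False
    then have "indicator F (q + y *\<^sub>R t) = (0::real)" for y using I by (auto simp: indicator_def)
    then show ?thesis by simp
  next
    case True
    have front: "q + y *\<^sub>R t \<in> rel_frontier F" if y: "y \<in> ?I" and ends: "y = \<alpha> \<or> y = \<beta>" for y
    proof -
      have "q + y *\<^sub>R t \<notin> rel_interior F"
      proof
        assume "q + y *\<^sub>R t \<in> rel_interior F"
        then obtain e where e: "e > 0" "ball (q + y *\<^sub>R t) e \<inter> affine hull F \<subseteq> F"
          unfolding mem_rel_interior_ball by blast
        have *: "y + \<delta> \<in> ?I" if "\<bar>\<delta>\<bar> < e" for \<delta>
        proof -
          have "(q + y *\<^sub>R t) + \<delta> *\<^sub>R t \<in> affine hull F"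
            using y t by (intro affine_hull_add_tangent hull_inc span_mul span_base) auto
          moreover have "(q + y *\<^sub>R t) + \<delta> *\<^sub>R t \<in> ball (q + y *\<^sub>R t) e" using that nt by (simp add: dist_norm)
          ultimately have "(q + y *\<^sub>R t) + \<delta> *\<^sub>R t \<in> F" using e by blast
          then show ?thesis by (simp add: algebra_simps)
        qed
        have "y + e/2 \<in> {\<alpha>..\<beta>}" "y + (- (e/2)) \<in> {\<alpha>..\<beta>}" using *[of "e/2"] *[of "-(e/2)"] e(1) unfolding I by auto
        then show False using ends e(1) by auto
      qed
      then show ?thesis using y closure_subset[of F] by (auto simp: rel_frontier_def)
    qed
    have D: "(?H has_real_derivative (t \<bullet> G (q + y *\<^sub>R t))) (at y)" for y by (rule GDERIV_line[OF h])
    have c: "isCont (\<lambda>y. t \<bullet> G (q + y *\<^sub>R t)) y" for y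
    proof -
      have "continuous_on UNIV (\<lambda>y. t \<bullet> G (q + y *\<^sub>R t))"
        by (intro continuous_intros continuous_on_compose2[OF G]) auto
      then show ?thesis by (simp add: continuous_on_eq_continuous_at)
    qed
    have "(LINT y|lborel. (t \<bullet> G (q + y *\<^sub>R t)) * indicator {\<alpha>..\<beta>} y) = ?H \<beta> - ?H \<alpha>"
      by (rule integral_FTC_Icc_real) (use D c True in auto)
    also have "\<dots> = 0"
    proof -
      have "\<alpha> \<in> ?I" "\<beta> \<in> ?I" unfolding I using True by auto
      then show ?thesis using front h0 by simp
    qed
    finally have 0: "(LINT y|lborel. (t \<bullet> G (q + y *\<^sub>R t)) * indicator {\<alpha>..\<beta>} y) = 0" .
    have "indicator F (q + y *\<^sub>R t) = (indicator {\<alpha>..\<beta>} y :: real)" for y unfolding I[symmetric] by (simp add: indicator_def)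
    then show ?thesis using 0 by (simp add: mult.commute)
  qed
qed

text \<open>
Integration by parts within a face, for functions vanishing on its relative boundary. The direction t
is one of the coordinates of \<open>face_measure\<close>, so Fubini's theorem reduces the claim to lines.
\<close>

lemma integral_face_tangential_derivative:
  fixes F :: "(real ^ 'n) set" and h :: "real ^ 'n \<Rightarrow> real"
  assumes F: "compact F" "convex F" and t: "t \<in> tangent_basis F"
    and h: "\<And>x. GDERIV h x :> G x" and G: "continuous_on UNIV G"
    and h0: "\<And>x. x \<in> rel_frontier F \<Longrightarrow> h x = 0"
  shows "(LINT x|face_measure F. t \<bullet> G x) = 0"
proof -
  let ?B = "tangent_basis F" let ?B' = "?B - {t}" let ?a = "SOME a. a \<in> F"
  have fB: "finite ?B" by (rule orthonormal_finite[OF tangent_basis(1)])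
  have ins: "insert t ?B' = ?B" using t by auto
  have cf: "continuous_on UNIV (\<lambda>x. t \<bullet> G x)" by (intro continuous_intros G)
  let ?f = "\<lambda>s. indicator F (face_map F s) * (t \<bullet> G (face_map F s))"
  have "(LINT x|face_measure F. t \<bullet> G x) = (LINT s|PiL ?B. ?f s)"
    using F(1) cf by (intro integral_face) (auto intro: borel_compact borel_measurable_continuous_onI)
  also have "\<dots> = (LINT s|PiL ?B'. LINT y|lborel. ?f (s(t := y)))"
    using lborel_prod.product_integral_insert[of ?B' t ?f] fB integrable_frame[OF tangent_basis(1) F(1) cf, of F ?a]
    unfolding ins by auto
  also have "\<dots> = (LINT s|PiL ?B'. 0)"
  proof (intro Bochner_Integration.integral_cong refl)
    fix s
    let ?q = "?a + (\<Sum>e\<in>?B'. s e *\<^sub>R e)"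
    have "face_map F (s(t := y)) = ?q + y *\<^sub>R t" for y
    proof -
      have "(\<Sum>e\<in>?B. (s(t := y)) e *\<^sub>R e) = y *\<^sub>R t + (\<Sum>e\<in>?B'. (s(t := y)) e *\<^sub>R e)"
        using fB t by (subst sum.remove[of _ t]) auto
      also have "(\<Sum>e\<in>?B'. (s(t := y)) e *\<^sub>R e) = (\<Sum>e\<in>?B'. s e *\<^sub>R e)" by (intro sum.cong) auto
      finally show ?thesis unfolding frame_map_def by simp
    qed
    then show "(LINT y|lborel. ?f (s(t := y))) = 0"
      using integral_line_zero[OF F t h G h0, of ?q] by simp
  qed
  finally show ?thesis by simp
qed

section \<open>One-sided derivatives\<close>

text \<open>
A derivative within S need not be unique at a corner or on a lower dimensional set. Segments to
other points of a convex S determine it on the span of their directions. For an element this is the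
whole space, for a face it consists of the tangential directions.
\<close>

lemma has_derivative_unique_tangent:
  fixes u :: "real ^ 'n \<Rightarrow> real"
  assumes S: "convex S" "x \<in> S"
    and D1: "(u has_derivative D1) (at x within S)" and D2: "(u has_derivative D2) (at x within S)"
    and t: "t \<in> span {y - x | y. y \<in> S}"
  shows "D1 t = D2 t"
proof (rule linear_eq_on[OF _ _ t])
  show "linear D1" "linear D2" using D1 D2 has_derivative_linear by blast+
  fix e assume "e \<in> {y - x | y. y \<in> S}"
  then obtain y where y: "y \<in> S" "e = y - x" by auto
  let ?c = "\<lambda>r::real. x + r *\<^sub>R e"
  have sub: "?c ` {0..1} \<subseteq> S"
  proof
    fix z assume "z \<in> ?c ` {0..1}"
    then obtain r where r: "0 \<le> r" "r \<le> 1" "z = x + r *\<^sub>R (y - x)" using y by auto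
    have "z = (1 - r) *\<^sub>R x + r *\<^sub>R y" unfolding r(3) by (simp add: algebra_simps)
    then show "z \<in> S" using convexD[OF S(1) S(2) y(1), of "1 - r" r] r by simp
  qed
  have c: "(?c has_derivative (\<lambda>r. r *\<^sub>R e)) (at 0 within {0..1})"
    by (auto intro!: derivative_eq_intros)
  have *: "((\<lambda>r. u (?c r)) has_vector_derivative D e) (at 0 within {0..1})" if "(u has_derivative D) (at x within S)" for D
  proof -
    have "(u has_derivative D) (at (?c 0) within ?c ` {0..1})" using has_derivative_subset[OF that sub] by simp
    from diff_chain_within[OF c this] have "((\<lambda>r. u (?c r)) has_derivative (\<lambda>r. D (r *\<^sub>R e))) (at 0 within {0..1})"
      by (simp add: comp_def)
    then show ?thesis using has_derivative_linear[OF that] by (simp add: has_vector_derivative_def linear_cmul)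
  qed
  show "D1 e = D2 e"
    using vector_derivative_unique_within_closed_interval[of 0 1 0 "\<lambda>r. u (?c r)" "D1 e" "D2 e"] *[OF D1] *[OF D2] by simp
qed

section \<open>Derivatives of polynomials\<close>

lemma real_polynomial_function_gderiv:
  fixes p :: "real ^ 'n \<Rightarrow> real"
  assumes "real_polynomial_function p"
  shows "\<exists>G. (\<forall>x. GDERIV p x :> G x) \<and> (\<forall>t. real_polynomial_function (\<lambda>x. t \<bullet> G x))"
  using assms
proof induction
  case (linear f)
  let ?g = "\<Sum>b\<in>Basis. f b *\<^sub>R b"
  have "f v = v \<bullet> ?g" for v
  proof -
    have "f v = f (\<Sum>b\<in>Basis. (v \<bullet> b) *\<^sub>R b)" by (simp add: euclidean_representation)
    also have "\<dots> = (\<Sum>b\<in>Basis. (v \<bullet> b) * f b)"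
      using bounded_linear.linear[OF linear] by (simp add: linear_sum linear_cmul)
    also have "\<dots> = v \<bullet> ?g" by (simp add: inner_sum_right mult.commute)
    finally show ?thesis .
  qed
  then have fe: "f = (\<lambda>v. v \<bullet> ?g)" by (rule ext)
  have "GDERIV f x :> ?g" for x
    unfolding gderiv_def by (rule has_derivative_eq_rhs[OF bounded_linear_imp_has_derivative[OF linear] fe])
  then show ?case by (intro exI[of _ "\<lambda>_. ?g"]) auto
next
  case (const c)
  show ?case by (intro exI[of _ "\<lambda>_. 0"]) (auto intro: GDERIV_const)
next
  case (add f g)
  then obtain F G where "\<forall>x. GDERIV f x :> F x" "\<forall>x. GDERIV g x :> G x"
    "\<forall>t. real_polynomial_function (\<lambda>x. t \<bullet> F x)" "\<forall>t. real_polynomial_function (\<lambda>x. t \<bullet> G x)" by blast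
  then show ?case by (intro exI[of _ "\<lambda>x. F x + G x"]) (auto intro: GDERIV_add simp: inner_add_right)
next
  case (mult f g)
  then obtain F G where "\<forall>x. GDERIV f x :> F x" "\<forall>x. GDERIV g x :> G x"
    "\<forall>t. real_polynomial_function (\<lambda>x. t \<bullet> F x)" "\<forall>t. real_polynomial_function (\<lambda>x. t \<bullet> G x)" by blast
  then show ?case using mult(1,2)
    by (intro exI[of _ "\<lambda>x. f x *\<^sub>R G x + g x *\<^sub>R F x"]) (auto intro!: GDERIV_mult real_polynomial_function.intros(3,4) simp: inner_add_right)
qed

definition gradient :: "(real ^ 'n \<Rightarrow> real) \<Rightarrow> real ^ 'n \<Rightarrow> real ^ 'n"
  where "gradient p x = (\<chi> i. frechet_derivative p (at x) (axis i 1))"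

definition dderiv :: "real ^ 'n \<Rightarrow> (real ^ 'n \<Rightarrow> real) \<Rightarrow> real ^ 'n \<Rightarrow> real"
  where "dderiv t p x = t \<bullet> gradient p x"

lemma GDERIV_imp_gradient:
  assumes "GDERIV p x :> G" shows "gradient p x = G"
proof -
  have "frechet_derivative p (at x) = (\<lambda>v. v \<bullet> G)"
    using assms unfolding gderiv_def by (metis frechet_derivative_at)
  then show ?thesis by (simp add: gradient_def vec_eq_iff inner_axis')
qed

lemma GDERIV_poly:
  fixes p :: "real ^ 'n \<Rightarrow> real"
  assumes "real_polynomial_function p" shows "GDERIV p x :> gradient p x"
  using real_polynomial_function_gderiv[OF assms] GDERIV_imp_gradient by metis

lemma real_polynomial_function_dderiv[intro]:
  fixes p :: "real ^ 'n \<Rightarrow> real"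
  assumes "real_polynomial_function p" shows "real_polynomial_function (dderiv t p)"
proof -
  obtain G where G: "\<forall>x. GDERIV p x :> G x" "\<forall>t. real_polynomial_function (\<lambda>x. t \<bullet> G x)"
    using real_polynomial_function_gderiv[OF assms] by blast
  then have "gradient p = G" using GDERIV_imp_gradient by blast
  then show ?thesis using G unfolding dderiv_def[abs_def] by auto
qed

lemma continuous_on_poly:
  fixes p :: "real ^ 'n \<Rightarrow> real"
  assumes "real_polynomial_function p" shows "continuous_on S p"
  using assms by (simp add: continuous_on_polymonial_function real_polynomial_function_eq)

lemma gradient_nth: "gradient p x $ i = dderiv (axis i 1) p x"
  by (simp add: dderiv_def inner_axis')

lemma continuous_on_gradient:
  fixes p :: "real ^ 'n \<Rightarrow> real"
  assumes "real_polynomial_function p" shows "continuous_on S (gradient p)"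
proof -
  have c: "continuous_on S (\<lambda>x. \<chi> i. dderiv (axis i 1) p x)"
    by (intro continuous_on_vec_lambda continuous_on_poly real_polynomial_function_dderiv assms)
  have e: "(\<lambda>x. \<chi> i. dderiv (axis i 1) p x) = gradient p" by (auto simp: vec_eq_iff gradient_nth)
  show ?thesis using c unfolding e .
qed

lemma dderiv_add: "real_polynomial_function p \<Longrightarrow> real_polynomial_function q \<Longrightarrow> dderiv t (\<lambda>x. p x + q x) = (\<lambda>x. dderiv t p x + dderiv t q x)"
  by (rule ext) (simp add: dderiv_def GDERIV_imp_gradient[OF GDERIV_add[OF GDERIV_poly GDERIV_poly]] inner_add_right)

lemma dderiv_diff: "real_polynomial_function p \<Longrightarrow> real_polynomial_function q \<Longrightarrow> dderiv t (\<lambda>x. p x - q x) = (\<lambda>x. dderiv t p x - dderiv t q x)"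
  by (rule ext) (simp add: dderiv_def GDERIV_imp_gradient[OF GDERIV_diff[OF GDERIV_poly GDERIV_poly]] inner_diff_right)

lemma dderiv_mult: "real_polynomial_function p \<Longrightarrow> real_polynomial_function q \<Longrightarrow> dderiv t (\<lambda>x. p x * q x) = (\<lambda>x. p x * dderiv t q x + q x * dderiv t p x)"
  by (rule ext) (simp add: dderiv_def GDERIV_imp_gradient[OF GDERIV_mult[OF GDERIV_poly GDERIV_poly]] inner_add_right)

lemma dderiv_const: "dderiv t (\<lambda>x. c) = (\<lambda>x. 0)"
  by (rule ext) (simp add: dderiv_def GDERIV_imp_gradient[OF GDERIV_const])

lemma dderiv_sum:
  assumes "finite I" "\<And>i. i \<in> I \<Longrightarrow> real_polynomial_function (p i)"
  shows "dderiv t (\<lambda>x. \<Sum>i\<in>I. p i x) = (\<lambda>x. \<Sum>i\<in>I. dderiv t (p i) x)"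
  using assms
proof (induction I)
  case (insert i I)
  then have "dderiv t (\<lambda>x. p i x + (\<Sum>i\<in>I. p i x)) = (\<lambda>x. dderiv t (p i) x + dderiv t (\<lambda>x. \<Sum>i\<in>I. p i x) x)"
    by (intro dderiv_add real_polynomial_function_sum) auto
  then show ?case using insert by simp
qed (simp add: dderiv_const)

lemma dderiv_linear:
  assumes "bounded_linear f" shows "dderiv t f = (\<lambda>x. f t)"
proof
  fix x :: "real ^ 'a"
  have "GDERIV f x :> gradient f x" using assms by (intro GDERIV_poly real_polynomial_function.intros(1))
  moreover have "(f has_derivative f) (at x)" using bounded_linear_imp_has_derivative[OF assms] .
  ultimately have "f = (\<lambda>v. v \<bullet> gradient f x)" unfolding gderiv_def using has_derivative_unique by blast
  then show "dderiv t f x = f t" unfolding dderiv_def by metis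
qed

lemma dderiv_commute:
  fixes p :: "real ^ 'n \<Rightarrow> real"
  assumes "real_polynomial_function p" shows "dderiv s (dderiv t p) = dderiv t (dderiv s p)"
  using assms
proof induction
  case (linear f)
  then show ?case by (simp add: dderiv_linear dderiv_const)
next
  case (const c)
  then show ?case by (simp add: dderiv_const)
next
  case (add f g)
  then show ?case by (simp add: dderiv_add real_polynomial_function_dderiv)
next
  case (mult f g)
  then show ?case
    by (simp add: dderiv_add dderiv_mult real_polynomial_function_dderiv real_polynomial_function.intros(4)) (simp add: algebra_simps)
qed

lemma polynomials_imp_real_polynomial_function:
  assumes "p \<in> polynomials k" shows "real_polynomial_function p"
proof -
  obtain c :: "('a \<Rightarrow> nat) \<Rightarrow> real" where c: "\<And>x. p x = (\<Sum>a | (\<Sum>i\<in>UNIV. a i) \<le> k. c a * (\<Prod>i\<in>UNIV. x $ i ^ a i))"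
    using assms unfolding polynomials_def by blast
  have "real_polynomial_function (\<lambda>x :: real ^ 'a. c a * (\<Prod>i\<in>UNIV. x $ i ^ a i))" for a
    by (intro real_polynomial_function.intros(4) real_polynomial_function.intros(2) real_polynomial_function_prod
        real_polynomial_function_power real_polynomial_function.intros(1) bounded_linear_vec_nth) auto
  then have "real_polynomial_function (\<lambda>x :: real ^ 'a. \<Sum>a | (\<Sum>i\<in>UNIV. a i) \<le> k. c a * (\<Prod>i\<in>UNIV. x $ i ^ a i))"
    by (cases "finite {a. (\<Sum>i\<in>(UNIV :: 'a set). a i) \<le> k}") (auto intro: real_polynomial_function_sum)
  then show ?thesis using c by presburger
qed

section \<open>Elementwise derivatives of piecewise polynomials\<close>

lemma span_diff_point:
  assumes "a \<in> F"
  shows "span {y - a | y. y \<in> F} = span (tangent_basis F)"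
  unfolding tangent_basis(2)
proof (rule span_eq[THEN iffD2], intro conjI subsetI)
  fix z assume "z \<in> {y - x | x y. x \<in> F \<and> y \<in> F}"
  then obtain x y where "x \<in> F" "y \<in> F" "z = (y - a) - (x - a)" by auto
  then show "z \<in> span {y - a | y. y \<in> F}" by (simp only:) (intro span_diff span_base, auto)
qed (use assms in \<open>auto intro: span_base\<close>)

lemma span_diff_simplex:
  fixes K :: "(real ^ 'n) set"
  assumes "int CARD('n) simplex K" "x \<in> K"
  shows "span {y - x | y. y \<in> K} = UNIV"
proof -
  have "aff_dim K = int (dim ((\<lambda>y. y - x) ` K))" using assms(2) by (intro aff_dim_eq_dim_subtract hull_inc)
  then have "dim ((\<lambda>y. y - x) ` K) = DIM(real ^ 'n)" using aff_dim_simplex[OF assms(1)] by simp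
  then have "span ((\<lambda>y. y - x) ` K) = UNIV" by (simp only: dim_eq_full)
  moreover have "(\<lambda>y. y - x) ` K = {y - x | y. y \<in> K}" by auto
  ultimately show ?thesis by simp
qed

lemma frechet_derivative_poly_within:
  fixes p :: "real ^ 'n \<Rightarrow> real"
  assumes S: "convex S" "x \<in> S" and p: "real_polynomial_function p" and u: "\<And>y. y \<in> S \<Longrightarrow> u y = p y"
    and t: "t \<in> span {y - x | y. y \<in> S}"
  shows "frechet_derivative u (at x within S) t = dderiv t p x"
proof -
  have "(p has_derivative (\<lambda>v. v \<bullet> gradient p x)) (at x within S)"
    using GDERIV_poly[OF p, of x] unfolding gderiv_def by (rule has_derivative_at_withinI)
  from has_derivative_transform[OF S(2) u this]
  have D: "(u has_derivative (\<lambda>v. v \<bullet> gradient p x)) (at x within S)" .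
  then have "(u has_derivative frechet_derivative u (at x within S)) (at x within S)"
    by (intro frechet_derivative_works[THEN iffD1]) (auto simp: differentiable_def)
  from has_derivative_unique_tangent[OF S this D t] show ?thesis by (simp add: dderiv_def)
qed

definition hessian :: "(real ^ 'n \<Rightarrow> real) \<Rightarrow> real ^ 'n \<Rightarrow> real ^ 'n ^ 'n"
  where "hessian p x = (\<chi> i. gradient (dderiv (axis i 1) p) x)"

lemma grad_on_poly:
  fixes K :: "(real ^ 'n) set"
  assumes K: "int CARD('n) simplex K" and x: "x \<in> K" and p: "real_polynomial_function p" and u: "\<And>y. y \<in> K \<Longrightarrow> u y = p y"
  shows "grad_on K u x = gradient p x"
  unfolding grad_on_def vec_eq_iff gradient_nth
  using frechet_derivative_poly_within[OF convex_simplex[OF K] x p u] span_diff_simplex[OF K x] by simp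

lemma hess_on_poly:
  fixes K :: "(real ^ 'n) set"
  assumes K: "int CARD('n) simplex K" and x: "x \<in> K" and p: "real_polynomial_function p" and u: "\<And>y. y \<in> K \<Longrightarrow> u y = p y"
  shows "hess_on K u x = hessian p x"
  unfolding hess_on_def hessian_def vec_eq_iff
proof (intro allI)
  fix i j
  have "grad_on K (\<lambda>y. grad_on K u y $ i) x = gradient (dderiv (axis i 1) p) x"
    by (rule grad_on_poly[OF K x]) (use grad_on_poly[OF K _ p u] p in \<open>auto simp: gradient_nth\<close>)
  then show "(\<chi> i. grad_on K (\<lambda>y. grad_on K u y $ i) x) $ i $ j = (\<chi> i. gradient (dderiv (axis i 1) p) x) $ i $ j" by simp
qed

lemma tangential_derivative_poly:
  fixes F :: "(real ^ 'n) set"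
  assumes F: "convex F" "x \<in> F" and p: "real_polynomial_function p" and u: "\<And>y. y \<in> F \<Longrightarrow> u y = p y"
    and t: "t \<in> tangent_basis F"
  shows "tangential_derivative F t u x = dderiv t p x"
  unfolding tangential_derivative_def
  using t by (intro frechet_derivative_poly_within[OF F p u]) (auto simp: span_diff_point[OF F(2)] intro: span_base)

lemma tangential_derivative2_poly:
  fixes F :: "(real ^ 'n) set"
  assumes F: "convex F" "x \<in> F" and p: "real_polynomial_function p" and u: "\<And>y. y \<in> F \<Longrightarrow> u y = p y"
    and t: "t \<in> tangent_basis F"
  shows "tangential_derivative F t (tangential_derivative F t u) x = dderiv t (dderiv t p) x"
  by (rule tangential_derivative_poly[OF F _ _ t]) (use tangential_derivative_poly[OF F(1) _ p u t] p in auto)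

lemma tangential_laplacian_poly:
  fixes F :: "(real ^ 'n) set"
  assumes F: "convex F" "x \<in> F" and p: "real_polynomial_function p" and u: "\<And>y. y \<in> F \<Longrightarrow> u y = p y"
  shows "tangential_laplacian F u x = (\<Sum>t\<in>tangent_basis F. dderiv t (dderiv t p) x)"
  unfolding tangential_laplacian_def by (intro sum.cong refl tangential_derivative2_poly[OF F p u])

section \<open>The integral identity on one element\<close>

abbreviation partial :: "'n \<Rightarrow> (real ^ 'n \<Rightarrow> real) \<Rightarrow> real ^ 'n \<Rightarrow> real"
  where "partial i \<equiv> dderiv (axis i 1)"

definition laplacian :: "(real ^ 'n \<Rightarrow> real) \<Rightarrow> real ^ 'n \<Rightarrow> real"
  where "laplacian p x = (\<Sum>i\<in>UNIV. partial i (partial i p) x)"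

lemma hessian_nth: "hessian p x $ i $ j = partial j (partial i p) x"
  by (simp add: hessian_def gradient_nth)

lemma trace_hessian: "trace (hessian p x) = laplacian p x"
  by (simp add: trace_def laplacian_def hessian_nth)

lemma norm_hessian: "(norm (hessian p x))\<^sup>2 = (\<Sum>i\<in>UNIV. \<Sum>j\<in>UNIV. (partial i (partial j p) x)\<^sup>2)"
  unfolding power2_norm_eq_inner by (simp add: inner_vec_def hessian_nth power2_eq_square) (rule sum.swap)

lemma norm_gradient: "(norm (gradient p x))\<^sup>2 = (\<Sum>i\<in>UNIV. (partial i p x)\<^sup>2)"
  unfolding power2_norm_eq_inner by (simp add: inner_vec_def gradient_nth power2_eq_square)

lemma dderiv_expand: "dderiv t p x = (\<Sum>i\<in>UNIV. t $ i * partial i p x)"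
  unfolding dderiv_def[of t] by (simp add: inner_vec_def gradient_nth)

lemma real_polynomial_function_laplacian: "real_polynomial_function p \<Longrightarrow> real_polynomial_function (laplacian p)"
  unfolding laplacian_def[abs_def] by (intro real_polynomial_function_sum real_polynomial_function_dderiv) auto

lemma parseval:
  fixes x y :: "'a::euclidean_space"
  assumes E: "orthonormal E" and "card E = DIM('a)"
  shows "x \<bullet> y = (\<Sum>e\<in>E. (x \<bullet> e) * (e \<bullet> y))"
proof -
  have "x \<in> span E" using orthonormal_span[OF assms] by simp
  from orthonormal_expand[OF E this] have "x \<bullet> y = (\<Sum>e\<in>E. (x \<bullet> e) *\<^sub>R e) \<bullet> y" by simp
  then show ?thesis by (simp add: inner_sum_left)
qed

text \<open>
The trace of the Hessian does not depend on the orthonormal basis.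
\<close>

lemma laplacian_orthonormal:
  fixes E :: "(real ^ 'n) set"
  assumes E: "orthonormal E" "card E = CARD('n)" and p: "real_polynomial_function p"
  shows "laplacian p x = (\<Sum>e\<in>E. dderiv e (dderiv e p) x)"
proof -
  have "dderiv e (dderiv e p) x = (\<Sum>i\<in>UNIV. \<Sum>j\<in>UNIV. (e $ i * e $ j) * partial j (partial i p) x)" for e
  proof -
    have "dderiv e (dderiv e p) x = (\<Sum>i\<in>UNIV. e $ i * dderiv e (partial i p) x)"
      unfolding dderiv_expand[of e "dderiv e p"] using dderiv_commute[OF p] by metis
    then show ?thesis unfolding dderiv_expand[of e "partial _ p"] by (simp add: sum_distrib_left mult.assoc)
  qed
  then have "(\<Sum>e\<in>E. dderiv e (dderiv e p) x) = (\<Sum>e\<in>E. \<Sum>i\<in>UNIV. \<Sum>j\<in>UNIV. (e $ i * e $ j) * partial j (partial i p) x)" by simp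
  also have "\<dots> = (\<Sum>i\<in>UNIV. \<Sum>e\<in>E. \<Sum>j\<in>UNIV. (e $ i * e $ j) * partial j (partial i p) x)" by (rule sum.swap)
  also have "\<dots> = (\<Sum>i\<in>UNIV. \<Sum>j\<in>UNIV. \<Sum>e\<in>E. (e $ i * e $ j) * partial j (partial i p) x)" by (intro sum.cong refl sum.swap)
  also have "\<dots> = (\<Sum>i\<in>UNIV. \<Sum>j\<in>UNIV. (if j = i then 1 else 0) * partial j (partial i p) x)"
  proof (intro sum.cong refl)
    fix i j :: 'n
    have "(\<Sum>e\<in>E. e $ i * e $ j) = axis i 1 \<bullet> (axis j 1 :: real ^ 'n)"
      using parseval[of E "axis i 1" "axis j 1 :: real ^ 'n"] E by (simp add: inner_axis inner_axis')
    also have "\<dots> = (if j = i then 1 else 0)" unfolding inner_axis' by (simp add: axis_def)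
    finally show "(\<Sum>e\<in>E. (e $ i * e $ j) * partial j (partial i p) x) = (if j = i then 1 else 0) * partial j (partial i p) x"
      by (simp only: sum_distrib_right[symmetric])
  qed
  also have "\<dots> = laplacian p x" by (simp add: laplacian_def if_distrib[of "\<lambda>c. c * _"] cong: if_cong)
  finally show ?thesis by simp
qed

lemma facet_simplex_vertex:
  fixes K :: "(real ^ 'n) set"
  assumes K: "int CARD('n) simplex K" and F: "F facet_of K"
  obtains C p where "simplex_vertex C p" "K = convex hull C" "F = convex hull (C - {p})"
proof -
  obtain C where C: "\<not> affine_dependent C" "card C = Suc CARD('n)" "K = convex hull C"
    using K unfolding simplex_def by (metis of_nat_Suc of_nat_eq_iff add.commute)
  obtain p where p: "p \<in> C" "F = convex hull (C - {p})"
    using F unfolding C(3) facet_of_convex_hull_affine_independent[OF C(1)] by auto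
  show ?thesis using C p by (intro that[of C p]) (unfold_locales, auto)
qed

lemma facet_compact_convex:
  fixes K :: "(real ^ 'n) set"
  assumes "int CARD('n) simplex K" "F facet_of K" shows "compact F" "convex F"
  using assms compact_simplex convex_simplex by (meson facet_of_imp_face_of face_of_imp_compact face_of_imp_convex)+

lemma facet_orthonormal:
  fixes K :: "(real ^ 'n) set"
  assumes K: "int CARD('n) simplex K" and F: "F facet_of K"
  shows "orthonormal (insert (outer_normal K F) (tangent_basis F))"
    "card (insert (outer_normal K F) (tangent_basis F)) = CARD('n)" "outer_normal K F \<notin> tangent_basis F"
proof -
  obtain C p where SV: "simplex_vertex C p" "K = convex hull C" "F = convex hull (C - {p})"
    by (rule facet_simplex_vertex[OF K F])
  interpret simplex_vertex C p by fact
  let ?n = "outer_normal K F"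
  have n: "norm ?n = 1" "\<And>t. t \<in> tangent_basis F \<Longrightarrow> ?n \<bullet> t = 0" using norm_normal normal_tangent SV(2,3) by auto
  then show nB: "?n \<notin> tangent_basis F" "orthonormal (insert ?n (tangent_basis F))"
    using orthonormal_insert[OF tangent_basis(1)] by blast+
  show "card (insert ?n (tangent_basis F)) = CARD('n)"
    using nB orthonormal_finite[OF tangent_basis(1)[of F]] card_tangent_basis_facet SV(2,3) by simp
qed

lemma poly_divergence:
  fixes K :: "(real ^ 'n) set"
  assumes K: "int CARD('n) simplex K" and q: "\<And>i. real_polynomial_function (q i)"
  shows "(LINT x|lborel. indicator K x * (\<Sum>i\<in>UNIV. partial i (q i) x)) =
    (\<Sum>F | F facet_of K. LINT x|face_measure F. (\<Sum>i\<in>UNIV. outer_normal K F $ i * q i x))"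
proof -
  have cK: "compact K" by (rule compact_simplex[OF K])
  note cF = facet_compact_convex(1)[OF K]
  have "(LINT x|lborel. indicator K x * (\<Sum>i\<in>UNIV. partial i (q i) x)) = (\<Sum>i\<in>UNIV. LINT x|lborel. indicator K x * partial i (q i) x)"
    unfolding sum_distrib_left using q
    by (intro Bochner_Integration.integral_sum integrable_compact_lborel cK continuous_on_poly) auto
  also have "\<dots> = (\<Sum>i\<in>UNIV. \<Sum>F | F facet_of K. (axis i 1 \<bullet> outer_normal K F) * (LINT x|face_measure F. q i x))"
    unfolding dderiv_def using q by (intro sum.cong refl simplex_divergence[OF K] GDERIV_poly continuous_on_gradient) auto
  also have "\<dots> = (\<Sum>F | F facet_of K. \<Sum>i\<in>UNIV. outer_normal K F $ i * (LINT x|face_measure F. q i x))"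
    by (subst sum.swap) (simp add: inner_axis')
  also have "\<dots> = (\<Sum>F | F facet_of K. LINT x|face_measure F. (\<Sum>i\<in>UNIV. outer_normal K F $ i * q i x))"
    using q by (intro sum.cong refl, subst integral_face_sum) (auto intro!: cF continuous_intros continuous_on_poly)
  finally show ?thesis .
qed

text \<open>
The flux through a face with normal n of the field \<Delta>p \<nabla>p - D^2p \<nabla>p - 2\<lambda> p \<nabla>p, written in
tangential and normal derivatives.
\<close>

definition boundary_density :: "real \<Rightarrow> (real ^ 'n) set \<Rightarrow> real ^ 'n \<Rightarrow> (real ^ 'n \<Rightarrow> real) \<Rightarrow> real ^ 'n \<Rightarrow> real"
  where "boundary_density lam F n p x = (\<Sum>t\<in>tangent_basis F. dderiv t (dderiv t p) x * dderiv n p x - dderiv t p x * dderiv t (dderiv n p) x) - 2 * lam * p x * dderiv n p x"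

text \<open>
The difference of the two volume integrands is the divergence of \<Delta>p \<nabla>p - D^2p \<nabla>p - 2\<lambda> p \<nabla>p;
its third derivatives cancel because derivatives commute. The flux is rewritten by expanding the
Laplacian and the product D^2p \<nabla>p in an orthonormal frame made of the normal and the tangent basis:
the contributions of the normal direction to the two terms are equal.
\<close>

lemma element_identity:
  fixes K :: "(real ^ 'n) set"
  assumes K: "int CARD('n) simplex K" and p: "real_polynomial_function p"
  shows "(LINT x|lborel. indicator K x * (laplacian p x - lam * p x)\<^sup>2) =
    (LINT x|lborel. indicator K x * ((norm (hessian p x))\<^sup>2 + 2 * lam * (norm (gradient p x))\<^sup>2 + lam\<^sup>2 * (p x)\<^sup>2))
    + (\<Sum>F | F facet_of K. LINT x|face_measure F. boundary_density lam F (outer_normal K F) p x)"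
proof -
  note [intro] = p real_polynomial_function_laplacian
  \<comment> \<open>the components of the field whose divergence is the difference of the volume integrands\<close>
  let ?q = "\<lambda>i x. partial i p x * laplacian p x - (\<Sum>j\<in>UNIV. partial j p x * partial i (partial j p) x) - 2 * lam * p x * partial i p x"
  note rpf = real_polynomial_function_diff real_polynomial_function_sum real_polynomial_function.intros(2-4)
     real_polynomial_function_dderiv real_polynomial_function_laplacian p finite_class.finite_UNIV
  have q: "real_polynomial_function (?q i)" for i
    by (intro rpf)
  have cK: "compact K" by (rule compact_simplex[OF K])
  have Dq: "partial i (?q i) x = partial i (partial i p) x * laplacian p x + (\<Sum>j\<in>UNIV. partial i p x * partial i (partial j (partial j p)) x)
      - (\<Sum>j\<in>UNIV. partial j p x * partial j (partial i (partial i p)) x) - (\<Sum>j\<in>UNIV. (partial i (partial j p) x)\<^sup>2)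
      - 2 * lam * ((partial i p x)\<^sup>2 + p x * partial i (partial i p) x)" for i x
  proof -
    have c: "partial i (partial i (partial j p)) = partial j (partial i (partial i p))" for j
      using dderiv_commute[OF p, of "axis i 1" "axis j 1"] dderiv_commute[OF real_polynomial_function_dderiv[OF p], of "axis i 1" "axis j 1"] by metis
    have laplacianD: "partial i (laplacian p) x = (\<Sum>j\<in>UNIV. partial i (partial j (partial j p)) x)"
      unfolding laplacian_def[abs_def] by (subst dderiv_sum) (auto)
    have "partial i (?q i) x = (partial i p x * partial i (laplacian p) x + laplacian p x * partial i (partial i p) x)
       - (\<Sum>j\<in>UNIV. partial j p x * partial i (partial i (partial j p)) x + partial i (partial j p) x * partial i (partial j p) x)
       - (2 * lam * p x * partial i (partial i p) x + partial i p x * (2 * lam * partial i p x))"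
    proof -
      have 1: "partial i (\<lambda>x. partial i p x * laplacian p x) = (\<lambda>x. partial i p x * partial i (laplacian p) x + laplacian p x * partial i (partial i p) x)"
        by (intro dderiv_mult rpf)
      have 2: "partial i (\<lambda>x. \<Sum>j\<in>UNIV. partial j p x * partial i (partial j p) x) = (\<lambda>x. \<Sum>j\<in>UNIV. partial j p x * partial i (partial i (partial j p)) x + partial i (partial j p) x * partial i (partial j p) x)"
        by (subst dderiv_sum, simp, intro rpf, subst dderiv_mult, (intro rpf)+, rule refl)
      have 3: "partial i (\<lambda>x. 2 * lam * p x) = (\<lambda>x. 2 * lam * partial i p x)"
        by (subst dderiv_mult) (auto simp: dderiv_const intro: rpf)
      have 4: "partial i (\<lambda>x. 2 * lam * p x * partial i p x) = (\<lambda>x. 2 * lam * p x * partial i (partial i p) x + partial i p x * (2 * lam * partial i p x))"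
      proof -
        have "partial i (\<lambda>x. (2 * lam * p x) * partial i p x) = (\<lambda>x. 2 * lam * p x * partial i (partial i p) x + partial i p x * partial i (\<lambda>x. 2 * lam * p x) x)"
          by (intro dderiv_mult rpf)
        then show ?thesis unfolding 3 .
      qed
      show ?thesis
        by (subst dderiv_diff, (intro rpf)+, subst dderiv_diff, (intro rpf)+, unfold 1 2 4, rule refl)
    qed
    then show ?thesis unfolding laplacianD c by (simp add: sum.distrib sum_distrib_left power2_eq_square algebra_simps)
  qed
  have div: "(\<Sum>i\<in>UNIV. partial i (?q i) x) = (laplacian p x - lam * p x)\<^sup>2
     - ((norm (hessian p x))\<^sup>2 + 2 * lam * (norm (gradient p x))\<^sup>2 + lam\<^sup>2 * (p x)\<^sup>2)" for x
  proof -
    have "(\<Sum>i\<in>UNIV. partial i (?q i) x) = laplacian p x * laplacian p x - (norm (hessian p x))\<^sup>2 - 2 * lam * ((norm (gradient p x))\<^sup>2 + p x * laplacian p x)"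
      unfolding Dq norm_hessian norm_gradient
      by (simp add: sum.distrib sum_subtractf laplacian_def sum_distrib_right sum_distrib_left[symmetric])
        (unfold sum_distrib_left, rule sum.swap)
    also have "\<dots> = (laplacian p x - lam * p x)\<^sup>2 - ((norm (hessian p x))\<^sup>2 + 2 * lam * (norm (gradient p x))\<^sup>2 + lam\<^sup>2 * (p x)\<^sup>2)"
      by (simp add: power2_eq_square algebra_simps)
    finally show ?thesis .
  qed
  have bd: "(\<Sum>i\<in>UNIV. outer_normal K F $ i * ?q i x) = boundary_density lam F (outer_normal K F) p x" if F: "F facet_of K" for F x
  proof -
    let ?n = "outer_normal K F" let ?B = "tangent_basis F"
    note E = facet_orthonormal[OF K F]
    have fB: "finite ?B" by (rule orthonormal_finite[OF tangent_basis(1)])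
    have "(\<Sum>i\<in>UNIV. ?n $ i * ?q i x) = (\<Sum>i\<in>UNIV. ?n $ i * partial i p x) * laplacian p x - (\<Sum>i\<in>UNIV. \<Sum>j\<in>UNIV. partial j p x * (?n $ i * partial i (partial j p) x))
        - 2 * lam * p x * (\<Sum>i\<in>UNIV. ?n $ i * partial i p x)"
      by (simp add: right_diff_distrib sum_subtractf sum_distrib_left sum_distrib_right mult_ac)
    also have "(\<Sum>i\<in>UNIV. \<Sum>j\<in>UNIV. partial j p x * (?n $ i * partial i (partial j p) x)) = (\<Sum>j\<in>UNIV. partial j p x * dderiv ?n (partial j p) x)"
      by (subst sum.swap) (simp add: dderiv_expand[of ?n] sum_distrib_left)
    also have "\<dots> = gradient p x \<bullet> gradient (dderiv ?n p) x"
    proof -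
      have "dderiv ?n (partial j p) = partial j (dderiv ?n p)" for j by (rule dderiv_commute[OF p])
      then show ?thesis unfolding inner_vec_def gradient_nth by simp
    qed
    also have "\<dots> = (\<Sum>e\<in>insert ?n ?B. dderiv e p x * dderiv e (dderiv ?n p) x)"
    proof -
      have "gradient p x \<bullet> gradient (dderiv ?n p) x = (\<Sum>e\<in>insert ?n ?B. (gradient p x \<bullet> e) * (e \<bullet> gradient (dderiv ?n p) x))"
        by (rule parseval[OF E(1)]) (use E(2) in simp)
      then show ?thesis unfolding inner_commute[of "gradient p x" "_ :: real ^ 'n"] dderiv_def[of _ _ x] .
    qed
    also have "(\<Sum>i\<in>UNIV. ?n $ i * partial i p x) = dderiv ?n p x" by (simp add: dderiv_expand[of ?n])
    also have "dderiv ?n p x * laplacian p x - (\<Sum>e\<in>insert ?n ?B. dderiv e p x * dderiv e (dderiv ?n p) x) - 2 * lam * p x * dderiv ?n p x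
       = boundary_density lam F ?n p x"
      unfolding laplacian_orthonormal[OF E(1,2) p] using fB E(3) by (simp add: boundary_density_def sum_subtractf sum_distrib_left algebra_simps)
    finally show ?thesis .
  qed
  have i: "integrable lborel (\<lambda>x. indicator K x * (laplacian p x - lam * p x)\<^sup>2)"
    "integrable lborel (\<lambda>x. indicator K x * ((norm (hessian p x))\<^sup>2 + 2 * lam * (norm (gradient p x))\<^sup>2 + lam\<^sup>2 * (p x)\<^sup>2))"
    unfolding norm_hessian norm_gradient
    by (intro integrable_compact_lborel cK continuous_intros continuous_on_poly real_polynomial_function_dderiv real_polynomial_function_laplacian p)+
  have "(LINT x|lborel. indicator K x * (laplacian p x - lam * p x)\<^sup>2) -
    (LINT x|lborel. indicator K x * ((norm (hessian p x))\<^sup>2 + 2 * lam * (norm (gradient p x))\<^sup>2 + lam\<^sup>2 * (p x)\<^sup>2))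
    = (LINT x|lborel. indicator K x * (\<Sum>i\<in>UNIV. partial i (?q i) x))"
    unfolding div right_diff_distrib by (rule Bochner_Integration.integral_diff[OF i, symmetric])
  also have "\<dots> = (\<Sum>F | F facet_of K. LINT x|face_measure F. boundary_density lam F (outer_normal K F) p x)"
    unfolding poly_divergence[OF K q] using bd by (intro sum.cong refl) simp
  finally show ?thesis by simp
qed

section \<open>Boundary values of limits of test functions\<close>

lemma frame_map_in_affine_hull:
  fixes F :: "(real ^ 'n) set"
  assumes "F \<noteq> {}" shows "face_map F s \<in> affine hull F"
proof -
  have "(SOME a. a \<in> F) \<in> F" using assms by (simp add: some_in_eq)
  then show ?thesis unfolding frame_map_def
    by (intro affine_hull_add_tangent hull_inc span_sum span_mul span_base) auto
qed

text \<open>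
If f were positive somewhere on F, it would be positive on a small cube of coordinates around a point
of the relative interior.
\<close>

lemma face_integral_eq_0:
  fixes F :: "(real ^ 'n) set" and f :: "real ^ 'n \<Rightarrow> real"
  assumes F: "compact F" "convex F" and f: "continuous_on UNIV f" "\<And>x. f x \<ge> 0"
    and 0: "(LINT x|face_measure F. f x) = 0" and y: "y \<in> F"
  shows "f y = 0"
proof (rule ccontr)
  assume "f y \<noteq> 0"
  let ?B = "tangent_basis F" let ?a = "SOME a. a \<in> F"
  note B = tangent_basis(1)[of F]
  note fB = orthonormal_finite[OF B]
  have a: "?a \<in> F" using y by (rule someI)
  have "open {x. f x > 0}" using f(1) by (intro open_Collect_less continuous_on_const) auto
  moreover have "y \<in> closure (rel_interior F)"
    using convex_closure_rel_interior[OF F(2)] y closure_subset by blast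
  moreover have "y \<in> {x. f x > 0}" using \<open>f y \<noteq> 0\<close> f(2)[of y] by simp
  ultimately obtain z where z: "z \<in> rel_interior F" "f z > 0"
    by (metis (mono_tags, lifting) closure_iff_nhds_not_empty mem_Collect_eq order_refl disjoint_iff)
  obtain e1 where e1: "e1 > 0" "ball z e1 \<inter> affine hull F \<subseteq> F" using z(1) unfolding mem_rel_interior_ball by blast
  obtain e2 where e2: "e2 > 0" "ball z e2 \<subseteq> {x. f x > 0}"
    using \<open>open {x. f x > 0}\<close> z(2) by (metis open_contains_ball mem_Collect_eq)
  \<comment> \<open>the norm of a point is at most the sum of its coordinates, hence the division by their number\<close>
  define \<epsilon> where "\<epsilon> = min e1 e2 / (real (card ?B) + 1)"
  have eps: "\<epsilon> > 0" using e1 e2 by (simp add: \<epsilon>_def)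
  define s1 where "s1 t = (z - ?a) \<bullet> t" for t
  let ?Q = "Pi\<^sub>E ?B (\<lambda>t. {s1 t - \<epsilon> <..< s1 t + \<epsilon>})"
  have zF: "z \<in> F" using z(1) rel_interior_subset by blast
  have "z - ?a = (\<Sum>t\<in>?B. s1 t *\<^sub>R t)"
    unfolding s1_def by (rule orthonormal_expand[OF B diff_in_span_tangent_basis[OF a zF]])
  then have zeq: "z = ?a + (\<Sum>t\<in>?B. s1 t *\<^sub>R t)" by (simp add: algebra_simps)
  have Q: "face_map F s \<in> F \<and> f (face_map F s) > 0" if "s \<in> ?Q" for s
  proof -
    have "face_map F s - z = (\<Sum>t\<in>?B. (s t - s1 t) *\<^sub>R t)"
      by (subst zeq) (simp add: frame_map_def scaleR_diff_left sum_subtractf)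
    then have "norm (face_map F s - z) \<le> (\<Sum>t\<in>?B. norm ((s t - s1 t) *\<^sub>R t))" by (simp only: norm_sum)
    also have "\<dots> \<le> (\<Sum>t\<in>?B. \<epsilon>)"
    proof (rule sum_mono)
      fix t assume t: "t \<in> ?B"
      have "norm t = 1" using B t by (simp add: orthonormal_def)
      moreover have "\<bar>s t - s1 t\<bar> \<le> \<epsilon>" using PiE_mem[OF that t] by (simp add: abs_le_iff)
      ultimately show "norm ((s t - s1 t) *\<^sub>R t) \<le> \<epsilon>" by simp
    qed
    also have "\<dots> = real (card ?B) * \<epsilon>" by simp
    also have "\<dots> < (real (card ?B) + 1) * \<epsilon>" using eps by simp
    also have "\<dots> = min e1 e2" by (simp add: \<epsilon>_def)
    finally have "face_map F s \<in> ball z e1" "face_map F s \<in> ball z e2" by (simp_all add: dist_norm norm_minus_commute)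
    moreover have "face_map F s \<in> affine hull F" using y by (intro frame_map_in_affine_hull) auto
    ultimately show ?thesis using e1 e2 by auto
  qed
  let ?g = "\<lambda>s. indicator F (face_map F s) * f (face_map F s)"
  have int: "integrable (PiL ?B) ?g" by (rule integrable_frame[OF B F(1) f(1)])
  have "(LINT s|PiL ?B. ?g s) = 0"
    using 0 F(1) f(1) integral_face[of F f] by (simp add: borel_compact borel_measurable_continuous_onI)
  then have "AE s in PiL ?B. ?g s = 0"
    using integral_nonneg_eq_0_iff_AE[OF int] f(2) by (auto simp: indicator_def)
  then have "AE s in PiL ?B. s \<notin> ?Q"
    by eventually_elim (use Q in fastforce)
  moreover have "?Q \<in> sets (PiL ?B)" using fB by (intro sets_PiM_I_finite) auto
  ultimately have "emeasure (PiL ?B) ?Q = 0"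
    using AE_iff_measurable[of ?Q "PiL ?B" "\<lambda>s. s \<notin> ?Q"] by (auto simp: space_PiM)
  moreover have "emeasure (PiL ?B) ?Q = ennreal (2 * \<epsilon>) ^ card ?B"
    using fB eps by (subst lborel_prod.emeasure_PiM) auto
  ultimately show False using eps by (simp add: ennreal_zero_less_mult_iff power_eq_0_iff)
qed

lemma GDERIV_inner: "GDERIV (\<lambda>x. (x - p) \<bullet> v) x :> v"
  unfolding gderiv_def by (auto intro!: derivative_eq_intros)

lemma GDERIV_power:
  assumes "GDERIV f x :> df"
  shows "GDERIV (\<lambda>x. f x ^ m) x :> (real m * f x ^ (m - 1)) *\<^sub>R df"
  using GDERIV_DERIV_compose[OF assms DERIV_pow[of m]] by simp

context simplex_vertex begin

lemma weight_bounds: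
  assumes y: "y \<in> F" and x: "x \<in> K"
  shows "0 \<le> (x - p) \<bullet> \<nu> / (\<nu> \<bullet> (y - p))" "(x - p) \<bullet> \<nu> / (\<nu> \<bullet> (y - p)) \<le> 1"
proof -
  obtain r z where r: "x = p + r *\<^sub>R (z - p)" "0 \<le> r" "r \<le> 1" "z \<in> F" using x unfolding simplex_eq_cone by auto
  have "(x - p) \<bullet> \<nu> = r * (\<nu> \<bullet> (z - p))" using r by (simp add: inner_commute)
  also have "\<nu> \<bullet> (z - p) = \<nu> \<bullet> (y - p)" using normal_orthogonal[OF r(4) y] by (simp add: inner_diff_right)
  finally have e: "(x - p) \<bullet> \<nu> / (\<nu> \<bullet> (y - p)) = r" using normal_apex[OF y] by simp
  show "0 \<le> (x - p) \<bullet> \<nu> / (\<nu> \<bullet> (y - p))" "(x - p) \<bullet> \<nu> / (\<nu> \<bullet> (y - p)) \<le> 1"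
    unfolding e using r by auto
qed

text \<open>
The affine function s equals 1 on F and 0 at the apex, and (x - p) \<cdot> \<nabla>s = s. Hence the weight s^m
adds m to the dimension in the divergence formula, while its mass concentrates near F as m grows.
\<close>

lemma weighted_divergence:
  fixes g :: "real ^ 'n \<Rightarrow> real"
  assumes g: "\<And>x. GDERIV g x :> G x" and G: "continuous_on UNIV G" and y: "y \<in> F"
  defines "c \<equiv> \<nu> \<bullet> (y - p)"
  defines "s \<equiv> \<lambda>x. (x - p) \<bullet> \<nu> / c"
  shows "(LINT x|lborel. indicator K x * ((real CARD('n) + real m) * ((g x)\<^sup>2 * s x ^ m) + 2 * (s x ^ m * (g x * ((x - p) \<bullet> G x)))))
    = c * (LINT x|face_measure F. (g x)\<^sup>2)"
proof -
  have c: "c > 0" unfolding c_def by (rule normal_apex[OF y])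
  have s: "GDERIV s x :> (1 / c) *\<^sub>R \<nu>" for x
    using GDERIV_inner[of p "(1 / c) *\<^sub>R \<nu>" x] by (simp add: s_def[abs_def])
  note cg = continuous_on_GDERIV[OF g]
  have cs: "continuous_on UNIV s" using c unfolding s_def by (intro continuous_intros) auto
  let ?h = "\<lambda>x. (g x)\<^sup>2 * s x ^ m"
  let ?H = "\<lambda>x. (g x)\<^sup>2 *\<^sub>R (real m * s x ^ (m - 1)) *\<^sub>R (1 / c) *\<^sub>R \<nu> + (s x ^ m) *\<^sub>R (2 * g x) *\<^sub>R G x"
  have h: "GDERIV ?h x :> ?H x" for x
    using GDERIV_mult[OF GDERIV_power[OF g, of 2] GDERIV_power[OF s, of m]] by simp
  have H: "continuous_on UNIV ?H" by (intro continuous_intros cg cs G)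
  have ms: "real m * s x ^ (m - 1) * s x = real m * s x ^ m" for x
    by (cases m) auto
  have "(LINT x|lborel. indicator K x * (CARD('n) * ?h x + (x - p) \<bullet> ?H x)) = c * (LINT x|face_measure F. ?h x)"
    by (rule divergence_vertex[OF h H y, folded c_def])
  also have "(LINT x|face_measure F. ?h x) = (LINT x|face_measure F. (g x)\<^sup>2)"
  proof (rule integral_face_cong[OF borel_compact[OF compact_F]])
    fix x assume x: "x \<in> F"
    have "\<nu> \<bullet> (x - p) = c" using normal_orthogonal[OF y x] unfolding c_def by (simp add: inner_diff_right)
    then have "s x = 1" using c by (simp add: s_def inner_commute)
    then show "?h x = (g x)\<^sup>2" by simp
  qed
  also have "(LINT x|lborel. indicator K x * (CARD('n) * ?h x + (x - p) \<bullet> ?H x)) =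
    (LINT x|lborel. indicator K x * ((real CARD('n) + real m) * ((g x)\<^sup>2 * s x ^ m) + 2 * (s x ^ m * (g x * ((x - p) \<bullet> G x)))))"
  proof (intro Bochner_Integration.integral_cong refl arg_cong2[where f="(*)"])
    fix x
    have "(x - p) \<bullet> ?H x = (g x)\<^sup>2 * (real m * s x ^ (m - 1) * s x) + 2 * (s x ^ m * (g x * ((x - p) \<bullet> G x)))"
      by (simp add: inner_add_right s_def algebra_simps)
    then show "CARD('n) * ?h x + (x - p) \<bullet> ?H x = (real CARD('n) + real m) * ((g x)\<^sup>2 * s x ^ m) + 2 * (s x ^ m * (g x * ((x - p) \<bullet> G x)))"
      unfolding ms by (simp add: algebra_simps)
  qed
  finally show ?thesis .
qed

text \<open>
A limit in L^2 of functions vanishing on F, with gradients bounded in L^2, vanishes on F. Put N = n + m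
and use the weight s^m. For the functions \<open>\<phi> j\<close> the weighted identity has no face term, and
Young's inequality bounds N times the weighted integral of \<open>(\<phi> j)^2\<close> by a multiple of 1/N. As
\<open>\<phi> j\<close> tends to q, the same holds for q up to constants. In the weighted identity for q the
remaining volume term is also of order 1/N, since the weight has mass of that order. So the integral
of q^2 over F is of order 1/N for every m.
\<close>

lemma vanishing_on_facet:
  fixes q :: "real ^ 'n \<Rightarrow> real" and \<phi> :: "nat \<Rightarrow> real ^ 'n \<Rightarrow> real"
  assumes q: "\<And>x. GDERIV q x :> Q x" "continuous_on UNIV Q"
    and \<phi>: "\<And>j x. GDERIV (\<phi> j) x :> \<Phi> j x" "\<And>j. continuous_on UNIV (\<Phi> j)"
    and \<phi>0: "\<And>j x. x \<in> F \<Longrightarrow> \<phi> j x = 0"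
    and lim: "(\<lambda>j. LINT x|lborel. indicator K x * (\<phi> j x - q x)\<^sup>2) \<longlonglongrightarrow> 0"
    and bound: "\<And>j. (LINT x|lborel. indicator K x * (norm (\<Phi> j x))\<^sup>2) \<le> A"
    and y: "y \<in> F"
  shows "q y = 0"
proof -
  note cq = continuous_on_GDERIV[OF q(1)] and c\<phi> = continuous_on_GDERIV[OF \<phi>(1)]
  define c where "c = \<nu> \<bullet> (y - p)"
  have c: "c > 0" unfolding c_def by (rule normal_apex[OF y])
  define s where "s = (\<lambda>x. (x - p) \<bullet> \<nu> / c)"
  have s01: "0 \<le> s x" "s x \<le> 1" if "x \<in> K" for x
    using weight_bounds[OF y that] by (auto simp: s_def c_def)
  have sm: "0 \<le> s x ^ m" "s x ^ m \<le> 1" if "x \<in> K" for x m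
    using s01[OF that] by (auto intro: power_le_one)
  have cs: "continuous_on UNIV s" using c unfolding s_def by (intro continuous_intros) auto
  note int = integrable_compact_lborel[OF compact_K]
  have wd: "(LINT x|lborel. indicator K x * ((real CARD('n) + real m) * ((g x)\<^sup>2 * s x ^ m) + 2 * (s x ^ m * (g x * ((x - p) \<bullet> G x)))))
    = c * (LINT x|face_measure F. (g x)\<^sup>2)" if "\<And>x. GDERIV g x :> G x" "continuous_on UNIV G" for g :: "real ^ 'n \<Rightarrow> real" and G m
    using weighted_divergence[OF that y, of m] by (simp add: s_def c_def)
  obtain R where R: "R > 0" "\<And>x. x \<in> K \<Longrightarrow> norm (x - p) \<le> R"
  proof -
    have "compact ((\<lambda>x. x - p) ` K)" by (intro compact_continuous_image compact_K continuous_intros)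
    from compact_imp_bounded[OF this] obtain R where "R > 0" "\<forall>z\<in>(\<lambda>x. x - p) ` K. norm z \<le> R" unfolding bounded_pos by auto
    then show ?thesis by (intro that[of R]) auto
  qed
  obtain M where M: "M > 0" "\<And>x. x \<in> K \<Longrightarrow> \<bar>2 * (q x * ((x - p) \<bullet> Q x))\<bar> \<le> M"
  proof -
    have "compact ((\<lambda>x. 2 * (q x * ((x - p) \<bullet> Q x))) ` K)"
      using cq q(2) by (intro compact_continuous_image compact_K continuous_intros) (auto intro: continuous_on_subset)
    from compact_imp_bounded[OF this] obtain M where "M > 0" "\<forall>z\<in>(\<lambda>x. 2 * (q x * ((x - p) \<bullet> Q x))) ` K. norm z \<le> M" unfolding bounded_pos by auto
    then show ?thesis by (intro that[of M]) auto
  qed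
  define V where "V = c * (LINT x|face_measure F. (1::real))"
  have key: "c * (LINT x|face_measure F. (q x)\<^sup>2) \<le> (8 * R\<^sup>2 * A + M * V) / N" if N: "N = real CARD('n) + real m" for N m
  proof -
    have N0: "N > 0" using N by (simp add: add_pos_nonneg)
    \<comment> \<open>the weighted identity for the constant 1: the weight has mass V / N\<close>
    have one: "N * (LINT x|lborel. indicator K x * s x ^ m) = V"
      using wd[of "\<lambda>_. 1" "\<lambda>_. 0" m, OF GDERIV_const continuous_on_const] unfolding V_def N
      by (simp add: mult.left_commute[of "indicator K _"])
    \<comment> \<open>the weighted identity for \<phi> j, estimated with Young's inequality; its face term vanishes\<close>
    have phi: "N * (LINT x|lborel. indicator K x * ((\<phi> j x)\<^sup>2 * s x ^ m)) \<le> 4 * R\<^sup>2 * A / N" for j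
    proof -
      have "(LINT x|face_measure F. (\<phi> j x)\<^sup>2) = (LINT x|face_measure F. 0)"
        by (rule integral_face_cong[OF borel_compact[OF compact_F]]) (simp add: \<phi>0)
      then have z: "(LINT x|lborel. indicator K x * (N * ((\<phi> j x)\<^sup>2 * s x ^ m) + 2 * (s x ^ m * (\<phi> j x * ((x - p) \<bullet> \<Phi> j x))))) = 0"
        using wd[OF \<phi>, of m j] unfolding N by simp
      have "N * (LINT x|lborel. indicator K x * ((\<phi> j x)\<^sup>2 * s x ^ m)) - 4 * R\<^sup>2 / N * (LINT x|lborel. indicator K x * (norm (\<Phi> j x))\<^sup>2)
        = (LINT x|lborel. indicator K x * (N * ((\<phi> j x)\<^sup>2 * s x ^ m) - 4 * R\<^sup>2 / N * (norm (\<Phi> j x))\<^sup>2))"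
      proof -
        have "(LINT x|lborel. N * (indicator K x * ((\<phi> j x)\<^sup>2 * s x ^ m)) - 4 * R\<^sup>2 / N * (indicator K x * (norm (\<Phi> j x))\<^sup>2))
          = (LINT x|lborel. N * (indicator K x * ((\<phi> j x)\<^sup>2 * s x ^ m))) - (LINT x|lborel. 4 * R\<^sup>2 / N * (indicator K x * (norm (\<Phi> j x))\<^sup>2))"
          by (intro Bochner_Integration.integral_diff integrable_mult_right int continuous_intros c\<phi> cs \<phi>)
        then have "N * (LINT x|lborel. indicator K x * ((\<phi> j x)\<^sup>2 * s x ^ m)) - 4 * R\<^sup>2 / N * (LINT x|lborel. indicator K x * (norm (\<Phi> j x))\<^sup>2)
          = (LINT x|lborel. N * (indicator K x * ((\<phi> j x)\<^sup>2 * s x ^ m)) - 4 * R\<^sup>2 / N * (indicator K x * (norm (\<Phi> j x))\<^sup>2))"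
          by (simp only: integral_mult_right_zero)
        also have "\<dots> = (LINT x|lborel. indicator K x * (N * ((\<phi> j x)\<^sup>2 * s x ^ m) - 4 * R\<^sup>2 / N * (norm (\<Phi> j x))\<^sup>2))"
          by (intro Bochner_Integration.integral_cong refl) (simp add: algebra_simps)
        finally show ?thesis .
      qed
      also have "\<dots> \<le> (LINT x|lborel. indicator K x * (2 * (N * ((\<phi> j x)\<^sup>2 * s x ^ m) + 2 * (s x ^ m * (\<phi> j x * ((x - p) \<bullet> \<Phi> j x))))))"
      proof (rule integral_mono)
        fix x
        show "indicator K x * (N * ((\<phi> j x)\<^sup>2 * s x ^ m) - 4 * R\<^sup>2 / N * (norm (\<Phi> j x))\<^sup>2)
          \<le> indicator K x * (2 * (N * ((\<phi> j x)\<^sup>2 * s x ^ m) + 2 * (s x ^ m * (\<phi> j x * ((x - p) \<bullet> \<Phi> j x)))))"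
        proof (cases "x \<in> K")
          case True
          let ?b = "(x - p) \<bullet> \<Phi> j x" let ?f = "\<phi> j x"
          have b: "?b\<^sup>2 \<le> R\<^sup>2 * (norm (\<Phi> j x))\<^sup>2"
          proof -
            have "\<bar>?b\<bar> \<le> norm (x - p) * norm (\<Phi> j x)" by (rule Cauchy_Schwarz_ineq2)
            also have "\<dots> \<le> R * norm (\<Phi> j x)" using R(2)[OF True] by (intro mult_right_mono) auto
            finally show ?thesis by (metis abs_ge_zero power2_abs power_mono power_mult_distrib)
          qed
          have "0 \<le> (N * ?f + 2 * ?b)\<^sup>2" by simp
          then have "- 4 * ?b\<^sup>2 \<le> N * (N * ?f\<^sup>2 + 4 * (?f * ?b))" by (simp add: power2_eq_square algebra_simps)
          then have "- 4 * ?b\<^sup>2 / N \<le> N * ?f\<^sup>2 + 4 * (?f * ?b)" by (subst pos_divide_le_eq[OF N0]) (simp only: mult.commute)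
          then have "s x ^ m * (- 4 * ?b\<^sup>2 / N) \<le> s x ^ m * (N * ?f\<^sup>2 + 4 * (?f * ?b))"
            using sm[OF True] by (intro mult_left_mono) auto
          moreover have "s x ^ m * (4 * ?b\<^sup>2 / N) \<le> 1 * (4 * (R\<^sup>2 * (norm (\<Phi> j x))\<^sup>2) / N)"
            using sm[OF True] b N0 by (intro mult_mono divide_right_mono) auto
          ultimately have "- (4 * R\<^sup>2 / N * (norm (\<Phi> j x))\<^sup>2) \<le> s x ^ m * (N * ?f\<^sup>2 + 4 * (?f * ?b))" by (simp add: algebra_simps)
          then show ?thesis using True by (simp add: algebra_simps)
        qed simp
      qed (intro int continuous_intros c\<phi> cs \<phi>)+
      also have "\<dots> = 2 * (LINT x|lborel. indicator K x * (N * ((\<phi> j x)\<^sup>2 * s x ^ m) + 2 * (s x ^ m * (\<phi> j x * ((x - p) \<bullet> \<Phi> j x)))))"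
        by (subst integral_mult_right_zero[symmetric], intro Bochner_Integration.integral_cong refl) (simp only: mult_ac)
      also have "\<dots> = 0" unfolding z by simp
      finally have "N * (LINT x|lborel. indicator K x * ((\<phi> j x)\<^sup>2 * s x ^ m)) \<le> 4 * R\<^sup>2 / N * (LINT x|lborel. indicator K x * (norm (\<Phi> j x))\<^sup>2)" by simp
      also have "\<dots> \<le> 4 * R\<^sup>2 / N * A" using bound N0 by (intro mult_left_mono) auto
      finally show ?thesis by simp
    qed
    have "c * (LINT x|face_measure F. (q x)\<^sup>2) \<le> 8 * R\<^sup>2 * A / N + M * V / N + 2 * N * (LINT x|lborel. indicator K x * (\<phi> j x - q x)\<^sup>2)" for j
    proof -
      have "c * (LINT x|face_measure F. (q x)\<^sup>2) = (LINT x|lborel. indicator K x * (N * ((q x)\<^sup>2 * s x ^ m) + 2 * (s x ^ m * (q x * ((x - p) \<bullet> Q x)))))"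
        unfolding N by (rule wd[OF q, symmetric])
      also have "\<dots> \<le> (LINT x|lborel. 2 * (N * (indicator K x * ((\<phi> j x)\<^sup>2 * s x ^ m))) + (M * (indicator K x * s x ^ m) + 2 * N * (indicator K x * (\<phi> j x - q x)\<^sup>2)))"
      proof (rule integral_mono)
        fix x
        show "indicator K x * (N * ((q x)\<^sup>2 * s x ^ m) + 2 * (s x ^ m * (q x * ((x - p) \<bullet> Q x))))
          \<le> 2 * (N * (indicator K x * ((\<phi> j x)\<^sup>2 * s x ^ m))) + (M * (indicator K x * s x ^ m) + 2 * N * (indicator K x * (\<phi> j x - q x)\<^sup>2))"
        proof (cases "x \<in> K")
          case True
          let ?f = "\<phi> j x" let ?w = "s x ^ m"
          have w: "0 \<le> ?w" "?w \<le> 1" using sm[OF True] by auto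
          have "0 \<le> (2 * ?f - q x)\<^sup>2" by simp
          then have "(q x)\<^sup>2 \<le> 2 * ?f\<^sup>2 + 2 * (?f - q x)\<^sup>2" by (simp add: power2_eq_square algebra_simps)
          then have "(q x)\<^sup>2 * ?w \<le> (2 * ?f\<^sup>2 + 2 * (?f - q x)\<^sup>2) * ?w" using w by (intro mult_right_mono)
          moreover have "2 * (?f - q x)\<^sup>2 * ?w \<le> 2 * (?f - q x)\<^sup>2 * 1" using w by (intro mult_left_mono) auto
          ultimately have 1: "(q x)\<^sup>2 * ?w \<le> 2 * (?f\<^sup>2 * ?w) + 2 * (?f - q x)\<^sup>2" by (simp add: algebra_simps)
          have 2: "?w * (2 * (q x * ((x - p) \<bullet> Q x))) \<le> ?w * M" using M(2)[OF True] w by (intro mult_left_mono) auto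
          have "N * ((q x)\<^sup>2 * ?w) \<le> N * (2 * (?f\<^sup>2 * ?w) + 2 * (?f - q x)\<^sup>2)" using 1 N0 by (intro mult_left_mono) auto
          then show ?thesis using True 2 by (simp add: algebra_simps)
        qed simp
      qed (intro Bochner_Integration.integrable_add integrable_mult_right int continuous_intros c\<phi> cs cq q)+
      also have "\<dots> = 2 * (N * (LINT x|lborel. indicator K x * ((\<phi> j x)\<^sup>2 * s x ^ m))) + (M * (LINT x|lborel. indicator K x * s x ^ m)
         + 2 * N * (LINT x|lborel. indicator K x * (\<phi> j x - q x)\<^sup>2))"
      proof -
        have i: "integrable lborel (\<lambda>x. 2 * (N * (indicator K x * ((\<phi> j x)\<^sup>2 * s x ^ m))))"
          "integrable lborel (\<lambda>x. M * (indicator K x * s x ^ m))" "integrable lborel (\<lambda>x. 2 * N * (indicator K x * (\<phi> j x - q x)\<^sup>2))"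
          by (intro integrable_mult_right int continuous_intros c\<phi> cs cq q)+
        show ?thesis
          by (subst Bochner_Integration.integral_add[OF i(1) Bochner_Integration.integrable_add[OF i(2,3)]],
              subst Bochner_Integration.integral_add[OF i(2,3)]) (simp only: integral_mult_right_zero)
      qed
      also have "\<dots> \<le> 2 * (4 * R\<^sup>2 * A / N) + (M * (V / N) + 2 * N * (LINT x|lborel. indicator K x * (\<phi> j x - q x)\<^sup>2))"
      proof -
        have "(LINT x|lborel. indicator K x * s x ^ m) = V / N" using one N0 by (simp add: field_simps)
        then show ?thesis using phi[of j] by simp
      qed
      finally show ?thesis by (simp add: algebra_simps)
    qed
    moreover have "(\<lambda>j. 8 * R\<^sup>2 * A / N + M * V / N + 2 * N * (LINT x|lborel. indicator K x * (\<phi> j x - q x)\<^sup>2))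
       \<longlonglongrightarrow> 8 * R\<^sup>2 * A / N + M * V / N + 2 * N * 0"
      by (intro tendsto_intros lim)
    ultimately have "c * (LINT x|face_measure F. (q x)\<^sup>2) \<le> 8 * R\<^sup>2 * A / N + M * V / N + 2 * N * 0"
      by (intro LIMSEQ_le_const) auto
    then show ?thesis by (simp add: add_divide_distrib)
  qed
  have "(\<lambda>m. (8 * R\<^sup>2 * A + M * V) / (real CARD('n) + real m)) \<longlonglongrightarrow> 0"
    by (rule real_tendsto_divide_at_top[OF tendsto_const filterlim_tendsto_add_at_top[OF tendsto_const filterlim_real_sequentially]])
  then have "c * (LINT x|face_measure F. (q x)\<^sup>2) \<le> 0"
    using key by (intro LIMSEQ_le_const) auto
  moreover have "(LINT x|face_measure F. (q x)\<^sup>2) \<ge> 0" by simp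
  ultimately have "(LINT x|face_measure F. (q x)\<^sup>2) = 0" using c by (simp add: mult_le_0_iff)
  then have "(q y)\<^sup>2 = 0"
    using face_integral_eq_0[OF compact_F convex_convex_hull, of "\<lambda>x. (q x)\<^sup>2"] y cq by (auto intro!: continuous_intros)
  then show ?thesis by simp
qed

end

lemma integral_lebesgue_on_borel:
  fixes f :: "'a::euclidean_space \<Rightarrow> real"
  assumes [measurable]: "S \<in> sets borel" "f \<in> borel_measurable borel"
  shows "(LINT x|lebesgue_on S. f x) = (LINT x|lborel. indicator S x * f x)"
proof -
  have "(LINT x|lebesgue_on S. f x) = (LINT x|lebesgue. indicator S x * f x)"
    by (subst integral_restrict_space) auto
  also have "\<dots> = (LINT x|lborel. indicator S x * f x)"
    by (rule integral_completion) measurable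
  finally show ?thesis .
qed

lemma AE_interior_convex:
  fixes K :: "'a::euclidean_space set"
  assumes "convex K" shows "AE x in lebesgue. x \<in> K \<longrightarrow> x \<in> interior K"
proof -
  have "frontier K \<in> null_sets lebesgue" using negligible_convex_frontier[OF assms] by (simp add: negligible_iff_null_sets)
  then have "AE x in lebesgue. x \<notin> frontier K" by (rule AE_not_in)
  then show ?thesis by eventually_elim (use closure_subset in \<open>auto simp: frontier_def\<close>)
qed

text \<open>
Completeness of Lebesgue measure makes a function measurable if it is almost everywhere equal to a
measurable one.
\<close>

lemma integrable_cong_AE_lebesgue:
  fixes f g :: "'a::euclidean_space \<Rightarrow> real"
  assumes ae: "AE x in lebesgue. f x = g x"
  shows "integrable lebesgue f \<longleftrightarrow> integrable lebesgue g"
proof -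
  have *: "integrable lebesgue g" if f: "integrable lebesgue f" "AE x in lebesgue. f x = g x" for f g :: "'a \<Rightarrow> real"
    by (rule integrable_cong_AE_imp[OF f(1) borel_measurable_AE[OF borel_measurable_integrable[OF f(1)] f(2)] f(2)])
  have "AE x in lebesgue. g x = f x" using ae by eventually_elim simp
  then show ?thesis using *[OF _ ae] * by blast
qed

text \<open>
The boundary of a convex set is negligible. The statement covers arbitrary f, so that integrals of the
nonlinear operator can be moved to the open element, on which it is square integrable.
\<close>

lemma integral_lebesgue_on_interior:
  fixes K :: "'a::euclidean_space set" and f :: "'a \<Rightarrow> real"
  assumes K: "convex K" "compact K"
  shows "(LINT x|lebesgue_on K. f x) = (LINT x|lebesgue_on (interior K). f x)"
    and "integrable (lebesgue_on K) f \<longleftrightarrow> integrable (lebesgue_on (interior K)) f"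
proof -
  have K': "K \<inter> space lebesgue \<in> sets lebesgue" "interior K \<inter> space lebesgue \<in> sets lebesgue"
    using K borel_compact[OF K(2)] by (auto intro: borel_open)
  have ae: "AE x in lebesgue. indicator K x *\<^sub>R f x = indicator (interior K) x *\<^sub>R f x"
    using AE_interior_convex[OF K(1)] by eventually_elim (use interior_subset in \<open>auto simp: indicator_def\<close>)
  show int: "integrable (lebesgue_on K) f \<longleftrightarrow> integrable (lebesgue_on (interior K)) f"
    unfolding integrable_restrict_space[OF K'(1)] integrable_restrict_space[OF K'(2)]
    by (rule integrable_cong_AE_lebesgue[OF ae])
  show "(LINT x|lebesgue_on K. f x) = (LINT x|lebesgue_on (interior K). f x)"
  proof (cases "integrable (lebesgue_on K) f")
    case True
    with int have "integrable lebesgue (\<lambda>x. indicator K x *\<^sub>R f x)" "integrable lebesgue (\<lambda>x. indicator (interior K) x *\<^sub>R f x)"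
      unfolding integrable_restrict_space[OF K'(1)] integrable_restrict_space[OF K'(2)] by auto
    then have "(LINT x|lebesgue. indicator K x *\<^sub>R f x) = (LINT x|lebesgue. indicator (interior K) x *\<^sub>R f x)"
      using ae by (intro integral_cong_AE borel_measurable_integrable)
    then show ?thesis unfolding integral_restrict_space[OF K'(1)] integral_restrict_space[OF K'(2)] .
  next
    case False
    then show ?thesis using int by (simp add: not_integrable_integral_eq)
  qed
qed

lemma integral_interior_borel:
  fixes K :: "'a::euclidean_space set" and f :: "'a \<Rightarrow> real"
  assumes K: "convex K" "compact K" and f: "continuous_on UNIV f"
  shows "(LINT x|lebesgue_on (interior K). f x) = (LINT x|lborel. indicator K x * f x)"
  using integral_lebesgue_on_borel[OF borel_compact[OF K(2)] borel_measurable_continuous_onI[OF f]]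
    integral_lebesgue_on_interior(1)[OF K, of f] by simp

lemma integral_lebesgue_on_mono_set:
  fixes f :: "'a::euclidean_space \<Rightarrow> real"
  assumes S: "open S" "open \<Omega>" "S \<subseteq> \<Omega>" and f: "integrable (lebesgue_on \<Omega>) f" "\<And>x. f x \<ge> 0"
  shows "(LINT x|lebesgue_on S. f x) \<le> (LINT x|lebesgue_on \<Omega>. f x)" "integrable (lebesgue_on S) f"
proof -
  have S': "S \<inter> space lebesgue \<in> sets lebesgue" "\<Omega> \<inter> space lebesgue \<in> sets lebesgue" using S by (auto intro: borel_open)
  have i: "integrable lebesgue (\<lambda>x. indicator \<Omega> x *\<^sub>R f x)" using f(1) unfolding integrable_restrict_space[OF S'(2)] .
  have "integrable lebesgue (\<lambda>x. indicator S x *\<^sub>R (indicator \<Omega> x *\<^sub>R f x))"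
    by (rule integrable_mult_indicator[OF _ i]) (use S'(1) in simp)
  then have j: "integrable lebesgue (\<lambda>x. indicator S x *\<^sub>R f x)"
    by (rule back_subst[of "integrable lebesgue"]) (use S(3) in \<open>auto simp: indicator_def fun_eq_iff subset_iff\<close>)
  then show "integrable (lebesgue_on S) f" unfolding integrable_restrict_space[OF S'(1)] .
  show "(LINT x|lebesgue_on S. f x) \<le> (LINT x|lebesgue_on \<Omega>. f x)"
    unfolding integral_restrict_space[OF S'(1)] integral_restrict_space[OF S'(2)]
    by (rule integral_mono[OF j i]) (use S(3) f(2) in \<open>auto simp: indicator_def\<close>)
qed

lemma L2_diff:
  assumes "u \<in> L2 U" "v \<in> L2 U" shows "(\<lambda>x. u x - v x) \<in> L2 U"
proof -
  have m: "u \<in> borel_measurable (lebesgue_on U)" "v \<in> borel_measurable (lebesgue_on U)"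
    and i: "integrable (lebesgue_on U) (\<lambda>x. 2 * (u x)\<^sup>2 + 2 * (v x)\<^sup>2)"
    using assms by (auto simp: L2_def)
  have "integrable (lebesgue_on U) (\<lambda>x. (u x - v x)\<^sup>2)"
  proof (rule Bochner_Integration.integrable_bound[OF i])
    show "AE x in lebesgue_on U. norm ((u x - v x)\<^sup>2) \<le> norm (2 * (u x)\<^sup>2 + 2 * (v x)\<^sup>2)"
    proof (rule AE_I2)
      fix x
      have "0 \<le> (u x + v x)\<^sup>2" by simp
      then have "(u x - v x)\<^sup>2 \<le> 2 * (u x)\<^sup>2 + 2 * (v x)\<^sup>2" by (simp add: power2_eq_square algebra_simps)
      then show "norm ((u x - v x)\<^sup>2) \<le> norm (2 * (u x)\<^sup>2 + 2 * (v x)\<^sup>2)" by simp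
    qed
  qed (use m in measurable)
  then show ?thesis using m by (auto simp: L2_def)
qed

lemma continuous_measurable_lebesgue_on:
  fixes f :: "'a::euclidean_space \<Rightarrow> real"
  assumes "continuous_on UNIV f" shows "f \<in> borel_measurable (lebesgue_on U)"
  using borel_measurable_continuous_onI[OF assms] by (intro measurable_restrict_space1 measurable_completion) simp

lemma continuous_integrable_lebesgue_on:
  fixes f :: "'a::euclidean_space \<Rightarrow> real"
  assumes U: "open U" "bounded U" and f: "continuous_on UNIV f"
  shows "integrable (lebesgue_on U) f"
proof -
  have U': "U \<inter> space lebesgue \<in> sets lebesgue" using U by (auto intro: borel_open)
  have "integrable lborel (\<lambda>x. indicator (closure U) x * f x)" using U f by (intro integrable_compact_lborel) auto
  then have "integrable lebesgue (\<lambda>x. indicator (closure U) x * f x)" by (simp add: integrable_completion)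
  then have "integrable lebesgue (\<lambda>x. indicator U x *\<^sub>R (indicator (closure U) x * f x))"
    by (rule integrable_mult_indicator[rotated]) (use U' in simp)
  then have "integrable lebesgue (\<lambda>x. indicator U x *\<^sub>R f x)"
    by (rule back_subst[of "integrable lebesgue"]) (use closure_subset[of U] in \<open>auto simp: indicator_def fun_eq_iff subset_iff\<close>)
  then show ?thesis unfolding integrable_restrict_space[OF U'] .
qed

lemma continuous_L2:
  fixes f :: "real ^ 'n \<Rightarrow> real"
  assumes U: "open U" "bounded U" and f: "continuous_on UNIV f"
  shows "f \<in> L2 U"
  using continuous_measurable_lebesgue_on[OF f] continuous_integrable_lebesgue_on[OF U, of "\<lambda>x. (f x)\<^sup>2"] f
  by (auto simp: L2_def intro!: continuous_intros)

lemma smooth_GDERIV: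
  fixes \<phi> :: "real ^ 'n \<Rightarrow> real"
  assumes "smooth \<phi>"
  shows "GDERIV \<phi> x :> (\<chi> i. pderivative i \<phi> x)" "continuous_on UNIV (pderivative i \<phi>)" "continuous_on UNIV (\<lambda>x. \<chi> i. pderivative i \<phi> x)"
proof -
  have "\<phi> differentiable at x" using assms unfolding smooth_def by (metis foldr_Nil id_apply)
  then have D: "(\<phi> has_derivative frechet_derivative \<phi> (at x)) (at x)" by (simp add: frechet_derivative_works)
  have "frechet_derivative \<phi> (at x) = (\<lambda>v. v \<bullet> (\<chi> i. pderivative i \<phi> x))"
  proof
    fix v :: "real ^ 'n"
    have "v = (\<Sum>i\<in>UNIV. v $ i *\<^sub>R axis i 1)" by (simp add: basis_expansion scalar_mult_eq_scaleR[symmetric])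
    then have "frechet_derivative \<phi> (at x) v = frechet_derivative \<phi> (at x) (\<Sum>i\<in>UNIV. v $ i *\<^sub>R axis i 1)" by metis
    also have "\<dots> = (\<Sum>i\<in>UNIV. v $ i * frechet_derivative \<phi> (at x) (axis i 1))"
      using has_derivative_linear[OF D] by (simp add: linear_sum linear_cmul)
    finally show "frechet_derivative \<phi> (at x) v = v \<bullet> (\<chi> i. pderivative i \<phi> x)"
      by (simp add: inner_vec_def pderivative_def)
  qed
  then show "GDERIV \<phi> x :> (\<chi> i. pderivative i \<phi> x)" using D unfolding gderiv_def by simp
  have c: "continuous_on UNIV (pderivative i \<phi>)" for i
  proof -
    have "pderivative i \<phi> differentiable at x" for x
      using assms[unfolded smooth_def, rule_format, of "[i]" x] by simp
    then show ?thesis by (simp add: continuous_at_imp_continuous_on differentiable_imp_continuous_within)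
  qed
  then show "continuous_on UNIV (pderivative i \<phi>)" "continuous_on UNIV (\<lambda>x. \<chi> i. pderivative i \<phi> x)"
    by (auto intro: continuous_on_vec_lambda)
qed

text \<open>
Test functions vanish near the boundary of \<Omega>, in particular on F, and those approximating u satisfy the
hypotheses of \<open>vanishing_on_facet\<close>.
\<close>

lemma H10_boundary_zero:
  fixes \<Omega> K F :: "(real ^ 'n) set" and u p :: "real ^ 'n \<Rightarrow> real"
  assumes \<Omega>: "open \<Omega>" "bounded \<Omega>" and u: "u \<in> H10 \<Omega>"
    and K: "int CARD('n) simplex K" "interior K \<subseteq> \<Omega>" and pol: "real_polynomial_function p" "\<And>x. x \<in> K \<Longrightarrow> u x = p x"
    and F: "F facet_of K" "F \<subseteq> frontier \<Omega>" and y: "y \<in> F"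
  shows "u y = 0"
proof -
  obtain g \<phi> where g: "H1 \<Omega> u g" and \<phi>: "\<And>j. \<phi> j \<in> test_functions \<Omega>"
    and lim: "(\<lambda>j::nat. (LINT x|lebesgue_on \<Omega>. (\<phi> j x - u x)\<^sup>2) +
       (\<Sum>i\<in>UNIV. LINT x|lebesgue_on \<Omega>. (pderivative i (\<phi> j) x - g x $ i)\<^sup>2)) \<longlonglongrightarrow> 0"
    using u unfolding H10_def by blast
  let ?a = "\<lambda>j. LINT x|lebesgue_on \<Omega>. (\<phi> j x - u x)\<^sup>2"
  let ?b = "\<lambda>j i. LINT x|lebesgue_on \<Omega>. (pderivative i (\<phi> j) x - g x $ i)\<^sup>2"
  have sm: "smooth (\<phi> j)" for j using \<phi> by (simp add: test_functions_def)
  note G = smooth_GDERIV[OF sm]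
  let ?Phi = "\<lambda>j x. \<chi> i. pderivative i (\<phi> j) x"
  note c\<phi> = continuous_on_GDERIV[OF G(1)]
  have cp: "continuous_on UNIV p" by (rule continuous_on_poly[OF pol(1)])
  have uL: "u \<in> L2 \<Omega>" and gL: "(\<lambda>x. g x $ i) \<in> L2 \<Omega>" for i using g by (auto simp: H1_def)
  have cK: "compact K" "convex K" using K(1) by (auto intro: compact_simplex convex_simplex)
  have bK: "bounded (interior K)" by (rule bounded_subset[OF compact_imp_bounded[OF cK(1)] interior_subset])
  have a0: "?a j \<ge> 0" and b0: "?b j i \<ge> 0" for i j by simp_all
  have onK: "(LINT x|lborel. indicator K x * f x) \<le> (LINT x|lebesgue_on \<Omega>. h x)"
    if f: "continuous_on UNIV f" and fh: "\<And>x. x \<in> interior K \<Longrightarrow> f x \<le> h x" and h: "integrable (lebesgue_on \<Omega>) h" "\<And>x. h x \<ge> 0" for f h :: "real ^ 'n \<Rightarrow> real"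
  proof -
    have "(LINT x|lborel. indicator K x * f x) = (LINT x|lebesgue_on (interior K). f x)"
      by (rule integral_interior_borel[OF cK(2,1) f, symmetric])
    also have "\<dots> \<le> (LINT x|lebesgue_on (interior K). h x)"
      by (rule integral_mono[OF continuous_integrable_lebesgue_on[OF _ _ f] integral_lebesgue_on_mono_set(2)[OF _ \<Omega>(1) K(2) h]])
        (use fh bK in auto)
    also have "\<dots> \<le> (LINT x|lebesgue_on \<Omega>. h x)"
      by (rule integral_lebesgue_on_mono_set(1)[OF _ \<Omega>(1) K(2) h]) auto
    finally show ?thesis .
  qed
  obtain A where A: "\<And>j. ?a j + (\<Sum>i\<in>UNIV. ?b j i) \<le> A"
  proof -
    have "Bseq (\<lambda>j. ?a j + (\<Sum>i\<in>UNIV. ?b j i))" using lim by (intro convergent_imp_Bseq convergentI)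
    then obtain A where n: "\<And>j. norm (?a j + (\<Sum>i\<in>UNIV. ?b j i)) \<le> A" unfolding Bseq_def by blast
    show ?thesis by (rule that[of A], rule order_trans[OF abs_ge_self n[unfolded real_norm_def]])
  qed
  obtain C q where SV: "simplex_vertex C q" "K = convex hull C" "F = convex hull (C - {q})"
    by (rule facet_simplex_vertex[OF K(1) F(1)])
  interpret simplex_vertex C q by fact
  have "p y = 0"
  proof (rule vanishing_on_facet[of p "gradient p" \<phi> ?Phi "2 * A + 2 * (\<Sum>i\<in>UNIV. LINT x|lebesgue_on \<Omega>. (g x $ i)\<^sup>2)"])
    show "GDERIV p x :> gradient p x" for x by (rule GDERIV_poly[OF pol(1)])
    show "continuous_on UNIV (gradient p)" by (rule continuous_on_gradient[OF pol(1)])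
    show "GDERIV (\<phi> j) x :> ?Phi j x" for j x by (rule G(1))
    show "continuous_on UNIV (?Phi j)" for j by (rule G(3))
    show "\<phi> j x = 0" if "x \<in> convex hull (C - {q})" for j x
    proof (rule ccontr)
      assume "\<phi> j x \<noteq> 0"
      then have "x \<in> closure {x. \<phi> j x \<noteq> 0}" using subsetD[OF closure_subset, of x "{x. \<phi> j x \<noteq> 0}"] by simp
      moreover have "closure {x. \<phi> j x \<noteq> 0} \<subseteq> \<Omega>" using \<phi>[of j] unfolding test_functions_def by blast
      ultimately have "x \<in> \<Omega>" by blast
      moreover have "x \<in> frontier \<Omega>" using that F(2) unfolding SV(3) by blast
      ultimately show False using \<Omega>(1) by (simp add: frontier_def interior_open)
    qed
    show "(\<lambda>j. LINT x|lborel. indicator (convex hull C) x * (\<phi> j x - p x)\<^sup>2) \<longlonglongrightarrow> 0"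
    proof (rule tendsto_sandwich[OF _ _ tendsto_const lim])
      show "\<forall>\<^sub>F j in sequentially. 0 \<le> (LINT x|lborel. indicator (convex hull C) x * (\<phi> j x - p x)\<^sup>2)"
        by (intro always_eventually allI Bochner_Integration.integral_nonneg) auto
      have "(LINT x|lborel. indicator K x * (\<phi> j x - p x)\<^sup>2) \<le> ?a j + (\<Sum>i\<in>UNIV. ?b j i)" for j
      proof -
        have "(LINT x|lborel. indicator K x * (\<phi> j x - p x)\<^sup>2) \<le> ?a j"
        proof (rule onK)
          show "continuous_on UNIV (\<lambda>x. (\<phi> j x - p x)\<^sup>2)" by (intro continuous_intros c\<phi> cp)
          show "(\<phi> j x - p x)\<^sup>2 \<le> (\<phi> j x - u x)\<^sup>2" if "x \<in> interior K" for x
            using pol(2)[OF subsetD[OF interior_subset that]] by simp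
          show "integrable (lebesgue_on \<Omega>) (\<lambda>x. (\<phi> j x - u x)\<^sup>2)"
            using L2_diff[OF continuous_L2[OF \<Omega> c\<phi>] uL] by (simp add: L2_def)
        qed simp
        also have "\<dots> \<le> ?a j + (\<Sum>i\<in>UNIV. ?b j i)" using b0 by (simp add: sum_nonneg)
        finally show ?thesis .
      qed
      then show "\<forall>\<^sub>F j in sequentially. (LINT x|lborel. indicator (convex hull C) x * (\<phi> j x - p x)\<^sup>2) \<le> ?a j + (\<Sum>i\<in>UNIV. ?b j i)"
        unfolding SV(2) by (intro always_eventually allI)
    qed
    show "(LINT x|lborel. indicator (convex hull C) x * (norm (?Phi j x))\<^sup>2) \<le> 2 * A + 2 * (\<Sum>i\<in>UNIV. LINT x|lebesgue_on \<Omega>. (g x $ i)\<^sup>2)" for j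
    proof -
      have "(norm (?Phi j x))\<^sup>2 = (\<Sum>i\<in>UNIV. (pderivative i (\<phi> j) x)\<^sup>2)" for x
        unfolding power2_norm_eq_inner by (simp add: inner_vec_def power2_eq_square)
      then have "(LINT x|lborel. indicator K x * (norm (?Phi j x))\<^sup>2) = (LINT x|lborel. (\<Sum>i\<in>UNIV. indicator K x * (pderivative i (\<phi> j) x)\<^sup>2))"
        by (simp add: sum_distrib_left)
      also have "\<dots> = (\<Sum>i\<in>UNIV. LINT x|lborel. indicator K x * (pderivative i (\<phi> j) x)\<^sup>2)"
        by (intro Bochner_Integration.integral_sum integrable_compact_lborel cK continuous_intros G)
      also have "\<dots> \<le> (\<Sum>i\<in>UNIV. 2 * ?b j i + 2 * (LINT x|lebesgue_on \<Omega>. (g x $ i)\<^sup>2))"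
      proof (rule sum_mono)
        fix i
        have i1: "integrable (lebesgue_on \<Omega>) (\<lambda>x. (pderivative i (\<phi> j) x - g x $ i)\<^sup>2)"
          using L2_diff[OF continuous_L2[OF \<Omega> G(2)] gL] by (simp add: L2_def)
        have i2: "integrable (lebesgue_on \<Omega>) (\<lambda>x. (g x $ i)\<^sup>2)" using gL by (simp add: L2_def)
        have "(LINT x|lborel. indicator K x * (pderivative i (\<phi> j) x)\<^sup>2) \<le> (LINT x|lebesgue_on \<Omega>. 2 * (pderivative i (\<phi> j) x - g x $ i)\<^sup>2 + 2 * (g x $ i)\<^sup>2)"
        proof (rule onK)
          show "continuous_on UNIV (\<lambda>x. (pderivative i (\<phi> j) x)\<^sup>2)" by (intro continuous_intros G)
          show "(pderivative i (\<phi> j) x)\<^sup>2 \<le> 2 * (pderivative i (\<phi> j) x - g x $ i)\<^sup>2 + 2 * (g x $ i)\<^sup>2" for x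
          proof -
            have "0 \<le> (pderivative i (\<phi> j) x - 2 * g x $ i)\<^sup>2" by simp
            then show ?thesis by (simp add: power2_eq_square algebra_simps)
          qed
        qed (use i1 i2 in auto)
        also have "\<dots> = 2 * ?b j i + 2 * (LINT x|lebesgue_on \<Omega>. (g x $ i)\<^sup>2)"
          using i1 i2 by (subst Bochner_Integration.integral_add) auto
        finally show "(LINT x|lborel. indicator K x * (pderivative i (\<phi> j) x)\<^sup>2) \<le> 2 * ?b j i + 2 * (LINT x|lebesgue_on \<Omega>. (g x $ i)\<^sup>2)" .
      qed
      also have "\<dots> = 2 * (\<Sum>i\<in>UNIV. ?b j i) + 2 * (\<Sum>i\<in>UNIV. LINT x|lebesgue_on \<Omega>. (g x $ i)\<^sup>2)"
        by (simp add: sum.distrib sum_distrib_left)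
      also have "\<dots> \<le> 2 * A + 2 * (\<Sum>i\<in>UNIV. LINT x|lebesgue_on \<Omega>. (g x $ i)\<^sup>2)"
        using A[of j] a0[of j] by linarith
      finally show ?thesis unfolding SV(2) .
    qed
    show "y \<in> convex hull (C - {q})" using y SV by simp
  qed
  moreover have "y \<in> K" using y F(1) facet_of_imp_subset by blast
  ultimately show ?thesis using pol(2) by simp
qed

section \<open>Interior faces of a conforming mesh\<close>

lemma orthonormal_insert_orthogonal:
  fixes B :: "(real ^ 'n) set"
  assumes E: "orthonormal (insert n B)" "card (insert n B) = CARD('n)" "n \<notin> B" and w: "w \<bullet> n = 0"
  shows "w \<in> span B"
proof -
  have fB: "finite B" using orthonormal_finite[OF E(1)] by simp
  have "w \<in> span (insert n B)" using orthonormal_span[OF E(1)] E(2) by simp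
  from orthonormal_expand[OF E(1) this] have "w = (\<Sum>t\<in>B. (w \<bullet> t) *\<^sub>R t)" using fB E(3) w by simp
  then show ?thesis by (metis (no_types, lifting) span_base span_mul span_sum)
qed

lemma rel_interior_add_tangent:
  fixes F :: "(real ^ 'n) set"
  assumes y: "y \<in> rel_interior F" and w: "w \<in> span (tangent_basis F)"
  shows "\<exists>e>0. \<forall>r. \<bar>r\<bar> < e \<longrightarrow> y + r *\<^sub>R w \<in> F"
proof -
  obtain e where e: "e > 0" "ball y e \<inter> affine hull F \<subseteq> F" and yF: "y \<in> F"
    using y unfolding mem_rel_interior_ball by blast
  show ?thesis
  proof (intro exI[of _ "e / (norm w + 1)"] conjI allI impI)
    show "0 < e / (norm w + 1)" using e(1) by (simp add: add_nonneg_pos)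
    fix r assume r: "\<bar>r\<bar> < e / (norm w + 1)"
    have "\<bar>r\<bar> * norm w \<le> \<bar>r\<bar> * (norm w + 1)" by (intro mult_left_mono) auto
    also have "\<dots> < e" using r by (simp add: pos_less_divide_eq add_nonneg_pos)
    finally have "y + r *\<^sub>R w \<in> ball y e" by (simp add: dist_norm)
    moreover have "y + r *\<^sub>R w \<in> affine hull F"
      using w yF by (intro affine_hull_add_tangent hull_inc span_mul)
    ultimately show "y + r *\<^sub>R w \<in> F" using e(2) by blast
  qed
qed

lemma (in simplex_vertex) segment_in_simplex:
  assumes "0 \<le> r" "r \<le> 1" "y \<in> F" shows "p + r *\<^sub>R (y - p) \<in> K"
  unfolding simplex_eq_cone using assms by blast

text \<open>
From a point y in the relative interior of F move slightly towards the vertex p of K opposite to F.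
As p and the vertex p' of K' opposite to F lie on the same side, this is a move towards p'
combined with a tangential one, and the latter stays within F if it is small.
\<close>

lemma same_normal_inside:
  fixes K K' F :: "(real ^ 'n) set"
  assumes K: "int CARD('n) simplex K" "F facet_of K" and K': "int CARD('n) simplex K'" "F facet_of K'"
    and same: "outer_normal K' F = outer_normal K F"
  obtains x where "x \<in> K" "x \<in> K'" "x \<notin> F"
proof -
  obtain C p where SV: "simplex_vertex C p" "K = convex hull C" "F = convex hull (C - {p})"
    by (rule facet_simplex_vertex[OF K])
  obtain C' p' where SV': "simplex_vertex C' p'" "K' = convex hull C'" "F = convex hull (C' - {p'})"
    by (rule facet_simplex_vertex[OF K'])
  interpret S: simplex_vertex C p by fact
  interpret S': simplex_vertex C' p' by fact
  let ?n = "outer_normal K F"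
  note E = facet_orthonormal[OF K]
  have cF: "convex F" unfolding SV(3) by simp
  have "F \<noteq> {}" using S.F_nonempty SV by simp
  then obtain y where y: "y \<in> rel_interior F" using cF by (meson all_not_in_conv rel_interior_eq_empty)
  have yF: "y \<in> F" using y rel_interior_subset by blast
  have c: "?n \<bullet> (y - p) > 0" using S.normal_apex[of y] yF SV by simp
  have c': "?n \<bullet> (y - p') > 0" using S'.normal_apex[of y] yF SV' same by simp
  \<comment> \<open>the ratio of the distances of p and p' from F, so that w below is tangential\<close>
  define \<sigma> where "\<sigma> = (?n \<bullet> (y - p)) / (?n \<bullet> (y - p'))"
  have \<sigma>: "\<sigma> > 0" using c c' by (simp add: \<sigma>_def)
  define w where "w = (p - y) - \<sigma> *\<^sub>R (p' - y)"
  have "w \<bullet> ?n = 0"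
  proof -
    have "w \<bullet> ?n = - (?n \<bullet> (y - p)) + \<sigma> * (?n \<bullet> (y - p'))"
      unfolding w_def by (simp add: inner_simps inner_commute algebra_simps)
    also have "\<dots> = 0" using c' by (simp add: \<sigma>_def)
    finally show ?thesis .
  qed
  then have w: "w \<in> span (tangent_basis F)" by (rule orthonormal_insert_orthogonal[OF E])
  obtain e where e: "e > 0" "\<And>r. \<bar>r\<bar> < e \<Longrightarrow> y + r *\<^sub>R w \<in> F"
    using rel_interior_add_tangent[OF y w] by blast
  \<comment> \<open>small enough that the move towards p' has length at most half the way and the tangential part stays in F\<close>
  define s where "s = min (1/2) (min (1 / (2 * \<sigma>)) (e / 4))"
  have s: "0 < s" "s \<le> 1/2" "s * \<sigma> \<le> 1/2" "s < e / 2"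
  proof -
    show "0 < s" "s \<le> 1/2" using \<sigma> e(1) by (auto simp: s_def)
    have "s \<le> 1 / (2 * \<sigma>)" by (simp add: s_def)
    then have "s * \<sigma> \<le> 1 / (2 * \<sigma>) * \<sigma>" using \<sigma> by (intro mult_right_mono) auto
    then show "s * \<sigma> \<le> 1/2" using \<sigma> by simp
    have "s \<le> e / 4" by (simp add: s_def)
    then show "s < e / 2" using e(1) by linarith
  qed
  let ?x = "y + s *\<^sub>R (p - y)"
  have x1: "?x \<in> K"
  proof -
    have "?x = p + (1 - s) *\<^sub>R (y - p)" by (simp add: algebra_simps)
    then show ?thesis using S.segment_in_simplex[of "1 - s" y] yF s unfolding SV(2,3) by simp
  qed
  have x2: "?x \<notin> F"
  proof
    assume "?x \<in> F"
    then have "?n \<bullet> (?x - y) = 0" using S.normal_orthogonal[of y ?x] yF SV by simp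
    then show False using s c by (simp add: inner_diff_right)
  qed
  have x3: "?x \<in> K'"
  proof -
    let ?r = "1 - s * \<sigma>"
    have r: "1/2 \<le> ?r" "?r \<le> 1" using s \<sigma> by (auto simp: less_imp_le)
    have "s / ?r \<le> s / (1/2)" using r s by (intro divide_left_mono) auto
    then have "\<bar>s / ?r\<bar> < e" using s r by simp
    then have z: "y + (s / ?r) *\<^sub>R w \<in> F" by (rule e(2))
    have "p' + \<rho> *\<^sub>R ((y + c *\<^sub>R w) - p') = p' + \<rho> *\<^sub>R (y - p') + (\<rho> * c) *\<^sub>R w" for \<rho> c
      by (simp add: algebra_simps)
    moreover have "?r * (s / ?r) = s" using r by simp
    ultimately have "p' + ?r *\<^sub>R ((y + (s / ?r) *\<^sub>R w) - p') = p' + ?r *\<^sub>R (y - p') + s *\<^sub>R w" by metis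
    also have "\<dots> = ?x" unfolding w_def by (simp add: algebra_simps)
    finally have "?x = p' + ?r *\<^sub>R ((y + (s / ?r) *\<^sub>R w) - p')" ..
    then show ?thesis using S'.segment_in_simplex[of ?r "y + (s / ?r) *\<^sub>R w"] z r unfolding SV'(2,3) by simp
  qed
  show ?thesis by (rule that[OF x1 x3 x2])
qed

lemma facet_proper_face_eq:
  assumes K: "convex K" and F: "F facet_of K" and G: "G face_of K" "F \<subseteq> G" "x \<in> G" "x \<notin> F"
  shows "G = K"
proof (rule ccontr)
  assume "G \<noteq> K"
  then have 1: "aff_dim G < aff_dim K" using face_of_aff_dim_lt[OF K G(1)] by simp
  have "F face_of G" using F G face_of_imp_subset[OF G(1)] by (meson face_of_subset facet_of_imp_face_of)
  moreover have "F \<noteq> G" using G by auto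
  ultimately have "aff_dim F < aff_dim G" using face_of_aff_dim_lt[of G F] face_of_imp_convex[OF G(1)] K by auto
  then show False using 1 F by (simp add: facet_of_def)
qed

text \<open>
Otherwise both elements would lie on the same side of F and share a point outside F. Their
intersection would then be a face of each that is larger than the facet F, hence all of both.
\<close>

lemma normals_opposite:
  fixes K K' F :: "(real ^ 'n) set"
  assumes K: "int CARD('n) simplex K" "F facet_of K" and K': "int CARD('n) simplex K'" "F facet_of K'"
    and ne: "K \<noteq> K'" and face: "K \<inter> K' face_of K" "K \<inter> K' face_of K'"
  shows "outer_normal K' F = - outer_normal K F"
proof -
  let ?n = "outer_normal K F" let ?m = "outer_normal K' F"
  note E = facet_orthonormal[OF K] and E' = facet_orthonormal[OF K']
  have fB: "finite (tangent_basis F)" by (rule orthonormal_finite[OF tangent_basis(1)])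
  have "?m \<in> span (insert ?n (tangent_basis F))" using orthonormal_span[OF E(1)] E(2) by simp
  moreover have "?m \<bullet> t = 0" if "t \<in> tangent_basis F" for t
    using orthonormal_inner[OF E'(1), of ?m t] that E'(3) by auto
  ultimately have m: "?m = (?m \<bullet> ?n) *\<^sub>R ?n" using orthonormal_expand[OF E(1), of ?m] fB E(3) by simp
  have "norm ?m = 1" "norm ?n = 1" using E(1) E'(1) by (auto simp: orthonormal_def)
  then have "\<bar>?m \<bullet> ?n\<bar> = 1" using m by (metis mult.right_neutral norm_scaleR)
  moreover have "?m \<bullet> ?n \<noteq> 1"
  proof
    assume "?m \<bullet> ?n = 1"
    then have "?m = ?n" using m by simp
    from same_normal_inside[OF K K' this] obtain x where x: "x \<in> K" "x \<in> K'" "x \<notin> F" by blast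
    have sub: "F \<subseteq> K \<inter> K'" using K(2) K'(2) facet_of_imp_subset by blast
    have "K \<inter> K' = K" by (rule facet_proper_face_eq[OF convex_simplex[OF K(1)] K(2) face(1) sub]) (use x in auto)
    moreover have "K \<inter> K' = K'" by (rule facet_proper_face_eq[OF convex_simplex[OF K'(1)] K'(2) face(2) sub]) (use x in auto)
    ultimately show False using ne by simp
  qed
  ultimately have "?m \<bullet> ?n = -1" by linarith
  then show ?thesis using m by simp
qed

lemma conforming_meshD:
  fixes \<Omega> :: "(real ^ 'n) set"
  assumes "conforming_mesh \<Omega> T"
  shows "finite T" "\<And>K. K \<in> T \<Longrightarrow> int CARD('n) simplex K" "\<Union>T = closure \<Omega>"
    "\<And>K K'. K \<in> T \<Longrightarrow> K' \<in> T \<Longrightarrow> K \<inter> K' face_of K" "\<And>K K'. K \<in> T \<Longrightarrow> K' \<in> T \<Longrightarrow> K \<inter> K' face_of K'"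
  using assms unfolding conforming_mesh_def triangulation_def by (auto simp: inf_commute) (metis inf_commute)

text \<open>
Points approaching a relative interior point y of F from the outside of K lie in elements other than
K. Infinitely many of them lie in the same element K', which then contains y. The common face of K
and K' contains y and therefore F.
\<close>

lemma second_element:
  fixes \<Omega> :: "(real ^ 'n) set"
  assumes mesh: "conforming_mesh \<Omega> T" and \<Omega>: "open \<Omega>" "convex \<Omega>"
    and K: "K \<in> T" "F facet_of K" and F: "\<not> F \<subseteq> frontier \<Omega>"
  obtains K' where "K' \<in> T" "K' \<noteq> K" "F facet_of K'"
proof -
  note T = conforming_meshD[OF mesh]
  obtain C p where SV: "simplex_vertex C p" "K = convex hull C" "F = convex hull (C - {p})"
    by (rule facet_simplex_vertex[OF T(2)[OF K(1)] K(2)])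
  interpret S: simplex_vertex C p by fact
  let ?n = "outer_normal K F"
  have cF: "convex F" unfolding SV(3) by simp
  have FK: "F \<subseteq> K" using K(2) by (rule facet_of_imp_subset)
  obtain x where x: "x \<in> F" "x \<in> \<Omega>"
  proof -
    obtain x where "x \<in> F" "x \<notin> frontier \<Omega>" using F by blast
    moreover have "x \<in> closure \<Omega>" using \<open>x \<in> F\<close> FK K(1) T(3) by blast
    ultimately show ?thesis using that \<Omega>(1) by (auto simp: frontier_def interior_open)
  qed
  have "x \<in> closure (rel_interior F)" using convex_closure_rel_interior[OF cF] x(1) closure_subset by blast
  then obtain y where y: "y \<in> rel_interior F" "y \<in> \<Omega>"
    using x(2) \<Omega>(1) by (metis closure_iff_nhds_not_empty disjoint_iff order_refl)
  have yF: "y \<in> F" using y rel_interior_subset by blast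
  obtain e where e: "e > 0" "ball y e \<subseteq> \<Omega>" using \<Omega>(1) y(2) by (meson open_contains_ball)
  \<comment> \<open>points on the other side of F converging to y; dividing by m + 2 keeps them in the ball around y\<close>
  define z where "z m = y + (e / (real m + 2)) *\<^sub>R ?n" for m :: nat
  have n1: "norm ?n = 1" using S.norm_normal SV by simp
  have zO: "z m \<in> \<Union>T" for m
  proof -
    have "e / (real m + 2) < e" using e(1) by (simp add: pos_divide_less_eq)
    then have "z m \<in> ball y e" using n1 e(1) by (simp add: z_def dist_norm)
    then show ?thesis using e(2) closure_subset T(3) by blast
  qed
  then have "\<forall>m\<in>UNIV. \<exists>K. K \<in> T \<and> z m \<in> K" by blast
  then have "\<exists>k. \<forall>m. k m \<in> T \<and> z m \<in> k m" by (metis UNIV_I)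
  then obtain k where k: "\<And>m. k m \<in> T" "\<And>m. z m \<in> k m" by blast
  have "finite (range k)" using k(1) T(1) by (meson finite_subset image_subsetI)
  then obtain m0 where m0: "infinite {m. k m = k m0}"
    using pigeonhole_infinite[of UNIV k] by auto
  let ?K = "k m0"
  have zK: "z m \<in> ?K" if "m \<in> {m. k m = k m0}" for m using k(2)[of m] that by simp
  have lim: "z \<longlonglongrightarrow> y"
  proof -
    have "(\<lambda>m. e / (real m + 2)) \<longlonglongrightarrow> 0" by real_asymp
    then have "(\<lambda>m. y + (e / (real m + 2)) *\<^sub>R ?n) \<longlonglongrightarrow> y + 0 *\<^sub>R ?n" by (intro tendsto_intros)
    then show ?thesis by (simp add: z_def[abs_def])
  qed
  obtain r :: "nat \<Rightarrow> nat" where r: "strict_mono r" "\<And>i. r i \<in> {m. k m = k m0}"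
    using infinite_enumerate[OF m0] by auto
  have "(z \<circ> r) \<longlonglongrightarrow> y" using lim r(1) by (rule LIMSEQ_subseq_LIMSEQ)
  then have yK: "y \<in> ?K"
    by (rule closed_sequentially[OF closed_simplex[OF T(2)[OF k(1)[of m0]]], rotated]) (use zK[OF r(2)] in simp)
  have "z m0 \<notin> K"
  proof
    assume "z m0 \<in> K"
    then have "?n \<bullet> (z m0 - y) \<le> 0" using S.normal_inward[of y "z m0"] yF SV by simp
    moreover have "?n \<bullet> (z m0 - y) = e / (real m0 + 2)" using n1 by (simp add: z_def dot_square_norm)
    ultimately show False using e(1) by (simp add: divide_le_0_iff)
  qed
  then have ne: "?K \<noteq> K" using k(2)[of m0] by auto
  have sub: "F \<subseteq> K \<inter> ?K"
    by (rule subset_of_face_of[OF T(4)[OF K(1) k(1)] FK]) (use y yK yF FK in auto)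
  have "F face_of K \<inter> ?K" using facet_of_imp_face_of[OF K(2)] sub by (rule face_of_subset) auto
  then have "F face_of ?K" using T(5)[OF K(1) k(1)] by (rule face_of_trans)
  moreover have "aff_dim F = aff_dim ?K - 1"
    using K(2) aff_dim_simplex[OF T(2)[OF K(1)]] aff_dim_simplex[OF T(2)[OF k(1)]] by (simp add: facet_of_def)
  ultimately have "F facet_of ?K" using yF by (auto simp: facet_of_def)
  then show ?thesis using that[OF k(1) ne] by blast
qed

text \<open>
Any two elements with the facet F have opposite normals, so there are at most two of them; there are
at least two because F is not contained in the boundary.
\<close>

lemma sum_normals_interior_face:
  fixes \<Omega> :: "(real ^ 'n) set"
  assumes mesh: "conforming_mesh \<Omega> T" and \<Omega>: "open \<Omega>" "convex \<Omega>" and F: "F \<in> interior_faces \<Omega> T"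
  shows "(\<Sum>K\<in>{K\<in>T. F facet_of K}. outer_normal K F) = 0"
proof -
  note T = conforming_meshD[OF mesh]
  obtain K where K: "K \<in> T" "F facet_of K" and nF: "\<not> F \<subseteq> frontier \<Omega>" using F unfolding interior_faces_def by blast
  obtain K' where K': "K' \<in> T" "K' \<noteq> K" "F facet_of K'" by (rule second_element[OF mesh \<Omega> K nF])
  have opp: "outer_normal L' F = - outer_normal L F" if "L \<in> T" "F facet_of L" "L' \<in> T" "F facet_of L'" "L \<noteq> L'" for L L'
    using that T by (intro normals_opposite) auto
  have "{K\<in>T. F facet_of K} = {K, K'}"
  proof (rule ccontr)
    assume "{K\<in>T. F facet_of K} \<noteq> {K, K'}"
    then obtain L where L: "L \<in> T" "F facet_of L" "L \<noteq> K" "L \<noteq> K'" using K K' by auto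
    have "outer_normal K' F = - outer_normal K F" "outer_normal L F = - outer_normal K F" "outer_normal L F = - outer_normal K' F"
      using opp K K' L by metis+
    then have e: "outer_normal K F = - outer_normal K F" by simp
    have "outer_normal K F $ i = 0" for i using arg_cong[OF e, of "\<lambda>v. v $ i"] by simp
    then have "outer_normal K F = 0" by (simp add: vec_eq_iff)
    moreover have "norm (outer_normal K F) = 1"
      using facet_orthonormal(1)[OF T(2)[OF K(1)] K(2)] by (simp add: orthonormal_def)
    ultimately show False by simp
  qed
  then show ?thesis using K'(2) opp[OF K K'(1,3)] by simp
qed

lemma interior_element_subset:
  fixes \<Omega> :: "(real ^ 'n) set"
  assumes mesh: "conforming_mesh \<Omega> T" and \<Omega>: "open \<Omega>" "convex \<Omega>" and K: "K \<in> T"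
  shows "interior K \<subseteq> \<Omega>"
proof -
  have "K \<subseteq> closure \<Omega>" using conforming_meshD(3)[OF mesh] K by blast
  then have "interior K \<subseteq> interior (closure \<Omega>)" by (rule interior_mono)
  then show ?thesis using convex_interior_closure[OF \<Omega>(2)] \<Omega>(1) by (simp add: interior_open)
qed

section \<open>The integral identity on the mesh\<close>

lemma fe_space_poly:
  assumes "u \<in> fe_space \<Omega> T k" "K \<in> T"
  shows "\<exists>p. real_polynomial_function p \<and> (\<forall>x\<in>K. u x = p x)"
  using assms polynomials_imp_real_polynomial_function unfolding fe_space_def by blast

text \<open>
Vertices for n = 2 and edges for n = 3 are the faces of codimension two, that is, the facets of the
facets of an element.
\<close>

lemma fe_space_C1:
  fixes \<Omega> :: "(real ^ 'n) set"
  assumes n: "CARD('n) = 2 \<or> CARD('n) = 3" and u: "u \<in> fe_space \<Omega> T k" and K: "K \<in> T" and S: "S face_of K" "aff_dim S = int CARD('n) - 2"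
  shows "C1_at T S u"
proof (cases "CARD('n) = 2")
  case True
  then obtain x where x: "S = {x}" using S(2) aff_dim_eq_0 by auto
  then have "x extreme_point_of K" using S(1) by (simp add: face_of_singleton)
  then show ?thesis using u K True x unfolding fe_space_def by auto
next
  case False
  then have "S edge_of K" using S n by (simp add: edge_of_def)
  then show ?thesis using u K False unfolding fe_space_def by auto
qed

text \<open>
A polynomial on the whole space that agrees with the jump of the gradient on F, so that it can be
differentiated there.
\<close>

definition jump_poly :: "(real ^ 'n) set set \<Rightarrow> (real ^ 'n) set \<Rightarrow> ((real ^ 'n) set \<Rightarrow> real ^ 'n \<Rightarrow> real) \<Rightarrow> real ^ 'n \<Rightarrow> real"
  where "jump_poly T F P x = (\<Sum>K\<in>{K\<in>T. F facet_of K}. dderiv (outer_normal K F) (P K) x)"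

lemma real_polynomial_function_jump_poly:
  assumes "finite T" "\<And>K. K \<in> T \<Longrightarrow> real_polynomial_function (P K)"
  shows "real_polynomial_function (jump_poly T F P)"
  unfolding jump_poly_def[abs_def] using assms by (intro real_polynomial_function_sum) auto

lemma grad_jump_poly:
  fixes T :: "(real ^ 'n) set set"
  assumes T: "\<And>K. K \<in> T \<Longrightarrow> int CARD('n) simplex K"
    and P: "\<And>K. K \<in> T \<Longrightarrow> real_polynomial_function (P K)" "\<And>K x. K \<in> T \<Longrightarrow> x \<in> K \<Longrightarrow> u x = P K x"
    and x: "x \<in> F"
  shows "grad_jump T F u x = jump_poly T F P x"
  unfolding grad_jump_def jump_poly_def
proof (intro sum.cong refl)
  fix K assume K: "K \<in> {K\<in>T. F facet_of K}"
  then have "x \<in> K" using x facet_of_imp_subset by blast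
  then have "grad_on K u x = gradient (P K) x" using K P by (intro grad_on_poly T) auto
  then show "grad_on K u x \<bullet> outer_normal K F = dderiv (outer_normal K F) (P K) x" by (simp add: dderiv_def inner_commute)
qed

text \<open>
On F the tangential derivatives of the polynomials from the two sides agree, so summing the densities
replaces the normal derivative by the jump J. The result is twice the claimed integrand minus
tangential derivatives of J times tangential derivatives of u. These integrate to 0, because J
vanishes on the relative boundary of F: there the gradients from both sides coincide and the normals
add up to 0.
\<close>

lemma integral_boundary_density_interior:
  fixes \<Omega> :: "(real ^ 'n) set"
  assumes mesh: "conforming_mesh \<Omega> T" and \<Omega>: "open \<Omega>" "convex \<Omega>" and F: "F \<in> interior_faces \<Omega> T"
    and P: "\<And>K. K \<in> T \<Longrightarrow> real_polynomial_function (P K)" "\<And>K x. K \<in> T \<Longrightarrow> x \<in> K \<Longrightarrow> u x = P K x"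
    and C1: "\<And>K S. K \<in> T \<Longrightarrow> S face_of K \<Longrightarrow> aff_dim S = int CARD('n) - 2 \<Longrightarrow> C1_at T S u"
  shows "(\<Sum>K\<in>{K\<in>T. F facet_of K}. LINT x|face_measure F. boundary_density lam F (outer_normal K F) (P K) x) =
    2 * (LINT x|face_measure F. grad_jump T F u x * (tangential_laplacian F u x - lam * u x))"
proof -
  note T = conforming_meshD[OF mesh]
  let ?S = "{K\<in>T. F facet_of K}"
  obtain K0 where K0: "K0 \<in> T" "F facet_of K0" using F unfolding interior_faces_def by blast
  note cF = facet_compact_convex[OF T(2)[OF K0(1)] K0(2)]
  have bF: "F \<in> sets borel" using cF(1) by (rule borel_compact)
  have fS: "finite ?S" using T(1) by simp
  have FK: "F \<subseteq> K" if "K \<in> ?S" for K using that facet_of_imp_subset by blast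
  let ?n = "\<lambda>K. outer_normal K F" let ?p = "P K0" let ?B = "tangent_basis F"
  have fB: "finite ?B" by (rule orthonormal_finite[OF tangent_basis(1)])
  let ?J = "jump_poly T F P"
  have rJ: "real_polynomial_function ?J" by (rule real_polynomial_function_jump_poly[OF T(1) P(1)])
  have rp: "real_polynomial_function ?p" by (rule P(1)[OF K0(1)])
  note rpf = real_polynomial_function_dderiv rJ rp
  have J: "grad_jump T F u x = ?J x" if "x \<in> F" for x by (rule grad_jump_poly) (use T(2) P that in auto)
  have td1: "dderiv t (P K) x = dderiv t ?p x" and td2: "dderiv t (dderiv t (P K)) x = dderiv t (dderiv t ?p) x"
    if K: "K \<in> ?S" and x: "x \<in> F" and t: "t \<in> ?B" for K x t
  proof -
    have uF: "u y = P K y" "u y = ?p y" if "y \<in> F" for y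
      using P(2)[of K y] P(2)[OF K0(1), of y] FK[OF K] FK[of K0] K K0 that by auto
    have rK: "real_polynomial_function (P K)" using K P(1) by auto
    show "dderiv t (P K) x = dderiv t ?p x"
      using tangential_derivative_poly[OF cF(2) x rK uF(1) t] tangential_derivative_poly[OF cF(2) x rp uF(2) t] by simp
    show "dderiv t (dderiv t (P K)) x = dderiv t (dderiv t ?p) x"
      using tangential_derivative2_poly[OF cF(2) x rK uF(1) t] tangential_derivative2_poly[OF cF(2) x rp uF(2) t] by simp
  qed
  have up: "u x = ?p x" if "x \<in> F" for x using P(2)[OF K0(1)] FK[of K0] K0 that by auto
  have J0: "?J x = 0" if x: "x \<in> rel_frontier F" for x
  proof -
    have pK: "polyhedron K0" by (rule simplex_imp_polyhedron[OF T(2)[OF K0(1)]])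
    have "polyhedron F" using face_of_polyhedron_polyhedron[OF pK facet_of_imp_face_of[OF K0(2)]] .
    then obtain S where S: "S facet_of F" "x \<in> S" using x by (auto simp: rel_frontier_of_polyhedron)
    have SK: "S face_of K" if "K \<in> ?S" for K
      using that face_of_trans[OF facet_of_imp_face_of[OF S(1)]] facet_of_imp_face_of by blast
    have "aff_dim S = int CARD('n) - 2"
      using S(1) K0(2) aff_dim_simplex[OF T(2)[OF K0(1)]] by (simp add: facet_of_def)
    then have "C1_at T S u" using C1[OF K0(1) SK] K0 by auto
    then have g: "grad_on K u x = grad_on K0 u x" if "K \<in> ?S" for K
      using that SK[OF that] SK[of K0] K0 S(2) face_of_imp_subset unfolding C1_at_def by blast
    have xF: "x \<in> F" using S facet_of_imp_subset by blast
    have "?J x = (\<Sum>K\<in>?S. grad_on K0 u x \<bullet> ?n K)" unfolding J[OF xF, symmetric] grad_jump_def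
      using g by (intro sum.cong) auto
    also have "\<dots> = grad_on K0 u x \<bullet> (\<Sum>K\<in>?S. ?n K)" by (simp add: inner_sum_right)
    also have "\<dots> = 0" unfolding sum_normals_interior_face[OF mesh \<Omega> F] by simp
    finally show ?thesis .
  qed
  let ?Lp = "\<lambda>x. \<Sum>t\<in>?B. dderiv t (dderiv t ?p) x"
  let ?D = "\<lambda>t x. dderiv t (\<lambda>x. dderiv t ?p x * ?J x) x"
  have dderivJ: "dderiv t ?J x = (\<Sum>K\<in>?S. dderiv t (dderiv (?n K) (P K)) x)" for t x
    unfolding jump_poly_def using fS P(1) by (subst dderiv_sum) auto
  have pt: "(\<Sum>K\<in>?S. boundary_density lam F (?n K) (P K) x) = 2 * (?J x * (?Lp x - lam * ?p x)) + (\<Sum>t\<in>?B. - ?D t x)" if x: "x \<in> F" for x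
  proof -
    have "(\<Sum>K\<in>?S. boundary_density lam F (?n K) (P K) x) = (\<Sum>K\<in>?S. (\<Sum>t\<in>?B. dderiv t (dderiv t ?p) x * dderiv (?n K) (P K) x - dderiv t ?p x * dderiv t (dderiv (?n K) (P K)) x) - 2 * lam * ?p x * dderiv (?n K) (P K) x)"
    proof (intro sum.cong refl)
      fix K assume K: "K \<in> ?S"
      have "P K x = ?p x" using up[OF x] P(2)[of K x] FK[OF K] K x by auto
      then show "boundary_density lam F (?n K) (P K) x = (\<Sum>t\<in>?B. dderiv t (dderiv t ?p) x * dderiv (?n K) (P K) x - dderiv t ?p x * dderiv t (dderiv (?n K) (P K)) x) - 2 * lam * ?p x * dderiv (?n K) (P K) x"
        unfolding boundary_density_def using td1[OF K x] td2[OF K x] by simp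
    qed
    also have "\<dots> = (\<Sum>t\<in>?B. dderiv t (dderiv t ?p) x * ?J x - dderiv t ?p x * dderiv t ?J x) - 2 * lam * ?p x * ?J x"
      unfolding dderivJ by (simp add: sum_subtractf sum_distrib_left jump_poly_def sum.swap[of _ ?B ?S])
    also have "\<dots> = (\<Sum>t\<in>?B. 2 * (dderiv t (dderiv t ?p) x * ?J x) - ?D t x) - 2 * lam * ?p x * ?J x"
    proof -
      have D: "?D t x = dderiv t ?p x * dderiv t ?J x + ?J x * dderiv t (dderiv t ?p) x" for t
        by (subst dderiv_mult) (intro rpf refl)+
      have "dderiv t (dderiv t ?p) x * ?J x - dderiv t ?p x * dderiv t ?J x = 2 * (dderiv t (dderiv t ?p) x * ?J x) - ?D t x" for t
        unfolding D by simp
      then show ?thesis by (simp only:)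
    qed
    also have "\<dots> = 2 * (?J x * (?Lp x - lam * ?p x)) + (\<Sum>t\<in>?B. - ?D t x)"
      by (simp add: sum_subtractf sum_negf sum_distrib_left sum_distrib_right algebra_simps)
    finally show ?thesis .
  qed
  have rD: "real_polynomial_function (\<lambda>x. dderiv t ?p x * ?J x)" for t by (intro rpf real_polynomial_function.intros(4))
  have D0: "(LINT x|face_measure F. - ?D t x) = 0" if t: "t \<in> ?B" for t
  proof -
    have "(LINT x|face_measure F. t \<bullet> gradient (\<lambda>x. dderiv t ?p x * ?J x) x) = 0"
      by (rule integral_face_tangential_derivative[OF cF t GDERIV_poly[OF rD] continuous_on_gradient[OF rD]]) (simp add: J0)
    then show ?thesis by (simp add: dderiv_def)
  qed
  have cbd: "continuous_on UNIV (boundary_density lam F (?n K) (P K))" if "K \<in> ?S" for K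
    unfolding boundary_density_def[abs_def] using that P(1)[of K]
    by (intro continuous_intros continuous_on_poly real_polynomial_function_dderiv) auto
  have "(\<Sum>K\<in>?S. LINT x|face_measure F. boundary_density lam F (?n K) (P K) x) = (LINT x|face_measure F. (\<Sum>K\<in>?S. boundary_density lam F (?n K) (P K) x))"
    by (rule integral_face_sum[OF cF(1) fS, symmetric]) (use cbd in auto)
  also have "\<dots> = (LINT x|face_measure F. 2 * (?J x * (?Lp x - lam * ?p x)) + (\<Sum>t\<in>?B. - ?D t x))"
    by (rule integral_face_cong[OF bF pt])
  also have "\<dots> = (LINT x|face_measure F. 2 * (?J x * (?Lp x - lam * ?p x))) + (LINT x|face_measure F. (\<Sum>t\<in>?B. - ?D t x))"
    by (intro integral_face_add cF continuous_intros continuous_on_poly rpf rD)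
  also have "(LINT x|face_measure F. (\<Sum>t\<in>?B. - ?D t x)) = 0"
    using D0 by (subst integral_face_sum[OF cF(1) fB]) (auto intro!: continuous_intros continuous_on_poly rpf rD)
  also have "(LINT x|face_measure F. 2 * (?J x * (?Lp x - lam * ?p x))) = 2 * (LINT x|face_measure F. ?J x * (?Lp x - lam * ?p x))"
    by simp
  also have "(LINT x|face_measure F. ?J x * (?Lp x - lam * ?p x)) = (LINT x|face_measure F. grad_jump T F u x * (tangential_laplacian F u x - lam * u x))"
    by (rule integral_face_cong[OF bF]) (simp add: J up tangential_laplacian_poly[OF cF(2) _ rp up])
  finally show ?thesis by simp
qed

lemma integral_boundary_density_zero:
  fixes F :: "(real ^ 'n) set"
  assumes F: "compact F" "convex F" and p: "real_polynomial_function p" and 0: "\<And>x. x \<in> F \<Longrightarrow> p x = 0"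
  shows "(LINT x|face_measure F. boundary_density lam F n p x) = 0"
proof -
  have r0: "real_polynomial_function (\<lambda>x :: real ^ 'n. 0 :: real)" by (rule real_polynomial_function.intros(2))
  have "dderiv t p x = 0" "dderiv t (dderiv t p) x = 0" if "x \<in> F" "t \<in> tangent_basis F" for x t
    using tangential_derivative_poly[OF F(2) that(1) p refl that(2)] tangential_derivative_poly[OF F(2) that(1) r0 0 that(2)]
      tangential_derivative2_poly[OF F(2) that(1) p refl that(2)] tangential_derivative2_poly[OF F(2) that(1) r0 0 that(2)]
    by (simp_all add: dderiv_const)
  then have "(LINT x|face_measure F. boundary_density lam F n p x) = (LINT x|face_measure F. 0)"
    using 0 by (intro integral_face_cong borel_compact F) (simp add: boundary_density_def)
  then show ?thesis by simp
qed

lemma finite_facets_mesh: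
  fixes T :: "(real ^ 'n) set set"
  assumes "finite T" "\<And>K. K \<in> T \<Longrightarrow> int CARD('n) simplex K"
  shows "finite {F. \<exists>K\<in>T. F facet_of K}"
proof -
  have "finite {F. F facet_of K}" if "K \<in> T" for K
    using finite_polytope_facets[OF simplex_imp_polytope[OF assms(2)[OF that]]] .
  moreover have "{F. \<exists>K\<in>T. F facet_of K} = (\<Union>K\<in>T. {F. F facet_of K})" by auto
  ultimately show ?thesis using assms(1) by simp
qed

text \<open>
Summing \<open>element_identity\<close> over the elements and collecting the fluxes by faces: the interior faces
yield the jump terms, and u vanishes on the others.
\<close>

lemma mesh_identity:
  fixes \<Omega> :: "(real ^ 'n) set"
  assumes mesh: "conforming_mesh \<Omega> T" and \<Omega>: "open \<Omega>" "convex \<Omega>"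
    and P: "\<And>K. K \<in> T \<Longrightarrow> real_polynomial_function (P K)" "\<And>K x. K \<in> T \<Longrightarrow> x \<in> K \<Longrightarrow> u x = P K x"
    and C1: "\<And>K S. K \<in> T \<Longrightarrow> S face_of K \<Longrightarrow> aff_dim S = int CARD('n) - 2 \<Longrightarrow> C1_at T S u"
    and bd: "\<And>K F x. K \<in> T \<Longrightarrow> F facet_of K \<Longrightarrow> F \<subseteq> frontier \<Omega> \<Longrightarrow> x \<in> F \<Longrightarrow> u x = 0"
  shows "(\<Sum>K\<in>T. LINT x|lborel. indicator K x * (laplacian (P K) x - lam * P K x)\<^sup>2) =
    (\<Sum>K\<in>T. LINT x|lborel. indicator K x * ((norm (hessian (P K) x))\<^sup>2 + 2 * lam * (norm (gradient (P K) x))\<^sup>2 + lam\<^sup>2 * (P K x)\<^sup>2))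
    + 2 * (\<Sum>F\<in>interior_faces \<Omega> T. LINT x|face_measure F. grad_jump T F u x * (tangential_laplacian F u x - lam * u x))"
proof -
  note T = conforming_meshD[OF mesh]
  let ?b = "\<lambda>K F. LINT x|face_measure F. boundary_density lam F (outer_normal K F) (P K) x"
  let ?A = "{F. \<exists>K\<in>T. F facet_of K}"
  have fA: "finite ?A" by (rule finite_facets_mesh[OF T(1,2)])
  have fF: "finite {F. F facet_of K}" if "K \<in> T" for K
    by (rule finite_subset[OF _ fA]) (use that in auto)
  have zero: "?b K F = 0" if "K \<in> T" "F facet_of K" "F \<notin> interior_faces \<Omega> T" for K F
  proof (rule integral_boundary_density_zero)
    show "compact F" "convex F" by (rule facet_compact_convex[OF T(2)[OF that(1)] that(2)])+
    show "real_polynomial_function (P K)" by (rule P(1)[OF that(1)])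
    have "F \<subseteq> frontier \<Omega>" using that unfolding interior_faces_def by blast
    then show "P K x = 0" if "x \<in> F" for x
      using bd[OF \<open>K \<in> T\<close> \<open>F facet_of K\<close> _ that] P(2)[OF \<open>K \<in> T\<close>, of x] that facet_of_imp_subset[OF \<open>F facet_of K\<close>] by auto
  qed
  have "(\<Sum>K\<in>T. \<Sum>F | F facet_of K. ?b K F) = (\<Sum>K\<in>T. \<Sum>F | F \<in> ?A \<and> F facet_of K. ?b K F)"
    by (intro sum.cong refl) auto
  also have "\<dots> = (\<Sum>F\<in>?A. \<Sum>K | K \<in> T \<and> F facet_of K. ?b K F)"
    by (rule sum.swap_restrict[OF T(1) fA])
  also have "\<dots> = (\<Sum>F\<in>interior_faces \<Omega> T. \<Sum>K | K \<in> T \<and> F facet_of K. ?b K F)"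
  proof (rule sum.mono_neutral_right[OF fA])
    show "interior_faces \<Omega> T \<subseteq> ?A" unfolding interior_faces_def by blast
    show "\<forall>F\<in>?A - interior_faces \<Omega> T. (\<Sum>K | K \<in> T \<and> F facet_of K. ?b K F) = 0"
      using zero by (intro ballI sum.neutral) auto
  qed
  also have "\<dots> = (\<Sum>F\<in>interior_faces \<Omega> T. 2 * (LINT x|face_measure F. grad_jump T F u x * (tangential_laplacian F u x - lam * u x)))"
    by (intro sum.cong refl integral_boundary_density_interior[OF mesh \<Omega> _ P C1])
  finally have faces: "(\<Sum>K\<in>T. \<Sum>F | F facet_of K. ?b K F) = 2 * (\<Sum>F\<in>interior_faces \<Omega> T. LINT x|face_measure F. grad_jump T F u x * (tangential_laplacian F u x - lam * u x))"
    by (simp only: sum_distrib_left)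
  show ?thesis unfolding faces[symmetric] sum.distrib[symmetric]
    by (intro sum.cong refl element_identity T(2) P(1))
qed

lemma norm_h_sq_poly:
  fixes T :: "(real ^ 'n) set set"
  assumes T: "\<And>K. K \<in> T \<Longrightarrow> int CARD('n) simplex K"
    and P: "\<And>K. K \<in> T \<Longrightarrow> real_polynomial_function (P K)" "\<And>K x. K \<in> T \<Longrightarrow> x \<in> K \<Longrightarrow> u x = P K x"
  shows "norm_h_sq T lam u = (\<Sum>K\<in>T. LINT x|lborel. indicator K x * ((norm (hessian (P K) x))\<^sup>2 + 2 * lam * (norm (gradient (P K) x))\<^sup>2 + lam\<^sup>2 * (P K x)\<^sup>2))"
  unfolding norm_h_sq_def
proof (intro sum.cong refl)
  fix K assume K: "K \<in> T"
  note S = T[OF K] and p = P(1)[OF K] and u = P(2)[OF K]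
  have cK: "compact K" by (rule compact_simplex[OF S])
  have c: "continuous_on UNIV (\<lambda>x. (norm (hessian (P K) x))\<^sup>2)" "continuous_on UNIV (\<lambda>x. (norm (gradient (P K) x))\<^sup>2)" "continuous_on UNIV (\<lambda>x. (P K x)\<^sup>2)"
    unfolding norm_hessian norm_gradient by (intro continuous_intros continuous_on_poly real_polynomial_function_dderiv p)+
  have conv: "(LINT x|lebesgue_on K. g x) = (LINT x|lborel. indicator K x * f x)" if "continuous_on UNIV f" "\<And>x. x \<in> K \<Longrightarrow> g x = f x" for f g :: "real ^ 'n \<Rightarrow> real"
  proof -
    have "(LINT x|lebesgue_on K. g x) = (LINT x|lebesgue_on K. f x)"
      by (intro Bochner_Integration.integral_cong refl) (simp add: that(2))
    then show ?thesis using integral_lebesgue_on_borel[OF borel_compact[OF cK] borel_measurable_continuous_onI[OF that(1)]] by simp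
  qed
  have i: "integrable lborel (\<lambda>x. indicator K x * (norm (hessian (P K) x))\<^sup>2)"
    "integrable lborel (\<lambda>x. 2 * lam * (indicator K x * (norm (gradient (P K) x))\<^sup>2))"
    "integrable lborel (\<lambda>x. lam\<^sup>2 * (indicator K x * (P K x)\<^sup>2))"
    by (intro integrable_mult_right integrable_compact_lborel cK c)+
  have "(LINT x|lebesgue_on K. (norm (hess_on K u x))\<^sup>2) = (LINT x|lborel. indicator K x * (norm (hessian (P K) x))\<^sup>2)"
    by (rule conv[OF c(1)]) (simp add: hess_on_poly[OF S _ p u])
  moreover have "(LINT x|lebesgue_on K. (norm (grad_on K u x))\<^sup>2) = (LINT x|lborel. indicator K x * (norm (gradient (P K) x))\<^sup>2)"
    by (rule conv[OF c(2)]) (simp add: grad_on_poly[OF S _ p u])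
  moreover have "(LINT x|lebesgue_on K. (u x)\<^sup>2) = (LINT x|lborel. indicator K x * (P K x)\<^sup>2)"
    by (rule conv[OF c(3)]) (simp add: u)
  ultimately have "(LINT x|lebesgue_on K. (norm (hess_on K u x))\<^sup>2) + 2 * lam * (LINT x|lebesgue_on K. (norm (grad_on K u x))\<^sup>2) + lam\<^sup>2 * (LINT x|lebesgue_on K. (u x)\<^sup>2)
    = (LINT x|lborel. indicator K x * (norm (hessian (P K) x))\<^sup>2) + (LINT x|lborel. 2 * lam * (indicator K x * (norm (gradient (P K) x))\<^sup>2)) + (LINT x|lborel. lam\<^sup>2 * (indicator K x * (P K x)\<^sup>2))"
    by (simp only: integral_mult_right_zero)
  also have "\<dots> = (LINT x|lborel. indicator K x * (norm (hessian (P K) x))\<^sup>2 + 2 * lam * (indicator K x * (norm (gradient (P K) x))\<^sup>2) + lam\<^sup>2 * (indicator K x * (P K x)\<^sup>2))"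
    unfolding Bochner_Integration.integral_add[OF i(1,2), symmetric]
    by (rule Bochner_Integration.integral_add[OF Bochner_Integration.integrable_add[OF i(1,2)] i(3), symmetric])
  also have "\<dots> = (LINT x|lborel. indicator K x * ((norm (hessian (P K) x))\<^sup>2 + 2 * lam * (norm (gradient (P K) x))\<^sup>2 + lam\<^sup>2 * (P K x)\<^sup>2))"
    by (intro Bochner_Integration.integral_cong refl) (simp add: algebra_simps)
  finally show "(LINT x|lebesgue_on K. (norm (hess_on K u x))\<^sup>2) + 2 * lam * (LINT x|lebesgue_on K. (norm (grad_on K u x))\<^sup>2) + lam\<^sup>2 * (LINT x|lebesgue_on K. (u x)\<^sup>2)
    = (LINT x|lborel. indicator K x * ((norm (hessian (P K) x))\<^sup>2 + 2 * lam * (norm (gradient (P K) x))\<^sup>2 + lam\<^sup>2 * (P K x)\<^sup>2))" .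
qed

section \<open>Weak derivatives of polynomials\<close>

text \<open>
The divergence theorem for the product of p and a test function, which vanishes on all facets.
\<close>

lemma weak_partial_poly:
  fixes K :: "(real ^ 'n) set"
  assumes K: "int CARD('n) simplex K" and p: "real_polynomial_function p"
  shows "weak_partial (interior K) i p (\<lambda>x. gradient p x $ i)"
  unfolding weak_partial_def
proof
  fix \<phi> assume \<phi>: "\<phi> \<in> test_functions (interior K)"
  have cK: "compact K" "convex K" using K by (auto intro: compact_simplex convex_simplex)
  have sm: "smooth \<phi>" using \<phi> by (simp add: test_functions_def)
  note G = smooth_GDERIV[OF sm]
  note c\<phi> = continuous_on_GDERIV[OF G(1)]
  let ?H = "\<lambda>x. p x *\<^sub>R (\<chi> i. pderivative i \<phi> x) + \<phi> x *\<^sub>R gradient p x"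
  have h: "GDERIV (\<lambda>x. p x * \<phi> x) x :> ?H x" for x by (rule GDERIV_mult[OF GDERIV_poly[OF p] G(1)])
  have H: "continuous_on UNIV ?H" by (intro continuous_intros continuous_on_poly p continuous_on_gradient G c\<phi>)
  have zero: "\<phi> x = 0" if "F facet_of K" "x \<in> F" for F x
  proof (rule ccontr)
    assume "\<phi> x \<noteq> 0"
    then have "x \<in> closure {x. \<phi> x \<noteq> 0}" using subsetD[OF closure_subset, of x "{x. \<phi> x \<noteq> 0}"] by simp
    moreover have "closure {x. \<phi> x \<noteq> 0} \<subseteq> interior K" using \<phi> unfolding test_functions_def by blast
    moreover have "F \<inter> interior K = {}"
      using that(1) by (intro face_of_disjoint_interior facet_of_imp_face_of) (auto simp: facet_of_irrefl)
    ultimately show False using that(2) by blast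
  qed
  note cF = facet_compact_convex(1)[OF K]
  have "(LINT x|lborel. indicator K x * (axis i 1 \<bullet> ?H x)) = (\<Sum>F | F facet_of K. (axis i 1 \<bullet> outer_normal K F) * (LINT x|face_measure F. p x * \<phi> x))"
    by (rule simplex_divergence[OF K h H])
  also have "\<dots> = (\<Sum>F | F facet_of K. (axis i 1 \<bullet> outer_normal K F) * (LINT x|face_measure F. 0))"
    using zero by (intro sum.cong refl arg_cong2[where f="(*)"] integral_face_cong borel_compact cF) auto
  finally have 0: "(LINT x|lborel. indicator K x * (axis i 1 \<bullet> ?H x)) = 0" by simp
  have i1: "integrable lborel (\<lambda>x. indicator K x * (p x * pderivative i \<phi> x))"
    and i2: "integrable lborel (\<lambda>x. indicator K x * (partial i p x * \<phi> x))"
    by (intro integrable_compact_lborel cK continuous_intros continuous_on_poly real_polynomial_function_dderiv p G c\<phi>)+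
  have "(LINT x|lborel. indicator K x * (p x * pderivative i \<phi> x)) + (LINT x|lborel. indicator K x * (partial i p x * \<phi> x))
    = (LINT x|lborel. indicator K x * (axis i 1 \<bullet> ?H x))"
    unfolding Bochner_Integration.integral_add[OF i1 i2, symmetric]
    by (intro Bochner_Integration.integral_cong refl) (simp add: inner_axis' gradient_nth algebra_simps)
  then have s: "(LINT x|lborel. indicator K x * (p x * pderivative i \<phi> x)) = - (LINT x|lborel. indicator K x * (partial i p x * \<phi> x))"
    using 0 by simp
  note conv = integral_interior_borel[OF cK(2,1)]
  have "(LINT x|lebesgue_on (interior K). p x * pderivative i \<phi> x) = - (LINT x|lebesgue_on (interior K). partial i p x * \<phi> x)"
    using s by (subst (1 2) conv) (intro continuous_intros continuous_on_poly real_polynomial_function_dderiv p G c\<phi>)+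
  then show "(LINT x|lebesgue_on (interior K). p x * pderivative i \<phi> x) = - (LINT x|lebesgue_on (interior K). gradient p x $ i * \<phi> x)"
    by (simp add: gradient_nth)
qed

text \<open>
This makes the assumption on the right-hand sides applicable on the interior of each element.
\<close>

lemma H2_poly:
  fixes K :: "(real ^ 'n) set"
  assumes K: "int CARD('n) simplex K" and p: "real_polynomial_function p"
  shows "H2 (interior K) p (gradient p) (hessian p)"
proof -
  have b: "bounded (interior K)" using compact_simplex[OF K] compact_imp_bounded bounded_subset interior_subset by blast
  have H1: "H1 (interior K) q (gradient q)" if q: "real_polynomial_function q" for q :: "real ^ 'n \<Rightarrow> real"
    unfolding H1_def
  proof (intro conjI allI)
    show "q \<in> L2 (interior K)" by (rule continuous_L2[OF open_interior b continuous_on_poly[OF q]])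
    show "(\<lambda>x. gradient q x $ i) \<in> L2 (interior K)" for i
      unfolding gradient_nth by (rule continuous_L2[OF open_interior b continuous_on_poly[OF real_polynomial_function_dderiv[OF q]]])
    show "weak_partial (interior K) i q (\<lambda>x. gradient q x $ i)" for i by (rule weak_partial_poly[OF K q])
  qed
  show ?thesis unfolding H2_def
    using H1[OF p] H1[OF real_polynomial_function_dderiv[OF p]] by (simp add: hessian_def gradient_nth)
qed

section \<open>The Cordes estimate\<close>

text \<open>
For each \<alpha> the ellipticity and Cordes conditions hold outside a null set depending on \<alpha>. Continuity
of the coefficients removes these null sets, which matters because there may be uncountably many \<alpha>.
\<close>

lemma AE_le_continuous:
  fixes f g :: "'a::euclidean_space \<Rightarrow> real"
  assumes \<Omega>: "open \<Omega>" and f: "continuous_on \<Omega> f" and g: "continuous_on \<Omega> g"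
    and ae: "AE x in lebesgue_on \<Omega>. f x \<le> g x" and x: "x \<in> \<Omega>"
  shows "f x \<le> g x"
proof (rule ccontr)
  assume "\<not> f x \<le> g x"
  let ?S = "{x \<in> \<Omega>. f x - g x \<in> {0<..}}"
  have "open ?S" using continuous_open_preimage[OF continuous_on_diff[OF f g] \<Omega> open_greaterThan[of 0]] by (simp add: vimage_def Int_def)
  have "AE x in lebesgue. x \<in> \<Omega> \<longrightarrow> f x \<le> g x"
    using ae \<Omega> by (subst (asm) AE_restrict_space_iff) (auto intro: borel_open)
  then have "AE x in lebesgue. x \<notin> ?S" by eventually_elim auto
  moreover have "?S \<in> sets lebesgue" using \<open>open ?S\<close> by (auto intro: borel_open)
  ultimately have "?S \<in> null_sets lebesgue" by (subst (asm) AE_iff_null_sets[symmetric]) auto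
  then have "negligible ?S" by (simp add: negligible_iff_null_sets)
  moreover have "x \<in> ?S" using x \<open>\<not> f x \<le> g x\<close> by simp
  ultimately show False using open_not_negligible[OF \<open>open ?S\<close>] by blast
qed

lemma mat_1_inner: "mat 1 \<bullet> (M :: real ^ 'n ^ 'n) = trace M"
proof -
  have "mat 1 $ i \<bullet> M $ i = M $ i $ i" for i
  proof -
    have "mat 1 $ i = (axis i 1 :: real ^ 'n)" by (auto simp: mat_def axis_def vec_eq_iff)
    then show ?thesis by (simp add: inner_axis')
  qed
  then show ?thesis unfolding trace_def by (simp add: inner_vec_def[of "mat 1 :: real ^ 'n ^ 'n"])
qed

lemma norm_scaled_minus_mat_1:
  fixes A :: "real ^ 'n ^ 'n"
  shows "(g *\<^sub>R A - mat 1) \<bullet> (g *\<^sub>R A - mat 1) = g\<^sup>2 * (norm A)\<^sup>2 - 2 * g * trace A + real CARD('n)"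
proof -
  have "trace (mat 1 :: real ^ 'n ^ 'n) = real CARD('n)" by (simp add: trace_def mat_def)
  then show ?thesis unfolding power2_norm_eq_inner
    by (simp add: inner_diff_left inner_diff_right mat_1_inner inner_commute[of A "mat 1"] power2_eq_square algebra_simps)
qed

text \<open>
The left-hand side is the square of the inner product of (\<gamma> A - I, \<gamma> b / \<surd>(2\<lambda>), 1 - \<gamma> c / \<lambda>) with
(M, \<surd>(2\<lambda>) q, \<lambda> r), where \<gamma> = S / Q. This \<gamma> minimises the norm of the first vector; the square of
its norm is n + 1 - S^2 / Q, at most 1 - eps by the Cordes condition.
\<close>

lemma cordes_algebra:
  fixes A M :: "real ^ 'n ^ 'n" and b q :: "real ^ 'n"
  assumes lam: "lam > 0"
    and Q: "Q = (norm A)\<^sup>2 + (norm b)\<^sup>2 / (2 * lam) + (c / lam)\<^sup>2" "Q > 0"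
    and S: "S = trace A + c / lam" and le: "Q * (real CARD('n) + eps) \<le> S\<^sup>2"
  shows "(S / Q * (A \<bullet> M + b \<bullet> q - c * r) - (trace M - lam * r))\<^sup>2 \<le> (1 - eps) * ((norm M)\<^sup>2 + 2 * lam * (norm q)\<^sup>2 + lam\<^sup>2 * r\<^sup>2)"
proof -
  let ?g = "S / Q" let ?k = "sqrt (2 * lam)"
  let ?X = "(?g *\<^sub>R A - mat 1, (?g / ?k) *\<^sub>R b, 1 - ?g * (c / lam))" and ?Y = "(M, ?k *\<^sub>R q, lam * r)"
  have k: "?k > 0" "?k * ?k = 2 * lam" using lam by auto
  have XY: "?X \<bullet> ?Y = ?g * (A \<bullet> M + b \<bullet> q - c * r) - (trace M - lam * r)"
    using k lam by (simp add: inner_diff_left mat_1_inner field_simps) (simp add: add_divide_distrib diff_divide_distrib)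
  have "(g *\<^sub>R A - mat 1, (g / ?k) *\<^sub>R b, 1 - g * (c / lam)) \<bullet> (g *\<^sub>R A - mat 1, (g / ?k) *\<^sub>R b, 1 - g * (c / lam)) =
    g\<^sup>2 * ((norm A)\<^sup>2 + (norm b)\<^sup>2 / (2 * lam) + (c / lam)\<^sup>2) - 2 * g * (trace A + c / lam) + real CARD('n) + 1" for g
  proof -
    have "((g / ?k) *\<^sub>R b) \<bullet> ((g / ?k) *\<^sub>R b) = ((g / ?k) * (g / ?k)) * (b \<bullet> b)"
      by (simp only: inner_scaleR_left inner_scaleR_right mult.assoc)
    also have "\<dots> = (g * g) / (?k * ?k) * (b \<bullet> b)" by (simp only: times_divide_times_eq)
    also have "\<dots> = g\<^sup>2 * ((norm b)\<^sup>2 / (2 * lam))" unfolding k(2) power2_norm_eq_inner by (simp add: power2_eq_square)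
    finally have b: "((g / ?k) *\<^sub>R b) \<bullet> ((g / ?k) *\<^sub>R b) = g\<^sup>2 * ((norm b)\<^sup>2 / (2 * lam))" .
    have c: "(1 - g * u) \<bullet> (1 - g * u) = 1 - 2 * g * u + g\<^sup>2 * u\<^sup>2" for u :: real
      by (simp add: power2_eq_square algebra_simps)
    show ?thesis unfolding inner_Pair norm_scaled_minus_mat_1 b c by (simp only: distrib_left)
  qed
  from this[of ?g] have XX: "?X \<bullet> ?X = ?g\<^sup>2 * Q - 2 * ?g * S + real CARD('n) + 1" unfolding Q(1)[symmetric] S[symmetric] .
  have YY: "?Y \<bullet> ?Y = (norm M)\<^sup>2 + 2 * lam * (norm q)\<^sup>2 + lam\<^sup>2 * r\<^sup>2"
    using k unfolding power2_norm_eq_inner by (simp add: power2_eq_square algebra_simps)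
  have "?g\<^sup>2 * Q - 2 * ?g * S = - (S\<^sup>2 / Q)" using Q(2) by (simp add: power2_eq_square field_simps)
  moreover have "real CARD('n) + eps \<le> S\<^sup>2 / Q" using le Q(2) by (simp add: pos_le_divide_eq mult.commute)
  ultimately have X: "?X \<bullet> ?X \<le> 1 - eps" unfolding XX by linarith
  have "(?X \<bullet> ?Y)\<^sup>2 \<le> (?X \<bullet> ?X) * (?Y \<bullet> ?Y)" by (rule Cauchy_Schwarz_ineq)
  also have "\<dots> \<le> (1 - eps) * (?Y \<bullet> ?Y)" using X by (rule mult_right_mono) (rule inner_ge_zero)
  finally show ?thesis unfolding XY YY .
qed

text \<open>
The same computation without lower-order terms, where only the component \<gamma> A - I remains and the
square of its norm is n - (tr A)^2 / |A|^2.
\<close>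

lemma cordes_algebra_0:
  fixes A M :: "real ^ 'n ^ 'n"
  assumes A: "norm A > 0" and le: "(norm A)\<^sup>2 * (real CARD('n) - 1 + eps) \<le> (trace A)\<^sup>2"
  shows "(trace A / (norm A)\<^sup>2 * (A \<bullet> M) - trace M)\<^sup>2 \<le> (1 - eps) * (norm M)\<^sup>2"
proof -
  let ?Q = "(norm A)\<^sup>2" let ?g = "trace A / ?Q" let ?X = "?g *\<^sub>R A - mat 1"
  have Q: "?Q > 0" using A by simp
  have XY: "?X \<bullet> M = ?g * (A \<bullet> M) - trace M" by (simp add: inner_diff_left mat_1_inner)
  have XX: "?X \<bullet> ?X = ?g\<^sup>2 * ?Q - 2 * ?g * trace A + real CARD('n)" by (rule norm_scaled_minus_mat_1)
  have "?g\<^sup>2 * ?Q - 2 * ?g * trace A = - ((trace A)\<^sup>2 / ?Q)" using Q by (simp add: power2_eq_square field_simps)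
  moreover have "real CARD('n) - 1 + eps \<le> (trace A)\<^sup>2 / ?Q" using le Q by (simp add: pos_le_divide_eq mult.commute)
  ultimately have X: "?X \<bullet> ?X \<le> 1 - eps" unfolding XX by linarith
  have "(?X \<bullet> M)\<^sup>2 \<le> (?X \<bullet> ?X) * (M \<bullet> M)" by (rule Cauchy_Schwarz_ineq)
  also have "\<dots> \<le> (1 - eps) * (M \<bullet> M)" using X by (rule mult_right_mono) simp
  finally show ?thesis unfolding XY power2_norm_eq_inner[of M] .
qed

lemma continuous_on_slice:
  assumes "continuous_on (S \<times> \<Lambda>) (\<lambda>(x, \<alpha>). f \<alpha> x)" "\<alpha> \<in> \<Lambda>" "T \<subseteq> S"
  shows "continuous_on T (f \<alpha>)"
proof -
  have "continuous_on T (\<lambda>x. (\<lambda>(x, \<alpha>). f \<alpha> x) (x, \<alpha>))"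
    using assms(2,3) by (intro continuous_on_compose2[OF assms(1)] continuous_intros) auto
  then show ?thesis by simp
qed

lemma cordes_pointwise:
  fixes \<Omega> :: "(real ^ 'n) set" and A :: "'l::metric_space \<Rightarrow> real ^ 'n \<Rightarrow> real ^ 'n ^ 'n"
  assumes \<Omega>: "open \<Omega>"
    and cA: "continuous_on (closure \<Omega> \<times> \<Lambda>) (\<lambda>(x, \<alpha>). A \<alpha> x)"
    and cb: "continuous_on (closure \<Omega> \<times> \<Lambda>) (\<lambda>(x, \<alpha>). b \<alpha> x)"
    and cc: "continuous_on (closure \<Omega> \<times> \<Lambda>) (\<lambda>(x, \<alpha>). c \<alpha> x)"
    and ell: "uniformly_elliptic \<Omega> \<Lambda> A" and cor: "cordes \<Omega> \<Lambda> A b c eps lam"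
    and x: "x \<in> \<Omega>" and \<alpha>: "\<alpha> \<in> \<Lambda>"
  shows "(gamma \<Omega> \<Lambda> A b c lam \<alpha> x * L_op A b c \<alpha> x r q M - (trace M - lam * r))\<^sup>2
    \<le> (1 - eps) * ((norm M)\<^sup>2 + 2 * lam * (norm q)\<^sup>2 + lam\<^sup>2 * r\<^sup>2)"
proof -
  have cl: "\<Omega> \<subseteq> closure \<Omega>" by (rule closure_subset)
  have cA': "continuous_on \<Omega> (A \<alpha>)" and cb': "continuous_on \<Omega> (b \<alpha>)" and cc': "continuous_on \<Omega> (c \<alpha>)"
    using continuous_on_slice[OF cA \<alpha> cl] continuous_on_slice[OF cb \<alpha> cl] continuous_on_slice[OF cc \<alpha> cl] by auto
  have ctr: "continuous_on \<Omega> (\<lambda>x. trace (A \<alpha> x))"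
    unfolding trace_def by (intro continuous_intros cA')
  obtain \<nu>1 where nu: "\<nu>1 > 0" and e0: "AE x in lebesgue_on \<Omega>. \<forall>\<xi>. \<nu>1 * (norm \<xi>)\<^sup>2 \<le> \<xi> \<bullet> (A \<alpha> x *v \<xi>)"
  proof -
    obtain \<nu>1 \<nu>2 where "\<nu>1 > 0" "\<forall>\<alpha>\<in>\<Lambda>. AE x in lebesgue_on \<Omega>. \<forall>\<xi>.
      \<nu>1 * (norm \<xi>)\<^sup>2 \<le> \<xi> \<bullet> (A \<alpha> x *v \<xi>) \<and> \<xi> \<bullet> (A \<alpha> x *v \<xi>) \<le> \<nu>2 * (norm \<xi>)\<^sup>2"
      using ell unfolding uniformly_elliptic_def by blast
    then show ?thesis using \<alpha> by (intro that[of \<nu>1]) (auto elim!: eventually_mono dest!: bspec)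
  qed
  have diag: "\<xi> \<bullet> (B *v \<xi>) = B $ i $ i" if "\<xi> = axis i 1" for \<xi> :: "real ^ 'n" and B :: "real ^ 'n ^ 'n" and i
    unfolding that inner_axis' by (simp add: matrix_vector_mul_component inner_axis)
  have eAE: "AE x in lebesgue_on \<Omega>. \<forall>i. \<nu>1 \<le> A \<alpha> x $ i $ i"
    using e0
  proof eventually_elim
    fix x assume *: "\<forall>\<xi>. \<nu>1 * (norm \<xi>)\<^sup>2 \<le> \<xi> \<bullet> (A \<alpha> x *v \<xi>)"
    show "\<forall>i. \<nu>1 \<le> A \<alpha> x $ i $ i"
    proof
      fix i show "\<nu>1 \<le> A \<alpha> x $ i $ i" using *[rule_format, of "axis i 1"] by (simp add: diag[OF refl])
    qed
  qed
  have trAE: "AE x in lebesgue_on \<Omega>. trace (A \<alpha> x) \<noteq> 0"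
    using eAE
  proof eventually_elim
    fix x assume *: "\<forall>i. \<nu>1 \<le> A \<alpha> x $ i $ i"
    have "0 < (\<Sum>i\<in>UNIV. A \<alpha> x $ i $ i)" using * nu by (intro sum_pos) (auto intro: less_le_trans)
    then show "trace (A \<alpha> x) \<noteq> 0" by (simp add: trace_def)
  qed
  have Apos: "norm (A \<alpha> x) > 0"
  proof -
    have "\<nu>1 \<le> A \<alpha> x $ i $ i" for i
      by (rule AE_le_continuous[OF \<Omega> continuous_on_const _ _ x])
        (auto intro!: continuous_intros cA' eventually_mono[OF eAE])
    from this[of undefined] show ?thesis using nu by auto
  qed
  show ?thesis
  proof (cases "lower_order \<Omega> \<Lambda> b c")
    case True
    let ?Q = "\<lambda>x. (norm (A \<alpha> x))\<^sup>2 + (norm (b \<alpha> x))\<^sup>2 / (2 * lam) + (c \<alpha> x / lam)\<^sup>2"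
    let ?S = "\<lambda>x. trace (A \<alpha> x) + c \<alpha> x / lam"
    have lam: "lam > 0" and eps: "0 < eps" and ae: "AE x in lebesgue_on \<Omega>. ?S x \<noteq> 0 \<and> ?Q x / (?S x)\<^sup>2 \<le> 1 / (real CARD('n) + eps)"
      using cor True \<alpha> by (auto simp: cordes_def)
    have "?Q x * (real CARD('n) + eps) \<le> (?S x)\<^sup>2"
    proof (rule AE_le_continuous[OF \<Omega> _ _ _ x])
      show "continuous_on \<Omega> (\<lambda>x. ?Q x * (real CARD('n) + eps))" "continuous_on \<Omega> (\<lambda>x. (?S x)\<^sup>2)"
        using lam by (auto intro!: continuous_intros cA' cb' cc' ctr)
      show "AE x in lebesgue_on \<Omega>. ?Q x * (real CARD('n) + eps) \<le> (?S x)\<^sup>2"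
        using ae
      proof eventually_elim
        fix x assume *: "?S x \<noteq> 0 \<and> ?Q x / (?S x)\<^sup>2 \<le> 1 / (real CARD('n) + eps)"
        have n: "real CARD('n) + eps > 0" using eps by (simp add: add_nonneg_pos)
        have "(?S x)\<^sup>2 > 0" using * by simp
        then have "?Q x \<le> 1 / (real CARD('n) + eps) * (?S x)\<^sup>2" using * by (subst (asm) pos_divide_le_eq) auto
        then show "?Q x * (real CARD('n) + eps) \<le> (?S x)\<^sup>2"
          using n by (simp add: pos_le_divide_eq)
      qed
    qed
    moreover have "?Q x > 0" using Apos lam by (intro add_pos_nonneg) auto
    ultimately have "(?S x / ?Q x * (A \<alpha> x \<bullet> M + b \<alpha> x \<bullet> q - c \<alpha> x * r) - (trace M - lam * r))\<^sup>2 \<le> (1 - eps) * ((norm M)\<^sup>2 + 2 * lam * (norm q)\<^sup>2 + lam\<^sup>2 * r\<^sup>2)"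
      by (intro cordes_algebra[OF lam refl _ refl])
    then show ?thesis using True by (simp add: gamma_def L_op_def)
  next
    case False
    have lam: "lam = 0" and eps: "0 < eps" and ae: "AE x in lebesgue_on \<Omega>. (norm (A \<alpha> x))\<^sup>2 / (trace (A \<alpha> x))\<^sup>2 \<le> 1 / (real CARD('n) - 1 + eps)"
      using cor False \<alpha> by (auto simp: cordes_def)
    have bc: "b \<alpha> x = 0" "c \<alpha> x = 0" using False \<alpha> x cl unfolding lower_order_def by blast+
    have "(norm (A \<alpha> x))\<^sup>2 * (real CARD('n) - 1 + eps) \<le> (trace (A \<alpha> x))\<^sup>2"
    proof (rule AE_le_continuous[OF \<Omega> _ _ _ x])
      show "continuous_on \<Omega> (\<lambda>x. (norm (A \<alpha> x))\<^sup>2 * (real CARD('n) - 1 + eps))" "continuous_on \<Omega> (\<lambda>x. (trace (A \<alpha> x))\<^sup>2)"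
        by (auto intro!: continuous_intros cA' ctr)
      show "AE x in lebesgue_on \<Omega>. (norm (A \<alpha> x))\<^sup>2 * (real CARD('n) - 1 + eps) \<le> (trace (A \<alpha> x))\<^sup>2"
        using ae trAE
      proof eventually_elim
        fix x assume *: "(norm (A \<alpha> x))\<^sup>2 / (trace (A \<alpha> x))\<^sup>2 \<le> 1 / (real CARD('n) - 1 + eps)" "trace (A \<alpha> x) \<noteq> 0"
        have "real CARD('n) \<ge> 1" by simp
        then have n: "real CARD('n) - 1 + eps > 0" using eps by linarith
        have "(trace (A \<alpha> x))\<^sup>2 > 0" using * by simp
        then have "(norm (A \<alpha> x))\<^sup>2 \<le> 1 / (real CARD('n) - 1 + eps) * (trace (A \<alpha> x))\<^sup>2" using * by (subst (asm) pos_divide_le_eq) auto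
        then show "(norm (A \<alpha> x))\<^sup>2 * (real CARD('n) - 1 + eps) \<le> (trace (A \<alpha> x))\<^sup>2"
          using n by (simp add: pos_le_divide_eq)
      qed
    qed
    from cordes_algebra_0[OF Apos this, of M] show ?thesis using False bc lam by (simp add: gamma_def L_op_def)
  qed
qed

lemma SUP_diff_bound:
  fixes f g :: "'l \<Rightarrow> real"
  assumes ne: "\<Lambda> \<noteq> {}" and f: "bdd_above (f ` \<Lambda>)" and g: "bdd_above (g ` \<Lambda>)"
    and le: "\<And>\<alpha>. \<alpha> \<in> \<Lambda> \<Longrightarrow> \<bar>f \<alpha> - g \<alpha> - l\<bar> \<le> e"
  shows "\<bar>(SUP \<alpha>\<in>\<Lambda>. f \<alpha>) - (SUP \<alpha>\<in>\<Lambda>. g \<alpha>) - l\<bar> \<le> e"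
proof -
  have "(SUP \<alpha>\<in>\<Lambda>. f \<alpha>) \<le> (SUP \<alpha>\<in>\<Lambda>. g \<alpha>) + l + e"
  proof (rule cSUP_least[OF ne])
    fix \<alpha> assume \<alpha>: "\<alpha> \<in> \<Lambda>"
    show "f \<alpha> \<le> (SUP \<alpha>\<in>\<Lambda>. g \<alpha>) + l + e" using le[OF \<alpha>] cSUP_upper[OF \<alpha> g] by linarith
  qed
  moreover have "(SUP \<alpha>\<in>\<Lambda>. g \<alpha>) \<le> (SUP \<alpha>\<in>\<Lambda>. f \<alpha>) - l + e"
  proof (rule cSUP_least[OF ne])
    fix \<alpha> assume \<alpha>: "\<alpha> \<in> \<Lambda>"
    show "g \<alpha> \<le> (SUP \<alpha>\<in>\<Lambda>. f \<alpha>) - l + e" using le[OF \<alpha>] cSUP_upper[OF \<alpha> f] by linarith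
  qed
  ultimately show ?thesis by linarith
qed

section \<open>Strong monotonicity\<close>

lemma integrable_L2_mult:
  assumes "f \<in> L2 U" "g \<in> L2 U" shows "integrable (lebesgue_on U) (\<lambda>x. f x * g x)"
proof -
  have m: "f \<in> borel_measurable (lebesgue_on U)" "g \<in> borel_measurable (lebesgue_on U)"
    and i: "integrable (lebesgue_on U) (\<lambda>x. (f x)\<^sup>2 + (g x)\<^sup>2)"
    using assms by (auto simp: L2_def)
  show ?thesis
  proof (rule Bochner_Integration.integrable_bound[OF i])
    show "AE x in lebesgue_on U. norm (f x * g x) \<le> norm ((f x)\<^sup>2 + (g x)\<^sup>2)"
    proof (rule AE_I2)
      fix x
      have "0 \<le> (\<bar>f x\<bar> - \<bar>g x\<bar>)\<^sup>2" "0 \<le> (f x)\<^sup>2 + (g x)\<^sup>2" by simp_all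
      then have "2 * \<bar>f x * g x\<bar> \<le> (f x)\<^sup>2 + (g x)\<^sup>2" by (simp add: power2_diff abs_mult)
      then show "norm (f x * g x) \<le> norm ((f x)\<^sup>2 + (g x)\<^sup>2)" by simp
    qed
  qed (use m in measurable)
qed

text \<open>
Young's inequality applied to (d - L) L.
\<close>

lemma perturbation_lower_bound:
  fixes d L R \<delta> :: real
  assumes \<delta>: "\<delta> \<ge> 0" and d: "(d - L)\<^sup>2 \<le> \<delta>\<^sup>2 * R"
  shows "d * L \<ge> (1 - \<delta> / 2) * L\<^sup>2 - \<delta> / 2 * R"
proof (cases "\<delta> = 0")
  case True
  then have "d = L" using d by simp
  then show ?thesis using True by (simp add: power2_eq_square)
next
  case False
  then have "\<delta> > 0" using \<delta> by simp
  have "0 \<le> ((d - L) + \<delta> * L)\<^sup>2" by simp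
  then have "0 \<le> \<delta>\<^sup>2 * R + 2 * \<delta> * ((d - L) * L) + \<delta>\<^sup>2 * L\<^sup>2"
    using d by (simp add: power2_eq_square algebra_simps)
  then have "0 \<le> \<delta> * (\<delta> * R + 2 * ((d - L) * L) + \<delta> * L\<^sup>2)" by (simp add: power2_eq_square algebra_simps)
  then have "0 \<le> \<delta> * R + 2 * ((d - L) * L) + \<delta> * L\<^sup>2" using \<open>\<delta> > 0\<close> by (simp add: zero_le_mult_iff)
  then show ?thesis by (simp add: power2_eq_square algebra_simps)
qed

text \<open>
The bounds of \<open>cordes_pointwise\<close> pass to the suprema wherever both are finite, that is almost
everywhere, and \<open>perturbation_lower_bound\<close> is integrated over the element. Square integrability
of the nonlinear terms, part of the assumption on the right-hand sides, allows splitting the integral.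
\<close>

lemma element_estimate:
  fixes \<Omega> :: "(real ^ 'n) set" and A :: "'l::metric_space \<Rightarrow> real ^ 'n \<Rightarrow> real ^ 'n ^ 'n"
  assumes \<Omega>: "open \<Omega>" and ne: "\<Lambda> \<noteq> {}"
    and cA: "continuous_on (closure \<Omega> \<times> \<Lambda>) (\<lambda>(x, \<alpha>). A \<alpha> x)"
    and cb: "continuous_on (closure \<Omega> \<times> \<Lambda>) (\<lambda>(x, \<alpha>). b \<alpha> x)"
    and cc: "continuous_on (closure \<Omega> \<times> \<Lambda>) (\<lambda>(x, \<alpha>). c \<alpha> x)"
    and ell: "uniformly_elliptic \<Omega> \<Lambda> A" and cor: "cordes \<Omega> \<Lambda> A b c eps lam"
    and rhs: "admissible_rhs \<Omega> \<Lambda> A b c f lam"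
    and K: "int CARD('n) simplex K" "interior K \<subseteq> \<Omega>"
    and p: "real_polynomial_function p" "\<And>x. x \<in> K \<Longrightarrow> w x = p x"
    and q: "real_polynomial_function q" "\<And>x. x \<in> K \<Longrightarrow> v x = q x"
  defines "\<delta> \<equiv> sqrt (1 - eps)"
  defines "r \<equiv> \<lambda>x. p x - q x"
  shows "(LINT x|lebesgue_on K. F_gamma \<Omega> \<Lambda> A b c f lam x (w x) (grad_on K w x) (hess_on K w x) * L_lam K lam (\<lambda>x. w x - v x) x)
       - (LINT x|lebesgue_on K. F_gamma \<Omega> \<Lambda> A b c f lam x (v x) (grad_on K v x) (hess_on K v x) * L_lam K lam (\<lambda>x. w x - v x) x)
    \<ge> (1 - \<delta> / 2) * (LINT x|lborel. indicator K x * (laplacian r x - lam * r x)\<^sup>2)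
     - \<delta> / 2 * (LINT x|lborel. indicator K x * ((norm (hessian r x))\<^sup>2 + 2 * lam * (norm (gradient r x))\<^sup>2 + lam\<^sup>2 * (r x)\<^sup>2))"
proof -
  let ?U = "interior K"
  have cK: "compact K" "convex K" using K(1) by (auto intro: compact_simplex convex_simplex)
  have bU: "bounded ?U" by (rule bounded_subset[OF compact_imp_bounded[OF cK(1)] interior_subset])
  have eps: "0 < eps" "eps \<le> 1" using cor by (auto simp: cordes_def)
  have \<delta>: "\<delta> \<ge> 0" "\<delta>\<^sup>2 = 1 - eps" using eps by (auto simp: \<delta>_def)
  have rr: "real_polynomial_function r" unfolding r_def by (intro real_polynomial_function_diff p(1) q(1))
  let ?F = "\<lambda>p x. F_gamma \<Omega> \<Lambda> A b c f lam x (p x) (gradient p x) (hessian p x)"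
  let ?L = "\<lambda>x. laplacian r x - lam * r x"
  let ?R = "\<lambda>x. (norm (hessian r x))\<^sup>2 + 2 * lam * (norm (gradient r x))\<^sup>2 + lam\<^sup>2 * (r x)\<^sup>2"
  have UK: "x \<in> K" if "x \<in> ?U" for x using that interior_subset by blast
  have adm: "AE x in lebesgue_on ?U. bdd_above ((\<lambda>\<alpha>. gamma \<Omega> \<Lambda> A b c lam \<alpha> x * (L_op A b c \<alpha> x (s x) (gradient s x) (hessian s x) - f \<alpha> x)) ` \<Lambda>)"
      "?F s \<in> L2 ?U" if "real_polynomial_function s" for s
    using rhs H2_poly[OF K(1) that] K(2) unfolding admissible_rhs_def by blast+
  have L: "L_lam K lam (\<lambda>x. w x - v x) x = ?L x" if "x \<in> K" for x
  proof -
    have "hess_on K (\<lambda>x. w x - v x) x = hessian r x"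
      by (rule hess_on_poly[OF K(1) that rr]) (simp add: r_def p(2) q(2))
    then show ?thesis using that by (simp add: L_lam_def trace_hessian r_def p(2) q(2))
  qed
  have Fw: "F_gamma \<Omega> \<Lambda> A b c f lam x (w x) (grad_on K w x) (hess_on K w x) = ?F p x" if "x \<in> K" for x
    using that by (simp add: p(2) grad_on_poly[OF K(1) that p] hess_on_poly[OF K(1) that p])
  have Fv: "F_gamma \<Omega> \<Lambda> A b c f lam x (v x) (grad_on K v x) (hess_on K v x) = ?F q x" if "x \<in> K" for x
    using that by (simp add: q(2) grad_on_poly[OF K(1) that q] hess_on_poly[OF K(1) that q])
  have cL: "continuous_on UNIV ?L" by (intro continuous_intros continuous_on_poly real_polynomial_function_laplacian rr)
  have cR: "continuous_on UNIV ?R"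
    unfolding norm_hessian norm_gradient by (intro continuous_intros continuous_on_poly real_polynomial_function_dderiv rr)
  have LL2: "?L \<in> L2 ?U" by (rule continuous_L2[OF open_interior bU cL])
  note ip = integrable_L2_mult[OF adm(2)[OF p(1)] LL2] and iq = integrable_L2_mult[OF adm(2)[OF q(1)] LL2]
  have iL: "integrable (lebesgue_on ?U) (\<lambda>x. (?L x)\<^sup>2)" and iR: "integrable (lebesgue_on ?U) ?R"
    by (intro continuous_integrable_lebesgue_on open_interior bU continuous_intros cL cR)+
  note conv = integral_interior_borel[OF cK(2,1)]
  have "(LINT x|lebesgue_on K. F_gamma \<Omega> \<Lambda> A b c f lam x (w x) (grad_on K w x) (hess_on K w x) * L_lam K lam (\<lambda>x. w x - v x) x)
      = (LINT x|lebesgue_on K. ?F p x * ?L x)"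
    by (intro Bochner_Integration.integral_cong refl) (simp add: L Fw)
  also have "\<dots> = (LINT x|lebesgue_on ?U. ?F p x * ?L x)" by (rule integral_lebesgue_on_interior(1)[OF cK(2,1)])
  finally have 1: "(LINT x|lebesgue_on K. F_gamma \<Omega> \<Lambda> A b c f lam x (w x) (grad_on K w x) (hess_on K w x) * L_lam K lam (\<lambda>x. w x - v x) x) = \<dots>" .
  have "(LINT x|lebesgue_on K. F_gamma \<Omega> \<Lambda> A b c f lam x (v x) (grad_on K v x) (hess_on K v x) * L_lam K lam (\<lambda>x. w x - v x) x)
      = (LINT x|lebesgue_on K. ?F q x * ?L x)"
    by (intro Bochner_Integration.integral_cong refl) (simp add: L Fv)
  also have "\<dots> = (LINT x|lebesgue_on ?U. ?F q x * ?L x)" by (rule integral_lebesgue_on_interior(1)[OF cK(2,1)])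
  finally have 2: "(LINT x|lebesgue_on K. F_gamma \<Omega> \<Lambda> A b c f lam x (v x) (grad_on K v x) (hess_on K v x) * L_lam K lam (\<lambda>x. w x - v x) x) = \<dots>" .
  have lin: "r x = p x - q x" "gradient r x = gradient p x - gradient q x" "hessian r x = hessian p x - hessian q x" for x
  proof -
    show "r x = p x - q x" by (simp add: r_def)
    show "gradient r x = gradient p x - gradient q x"
      unfolding r_def vec_eq_iff gradient_nth by (simp add: gradient_nth dderiv_diff[OF p(1) q(1)])
    show "hessian r x = hessian p x - hessian q x"
      unfolding r_def vec_eq_iff
      by (simp add: hessian_nth dderiv_diff[OF p(1) q(1)] dderiv_diff[OF real_polynomial_function_dderiv[OF p(1)] real_polynomial_function_dderiv[OF q(1)]])
  qed
  have ae: "AE x in lebesgue_on ?U. (1 - \<delta> / 2) * (?L x)\<^sup>2 - \<delta> / 2 * ?R x \<le> ?F p x * ?L x - ?F q x * ?L x"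
    using adm(1)[OF p(1)] adm(1)[OF q(1)] AE_space
  proof eventually_elim
    fix x
    let ?f = "\<lambda>s \<alpha>. gamma \<Omega> \<Lambda> A b c lam \<alpha> x * (L_op A b c \<alpha> x (s x) (gradient s x) (hessian s x) - f \<alpha> x)"
    assume bd: "bdd_above (?f p ` \<Lambda>)" "bdd_above (?f q ` \<Lambda>)" and "x \<in> space (lebesgue_on ?U)"
    then have x: "x \<in> \<Omega>" using K(2) by auto
    have "\<bar>?F p x - ?F q x - ?L x\<bar> \<le> sqrt ((1 - eps) * ?R x)"
      unfolding F_gamma_def
    proof (rule SUP_diff_bound[OF ne bd])
      fix \<alpha> assume \<alpha>: "\<alpha> \<in> \<Lambda>"
      have e: "?f p \<alpha> - ?f q \<alpha> = gamma \<Omega> \<Lambda> A b c lam \<alpha> x * L_op A b c \<alpha> x (r x) (gradient r x) (hessian r x)"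
        unfolding lin L_op_def by (simp add: inner_diff_right algebra_simps)
      show "\<bar>?f p \<alpha> - ?f q \<alpha> - ?L x\<bar> \<le> sqrt ((1 - eps) * ?R x)"
        unfolding e using cordes_pointwise[OF \<Omega> cA cb cc ell cor x \<alpha>, of "r x" "gradient r x" "hessian r x"]
        by (intro real_le_rsqrt) (simp add: trace_hessian)
    qed
    moreover have "0 \<le> (1 - eps) * ?R x"
    proof -
      have "0 \<le> lam" using cor by (auto simp: cordes_def split: if_splits)
      then show ?thesis using eps by simp
    qed
    ultimately have "(?F p x - ?F q x - ?L x)\<^sup>2 \<le> \<delta>\<^sup>2 * ?R x"
      unfolding \<delta>(2) by (simp add: sqrt_ge_absD)
    from perturbation_lower_bound[OF \<delta>(1) this]
    show "(1 - \<delta> / 2) * (?L x)\<^sup>2 - \<delta> / 2 * ?R x \<le> ?F p x * ?L x - ?F q x * ?L x"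
      by (simp add: left_diff_distrib)
  qed
  have "(1 - \<delta> / 2) * (LINT x|lborel. indicator K x * (?L x)\<^sup>2) - \<delta> / 2 * (LINT x|lborel. indicator K x * ?R x)
    = (1 - \<delta> / 2) * (LINT x|lebesgue_on ?U. (?L x)\<^sup>2) - \<delta> / 2 * (LINT x|lebesgue_on ?U. ?R x)"
    by (simp only: conv[OF cR] conv[OF continuous_on_power[OF cL]])
  also have "\<dots> = (LINT x|lebesgue_on ?U. (1 - \<delta> / 2) * (?L x)\<^sup>2) - (LINT x|lebesgue_on ?U. \<delta> / 2 * ?R x)"
    by (simp only: integral_mult_right_zero)
  also have "\<dots> = (LINT x|lebesgue_on ?U. (1 - \<delta> / 2) * (?L x)\<^sup>2 - \<delta> / 2 * ?R x)"
    by (rule Bochner_Integration.integral_diff[OF integrable_mult_right[OF iL] integrable_mult_right[OF iR], symmetric])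
  also have "\<dots> \<le> (LINT x|lebesgue_on ?U. ?F p x * ?L x - ?F q x * ?L x)"
    by (rule integral_mono_AE[OF Bochner_Integration.integrable_diff[OF integrable_mult_right[OF iL] integrable_mult_right[OF iR]]
        Bochner_Integration.integrable_diff[OF ip iq] ae])
  also have "\<dots> = (LINT x|lebesgue_on ?U. ?F p x * ?L x) - (LINT x|lebesgue_on ?U. ?F q x * ?L x)"
    by (rule Bochner_Integration.integral_diff[OF ip iq])
  finally show ?thesis unfolding 1 2 .
qed

lemma grad_on_diff_poly:
  fixes K :: "(real ^ 'n) set"
  assumes K: "int CARD('n) simplex K" and x: "x \<in> K"
    and p: "real_polynomial_function p" "\<And>y. y \<in> K \<Longrightarrow> w y = p y"
    and q: "real_polynomial_function q" "\<And>y. y \<in> K \<Longrightarrow> v y = q y"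
  shows "grad_on K (\<lambda>y. w y - v y) x = grad_on K w x - grad_on K v x"
proof -
  have "grad_on K (\<lambda>y. w y - v y) x = gradient (\<lambda>y. p y - q y) x"
    by (rule grad_on_poly[OF K x real_polynomial_function_diff[OF p(1) q(1)]]) (simp add: p(2) q(2))
  also have "\<dots> = gradient p x - gradient q x"
    unfolding vec_eq_iff by (simp add: gradient_nth dderiv_diff[OF p(1) q(1)])
  finally show ?thesis by (simp add: grad_on_poly[OF K x p] grad_on_poly[OF K x q])
qed

lemma jump_integral_diff:
  fixes T :: "(real ^ 'n) set set"
  assumes T: "finite T" "\<And>K. K \<in> T \<Longrightarrow> int CARD('n) simplex K" and F: "F \<in> interior_faces \<Omega> T"
    and p: "\<And>K. K \<in> T \<Longrightarrow> real_polynomial_function (p K)" "\<And>K x. K \<in> T \<Longrightarrow> x \<in> K \<Longrightarrow> w x = p K x"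
    and q: "\<And>K. K \<in> T \<Longrightarrow> real_polynomial_function (q K)" "\<And>K x. K \<in> T \<Longrightarrow> x \<in> K \<Longrightarrow> v x = q K x"
  defines "z \<equiv> \<lambda>x. w x - v x"
  shows "(LINT x|face_measure F. grad_jump T F w x * (tangential_laplacian F z x - lam * z x))
       - (LINT x|face_measure F. grad_jump T F v x * (tangential_laplacian F z x - lam * z x))
       = (LINT x|face_measure F. grad_jump T F z x * (tangential_laplacian F z x - lam * z x))"
proof -
  let ?S = "{K\<in>T. F facet_of K}"
  obtain K0 where K0: "K0 \<in> T" "F facet_of K0" using F unfolding interior_faces_def by blast
  note cF = facet_compact_convex[OF T(2)[OF K0(1)] K0(2)]
  have bF: "F \<in> sets borel" using cF(1) by (rule borel_compact)
  have FK: "x \<in> K" if "x \<in> F" "K \<in> ?S" for x K using that facet_of_imp_subset by blast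
  have Jp: "grad_jump T F w x = jump_poly T F p x" and Jq: "grad_jump T F v x = jump_poly T F q x" if "x \<in> F" for x
    by (rule grad_jump_poly; use T(2) p q that in auto)+
  have jd: "grad_jump T F z x = grad_jump T F w x - grad_jump T F v x" if "x \<in> F" for x
    unfolding grad_jump_def z_def sum_subtractf[symmetric]
  proof (intro sum.cong refl)
    fix K assume K: "K \<in> ?S"
    then have KT: "K \<in> T" by simp
    show "grad_on K (\<lambda>x. w x - v x) x \<bullet> outer_normal K F = grad_on K w x \<bullet> outer_normal K F - grad_on K v x \<bullet> outer_normal K F"
      by (simp add: grad_on_diff_poly[OF T(2)[OF KT] FK[OF that K] p[OF KT] q[OF KT]] inner_diff_left)
  qed
  let ?r = "\<lambda>x. p K0 x - q K0 x"
  have rr: "real_polynomial_function ?r" by (intro real_polynomial_function_diff p(1) q(1) K0(1))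
  have zr: "z x = ?r x" if "x \<in> F" for x using p(2)[OF K0(1)] q(2)[OF K0(1)] FK[OF that] K0 by (simp add: z_def)
  let ?e = "\<lambda>x. (\<Sum>t\<in>tangent_basis F. dderiv t (dderiv t ?r) x) - lam * ?r x"
  have fB: "finite (tangent_basis F)" by (rule orthonormal_finite[OF tangent_basis(1)])
  have E: "tangential_laplacian F z x - lam * z x = ?e x" if "x \<in> F" for x
    using tangential_laplacian_poly[OF cF(2) that rr zr] zr[OF that] by simp
  have ce: "continuous_on UNIV ?e" by (intro continuous_intros continuous_on_poly real_polynomial_function_dderiv rr)
  have cw: "continuous_on UNIV (\<lambda>x. jump_poly T F p x * ?e x)" and cv: "continuous_on UNIV (\<lambda>x. - 1 * (jump_poly T F q x * ?e x))"
    using ce by (auto intro!: continuous_intros continuous_on_poly[OF real_polynomial_function_jump_poly[OF T(1)]] p(1) q(1))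
  have "(LINT x|face_measure F. grad_jump T F w x * (tangential_laplacian F z x - lam * z x)) = (LINT x|face_measure F. jump_poly T F p x * ?e x)"
    by (rule integral_face_cong[OF bF]) (simp add: E Jp)
  moreover have "(LINT x|face_measure F. grad_jump T F v x * (tangential_laplacian F z x - lam * z x)) = (LINT x|face_measure F. jump_poly T F q x * ?e x)"
    by (rule integral_face_cong[OF bF]) (simp add: E Jq)
  moreover have "(LINT x|face_measure F. grad_jump T F z x * (tangential_laplacian F z x - lam * z x)) = (LINT x|face_measure F. jump_poly T F p x * ?e x + - 1 * (jump_poly T F q x * ?e x))"
    by (rule integral_face_cong[OF bF]) (simp add: E jd Jp Jq left_diff_distrib)
  moreover have "\<dots> = (LINT x|face_measure F. jump_poly T F p x * ?e x) + (LINT x|face_measure F. - 1 * (jump_poly T F q x * ?e x))"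
    by (rule integral_face_add[OF cF(1) cw cv])
  moreover have "(LINT x|face_measure F. - 1 * (jump_poly T F q x * ?e x)) = - (LINT x|face_measure F. jump_poly T F q x * ?e x)" by simp
  ultimately show ?thesis by linarith
qed

theorem lemma5p1:
  fixes \<Omega> :: "(real ^ 'n) set"
    and T :: "(real ^ 'n) set set"
    and \<sigma> :: real
    and k :: nat
    and \<Lambda> :: "'l::metric_space set"
    and A :: "'l \<Rightarrow> real ^ 'n \<Rightarrow> real ^ 'n ^ 'n"
    and b :: "'l \<Rightarrow> real ^ 'n \<Rightarrow> real ^ 'n"
    and c f :: "'l \<Rightarrow> real ^ 'n \<Rightarrow> real"
    and eps lam :: real
    and w v :: "real ^ 'n \<Rightarrow> real"
  assumes "CARD('n) = 2 \<and> k \<ge> 3 \<or> CARD('n) = 3 \<and> k \<ge> 5"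
    and "bounded \<Omega>" and "open \<Omega>" and "convex \<Omega>" and "polytope (closure \<Omega>)"
    and "conforming_mesh \<Omega> T" and "\<sigma> > 0" and "shape_regular \<sigma> T"
    and "compact \<Lambda>" and "\<Lambda> \<noteq> {}"
    and "continuous_on (closure \<Omega> \<times> \<Lambda>) (\<lambda>(x, \<alpha>). A \<alpha> x)"
    and "continuous_on (closure \<Omega> \<times> \<Lambda>) (\<lambda>(x, \<alpha>). b \<alpha> x)"
    and "continuous_on (closure \<Omega> \<times> \<Lambda>) (\<lambda>(x, \<alpha>). c \<alpha> x)"
    and "uniformly_elliptic \<Omega> \<Lambda> A"
    and "cordes \<Omega> \<Lambda> A b c eps lam"
    and "admissible_rhs \<Omega> \<Lambda> A b c f lam"
    and "w \<in> fe_space \<Omega> T k" and "v \<in> fe_space \<Omega> T k"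
  shows "M_h \<Omega> T \<Lambda> A b c f eps lam w (\<lambda>x. w x - v x) - M_h \<Omega> T \<Lambda> A b c f eps lam v (\<lambda>x. w x - v x)
         \<ge> (1 - sqrt (1 - eps)) * norm_h_sq T lam (\<lambda>x. w x - v x)"
proof -
  note n = assms(1) and bO = assms(2) and oO = assms(3) and vO = assms(4) and mesh = assms(6) and ne = assms(10)
    and cA = assms(11) and cb = assms(12) and cc = assms(13) and ell = assms(14) and cor = assms(15) and rhs = assms(16)
    and w = assms(17) and v = assms(18)
  note T = conforming_meshD[OF mesh]
  have n23: "CARD('n) = 2 \<or> CARD('n) = 3" using n by blast
  have IK: "interior K \<subseteq> \<Omega>" if "K \<in> T" for K by (rule interior_element_subset[OF mesh oO vO that])
  obtain p where p: "\<And>K. K \<in> T \<Longrightarrow> real_polynomial_function (p K)" "\<And>K x. K \<in> T \<Longrightarrow> x \<in> K \<Longrightarrow> w x = p K x"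
    using bchoice[of T "\<lambda>K p. real_polynomial_function p \<and> (\<forall>x\<in>K. w x = p x)"] fe_space_poly[OF w] by blast
  obtain q where q: "\<And>K. K \<in> T \<Longrightarrow> real_polynomial_function (q K)" "\<And>K x. K \<in> T \<Longrightarrow> x \<in> K \<Longrightarrow> v x = q K x"
    using bchoice[of T "\<lambda>K p. real_polynomial_function p \<and> (\<forall>x\<in>K. v x = p x)"] fe_space_poly[OF v] by blast
  let ?z = "\<lambda>x. w x - v x" let ?P = "\<lambda>K x. p K x - q K x" let ?\<delta> = "sqrt (1 - eps)"
  have P: "real_polynomial_function (?P K)" "\<And>x. x \<in> K \<Longrightarrow> ?z x = ?P K x" if "K \<in> T" for K
    using p q that by (auto intro: real_polynomial_function_diff)
  have C1: "C1_at T S ?z" if K: "K \<in> T" and S: "S face_of K" "aff_dim S = int CARD('n) - 2" for K S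
    unfolding C1_at_def
  proof (intro ballI impI)
    fix L L' x assume L: "L \<in> T" "L' \<in> T" "S \<subseteq> L \<and> S \<subseteq> L'" "x \<in> S"
    have x: "x \<in> L" "x \<in> L'" using L by auto
    have "grad_on L w x = grad_on L' w x" "grad_on L v x = grad_on L' v x"
      using fe_space_C1[OF n23 w K S, unfolded C1_at_def, rule_format, OF L]
        fe_space_C1[OF n23 v K S, unfolded C1_at_def, rule_format, OF L] .
    then show "grad_on L ?z x = grad_on L' ?z x"
      using grad_on_diff_poly[OF T(2)[OF L(1)] x(1) p[OF L(1)] q[OF L(1)]] grad_on_diff_poly[OF T(2)[OF L(2)] x(2) p[OF L(2)] q[OF L(2)]]
      by simp
  qed
  have bd: "?z x = 0" if K: "K \<in> T" and F: "F facet_of K" "F \<subseteq> frontier \<Omega>" "x \<in> F" for K F x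
  proof -
    have H: "w \<in> H10 \<Omega>" "v \<in> H10 \<Omega>" using w v by (simp_all add: fe_space_def)
    have "w x = 0" by (rule H10_boundary_zero[OF oO bO H(1) T(2)[OF K] IK[OF K] p[OF K] F])
    moreover have "v x = 0" by (rule H10_boundary_zero[OF oO bO H(2) T(2)[OF K] IK[OF K] q[OF K] F])
    ultimately show ?thesis by simp
  qed
  define S where "S = (\<Sum>K\<in>T. LINT x|lborel. indicator K x * (laplacian (?P K) x - lam * ?P K x)\<^sup>2)"
  define N where "N = (\<Sum>K\<in>T. LINT x|lborel. indicator K x * ((norm (hessian (?P K) x))\<^sup>2 + 2 * lam * (norm (gradient (?P K) x))\<^sup>2 + lam\<^sup>2 * (?P K x)\<^sup>2))"
  define J where "J = (\<Sum>F\<in>interior_faces \<Omega> T. LINT x|face_measure F. grad_jump T F ?z x * (tangential_laplacian F ?z x - lam * ?z x))"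
  have S: "S = N + 2 * J"
    unfolding S_def N_def J_def by (rule mesh_identity[OF mesh oO vO P C1 bd])
  have N: "norm_h_sq T lam ?z = N"
    unfolding N_def by (rule norm_h_sq_poly[OF T(2) P])
  let ?I = "\<lambda>K u. LINT x|lebesgue_on K. F_gamma \<Omega> \<Lambda> A b c f lam x (u x) (grad_on K u x) (hess_on K u x) * L_lam K lam ?z x"
  let ?J = "\<lambda>F u. LINT x|face_measure F. grad_jump T F u x * (tangential_laplacian F ?z x - lam * ?z x)"
  have "(\<Sum>K\<in>T. ?I K w - ?I K v) \<ge> (\<Sum>K\<in>T. (1 - ?\<delta> / 2) * (LINT x|lborel. indicator K x * (laplacian (?P K) x - lam * ?P K x)\<^sup>2)
     - ?\<delta> / 2 * (LINT x|lborel. indicator K x * ((norm (hessian (?P K) x))\<^sup>2 + 2 * lam * (norm (gradient (?P K) x))\<^sup>2 + lam\<^sup>2 * (?P K x)\<^sup>2)))"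
    by (intro sum_mono element_estimate[OF oO ne cA cb cc ell cor rhs] T(2) IK p q)
  then have vol: "(\<Sum>K\<in>T. ?I K w - ?I K v) \<ge> (1 - ?\<delta> / 2) * S - ?\<delta> / 2 * N"
    unfolding S_def N_def by (simp only: sum_subtractf sum_distrib_left)
  have jumps: "(\<Sum>F\<in>interior_faces \<Omega> T. ?J F w - ?J F v) = J"
    unfolding J_def by (intro sum.cong refl jump_integral_diff[OF T(1,2) _ p q])
  have "M_h \<Omega> T \<Lambda> A b c f eps lam w ?z - M_h \<Omega> T \<Lambda> A b c f eps lam v ?z
    = (\<Sum>K\<in>T. ?I K w - ?I K v) - (2 - ?\<delta>) * (\<Sum>F\<in>interior_faces \<Omega> T. ?J F w - ?J F v)"
    unfolding M_h_def sum_subtractf by (simp only: right_diff_distrib)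
  also have "\<dots> \<ge> (1 - ?\<delta> / 2) * S - ?\<delta> / 2 * N - (2 - ?\<delta>) * J"
    using vol unfolding jumps by linarith
  \<comment> \<open>inserting S = N + 2 J, the terms with J cancel\<close>
  also have "(1 - ?\<delta> / 2) * S - ?\<delta> / 2 * N - (2 - ?\<delta>) * J = (1 - ?\<delta>) * N"
    unfolding S by (simp add: field_simps)
  finally show ?thesis unfolding N by simp
qed

end
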